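(* Let $I=(\mathbf{x}^{\mathbf{a}_1},\dots,\mathbf{x}^{\mathbf{a}_d})$ be a minimal reduction ideal of $\mathfrak{m}$. If $\mathrm{gr}_{\mathfrak{m}}(R)$ is Cohen-Macaulay, then $r_I(R)\leq e(R)-\mathrm{codim}(R)$.
   Context: Let $d\ge 1$, let $\mathbb{N}$ be the set of non-negative integers, and let $S\subseteq\mathbb{N}^d$ be an affine (finitely generated) semigroup containing $\mathbf 0$, fully embedded in $\mathbb{N}^d$ (i.e. of dimension $d$: $S$ spans $\mathbb{R}^d$), and simplicial: the cone $\mathrm{cone}(S)\subseteq\mathbb{R}^d_{\ge0}$ of non-negative real combinations of elements of $S$ has exactly $d$ extremal rays. Its minimal generating set is $\{\mathbf{a}_1,\dots,\mathbf{a}_{d+s}\}$, where $\mathbf{a}_1,\dots,\mathbf{a}_d$ are the extremal rays of $S$, i.e. the smallest nonzero elements of $S$ lying on each of the $d$ extremal rays of the cone. Let $\mathbb{K}$ be a field. For $\mathbf a=(a_1,\dots,a_d)\in\mathbb{N}^d$ put $\mathbf{x}^{\mathbf{a}}=x_1^{a_1}\cdots x_d^{a_d}$. Let $R=\mathbb{K}[S]=\mathbb{K}[\mathbf{x}^{\mathbf{a}_1},\dots,\mathbf{x}^{\mathbf{a}_{d+s}}]\subseteq\mathbb{K}[x_1,\dots,x_d]$ (of Krull dimension $d$), $\mathfrak{m}=(\mathbf{x}^{\mathbf{a}_1},\dots,\mathbf{x}^{\mathbf{a}_{d+s}})$ and $\mathrm{gr}_{\mathfrak{m}}(R)=\bigoplus_{i\ge0}\mathfrak{m}^i/\mathfrak{m}^{i+1}$.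 Here $\mathrm{codim}(R)$ is the embedding dimension $d+s$ minus $\dim R=d$, so $\mathrm{codim}(R)=s$. The multiplicity of $R$ is $e(R)=e(\mathfrak{m})=\lim_{n\to\infty}\frac{d!}{n^d}\lambda_R(R/\mathfrak{m}^n)$, where $\lambda_R$ denotes length. An ideal $J\subseteq\mathfrak{m}$ of $R$ is a reduction ideal of $\mathfrak{m}$ if $\mathfrak{m}^{n+1}=J\mathfrak{m}^n$ for $n\gg0$; it is a minimal reduction ideal if it is minimal among reduction ideals with respect to inclusion. For a minimal reduction ideal $J$, the reduction number $r_J(R)$ is the smallest positive integer $r$ such that $\mathfrak{m}^{n+1}=J\mathfrak{m}^n$ for all $n\geq r$. *)

theory Defs
  imports
    "HOL-Analysis.Analysis"
    "HOL-Algebra.Module"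
    "HOL-Algebra.QuotRing"
    "HOL-Algebra.Ideal_Product"
    "HOL-Algebra.Ring_Divisibility"
    "HOL-Library.Poly_Mapping"
begin

section \<open>Simplicial affine semigroups\<close>

text \<open>The semigroup \<open>S\<close> is a subset of \<^typ>\<open>nat ^ 'd\<close>, so \<open>d\<close> is \<open>CARD('d) \<ge> 1\<close>.\<close>

definition nat_span :: "(nat ^ 'd) set \<Rightarrow> (nat ^ 'd) set" where
  "nat_span A = {\<Sum>a\<in>F. c a *s a | F c. finite F \<and> F \<subseteq> A}"

definition minimal_generating_set :: "(nat ^ 'd) set \<Rightarrow> (nat ^ 'd) set \<Rightarrow> bool" where
  "minimal_generating_set A S \<longleftrightarrow>
     finite A \<and> nat_span A = S \<and> (\<forall>B. B \<subset> A \<longrightarrow> nat_span B \<noteq> S)"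

definition real_vec :: "nat ^ 'd \<Rightarrow> real ^ 'd" where
  "real_vec a = (\<chi> i. real (a $ i))"

definition semigroup_cone :: "(nat ^ 'd) set \<Rightarrow> (real ^ 'd) set" where
  "semigroup_cone S =
     {\<Sum>a\<in>F. c a *\<^sub>R real_vec a | F c. finite F \<and> F \<subseteq> S \<and> (\<forall>a\<in>F. (0::real) \<le> c a)}"

definition extremal_rays :: "(real ^ 'd) set \<Rightarrow> (real ^ 'd) set set" where
  "extremal_rays C = {F. F face_of C \<and> (\<exists>u. u \<noteq> 0 \<and> F = {t *\<^sub>R u | t. 0 \<le> t})}"

definition simplicial_affine_semigroup :: "(nat ^ 'd) set \<Rightarrow> bool" where
  "simplicial_affine_semigroup S \<longleftrightarrow>
     (\<exists>F. finite F \<and> S = nat_span F) \<and>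
     span (real_vec ` S) = UNIV \<and>
     card (extremal_rays (semigroup_cone S)) = CARD('d)"

text \<open>The elements \<open>a\<^sub>1, \<dots>, a\<^sub>d\<close>: on each extremal ray of the cone, the smallest nonzero
  element of \<open>S\<close>. The order on vectors is componentwise; it is total on each ray.\<close>

definition extremal_elements :: "(nat ^ 'd) set \<Rightarrow> (nat ^ 'd) set" where
  "extremal_elements S =
     {a. \<exists>F \<in> extremal_rays (semigroup_cone S).
           a \<in> S \<and> a \<noteq> 0 \<and> real_vec a \<in> F \<and>
           (\<forall>b\<in>S. b \<noteq> 0 \<and> real_vec b \<in> F \<longrightarrow> a \<le> b)}"


section \<open>The semigroup ring\<close>

text \<open>\<^typ>\<open>(nat ^ 'd) \<Rightarrow>\<^sub>0 'k\<close> is the polynomial ring over \<open>'k\<close> in variables indexed by \<open>'d\<close>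
  (finitely supported functions on exponent vectors, with convolution product).\<close>

definition monom_of :: "nat ^ 'd \<Rightarrow> (nat ^ 'd) \<Rightarrow>\<^sub>0 'k::field" where
  "monom_of a = Poly_Mapping.single a 1"

definition semigroup_ring :: "(nat ^ 'd) set \<Rightarrow> ((nat ^ 'd) \<Rightarrow>\<^sub>0 'k::field) ring" where
  "semigroup_ring S =
     \<lparr>carrier = {f. Poly_Mapping.keys f \<subseteq> S}, mult = (*), one = 1, zero = 0, add = (+)\<rparr>"

lemma nat_span_zero: "0 \<in> nat_span A"
  unfolding nat_span_def by (rule CollectI, rule exI[of _ "{}"]) auto

lemma nat_span_superset: "a \<in> A \<Longrightarrow> a \<in> nat_span A"
  unfolding nat_span_def
  by (rule CollectI, rule exI[of _ "{a}"], rule exI[of _ "\<lambda>_. 1"])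
     (auto simp: vector_scalar_mult_def vec_eq_iff)

lemma nat_span_add:
  assumes "x \<in> nat_span A" and "y \<in> nat_span A"
  shows "x + y \<in> nat_span A"
proof -
  obtain F c where F: "finite F" "F \<subseteq> A" "x = (\<Sum>a\<in>F. c a *s a)"
    using assms(1) unfolding nat_span_def by auto
  obtain G e where G: "finite G" "G \<subseteq> A" "y = (\<Sum>a\<in>G. e a *s a)"
    using assms(2) unfolding nat_span_def by auto
  let ?c = "\<lambda>a. if a \<in> F then c a else 0" and ?e = "\<lambda>a. if a \<in> G then e a else 0"
  have x: "x = (\<Sum>a\<in>F \<union> G. ?c a *s a)"
    unfolding F(3) by (rule sum.mono_neutral_cong_left)
      (use F G in \<open>auto simp: vector_scalar_mult_def vec_eq_iff\<close>)
  have y: "y = (\<Sum>a\<in>F \<union> G. ?e a *s a)"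
    unfolding G(3) by (rule sum.mono_neutral_cong_left)
      (use F G in \<open>auto simp: vector_scalar_mult_def vec_eq_iff\<close>)
  have "x + y = (\<Sum>a\<in>F \<union> G. (?c a + ?e a) *s a)"
    unfolding x y sum.distrib[symmetric]
    by (rule sum.cong) (auto simp: vector_scalar_mult_def vec_eq_iff algebra_simps)
  then show ?thesis
    unfolding nat_span_def using F G
    by (intro CollectI exI[of _ "F \<union> G"] exI[of _ "\<lambda>a. ?c a + ?e a"]) auto
qed

lemma cring_semigroup_ring: "cring (semigroup_ring (nat_span A) :: ((nat ^ 'd) \<Rightarrow>\<^sub>0 'k::field) ring)"
proof (rule cringI)
  show "abelian_group (semigroup_ring (nat_span A) :: ((nat ^ 'd) \<Rightarrow>\<^sub>0 'k) ring)"
  proof (rule abelian_groupI)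
    fix x :: "(nat ^ 'd) \<Rightarrow>\<^sub>0 'k"
    assume "x \<in> carrier (semigroup_ring (nat_span A))"
    then show "\<exists>y\<in>carrier (semigroup_ring (nat_span A)).
        y \<oplus>\<^bsub>semigroup_ring (nat_span A)\<^esub> x = \<zero>\<^bsub>semigroup_ring (nat_span A)\<^esub>"
      by (intro bexI[of _ "- x"]) (auto simp: semigroup_ring_def)
  qed (use Poly_Mapping.keys_add in \<open>fastforce simp: semigroup_ring_def algebra_simps\<close>)+
  show "comm_monoid (semigroup_ring (nat_span A) :: ((nat ^ 'd) \<Rightarrow>\<^sub>0 'k) ring)"
  proof (rule comm_monoidI)
    fix x y :: "(nat ^ 'd) \<Rightarrow>\<^sub>0 'k"
    assume "x \<in> carrier (semigroup_ring (nat_span A))" "y \<in> carrier (semigroup_ring (nat_span A))"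
    then show "x \<otimes>\<^bsub>semigroup_ring (nat_span A)\<^esub> y \<in> carrier (semigroup_ring (nat_span A))"
      using Poly_Mapping.keys_mult[of x y] nat_span_add by (fastforce simp: semigroup_ring_def)
  qed (auto simp: semigroup_ring_def algebra_simps nat_span_zero)
qed (auto simp: semigroup_ring_def algebra_simps)

text \<open>The carrier of the semigroup ring is the \<open>K\<close>-subalgebra generated by the monomials
  of any generating set of the semigroup.\<close>

lemma semigroup_ring_least:
  fixes T :: "((nat ^ 'd) \<Rightarrow>\<^sub>0 'k::field) set"
  assumes const: "\<And>c. Poly_Mapping.single 0 c \<in> T"
    and gen: "\<And>a. a \<in> A \<Longrightarrow> monom_of a \<in> T"
    and add: "\<And>f g. f \<in> T \<Longrightarrow> g \<in> T \<Longrightarrow> f + g \<in> T"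
    and mult: "\<And>f g. f \<in> T \<Longrightarrow> g \<in> T \<Longrightarrow> f * g \<in> T"
  shows "carrier (semigroup_ring (nat_span A)) \<subseteq> T"
proof -
  have mm: "monom_of (a + b) = (monom_of a * monom_of b :: (nat ^ 'd) \<Rightarrow>\<^sub>0 'k)" for a b
    by (simp add: monom_of_def Poly_Mapping.mult_single)
  have m0: "monom_of 0 \<in> T" using const[of 1] by (simp add: monom_of_def)
  have scale: "monom_of (n *s a) \<in> T" if "a \<in> A" for n :: nat and a
  proof (induction n)
    case 0
    have "(0::nat) *s a = 0" by (simp add: vector_scalar_mult_def vec_eq_iff)
    then show ?case using m0 by simp
  next
    case (Suc n)
    have "Suc n *s a = a + n *s a" by (simp add: vector_scalar_mult_def vec_eq_iff)
    then show ?case using Suc mult gen that by (simp add: mm)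
  qed
  have "monom_of (\<Sum>a\<in>F. c a *s a) \<in> T" if "finite F" "F \<subseteq> A" for F and c :: "nat ^ 'd \<Rightarrow> nat"
    using that by (induction F rule: finite_induct) (auto simp: m0 mm mult scale)
  then have mon: "monom_of a \<in> T" if "a \<in> nat_span A" for a
    using that unfolding nat_span_def by auto
  have single: "Poly_Mapping.single a c \<in> T" if "a \<in> nat_span A" for a c
  proof -
    have "Poly_Mapping.single a c = Poly_Mapping.single 0 c * monom_of a"
      by (simp add: monom_of_def Poly_Mapping.mult_single)
    then show ?thesis using mult const mon that by simp
  qed
  show ?thesis
  proof
    fix f :: "(nat ^ 'd) \<Rightarrow>\<^sub>0 'k"
    assume f: "f \<in> carrier (semigroup_ring (nat_span A))"
    have "(\<Sum>a\<in>F. Poly_Mapping.single a (Poly_Mapping.lookup f a)) \<in> T"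
      if "finite F" "F \<subseteq> nat_span A" for F
      using that
    proof (induction F rule: finite_induct)
      case empty
      show ?case using const[of 0] by simp
    qed (auto simp: add single)
    then have "(\<Sum>a\<in>Poly_Mapping.keys f. Poly_Mapping.single a (Poly_Mapping.lookup f a)) \<in> T"
      using f by (simp add: semigroup_ring_def)
    moreover have "(\<Sum>a\<in>Poly_Mapping.keys f. Poly_Mapping.single a (Poly_Mapping.lookup f a)) = f"
    proof (rule poly_mapping_eqI)
      fix k
      show "Poly_Mapping.lookup (\<Sum>a\<in>Poly_Mapping.keys f.
          Poly_Mapping.single a (Poly_Mapping.lookup f a)) k = Poly_Mapping.lookup f k"
        by (simp add: Poly_Mapping.lookup_sum lookup_single when_def in_keys_iff sum.delta)
    qed
    ultimately show "f \<in> T" by simp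
  qed
qed


section \<open>Reductions, length and multiplicity\<close>

primrec ideal_power :: "('a, 'b) ring_scheme \<Rightarrow> 'a set \<Rightarrow> nat \<Rightarrow> 'a set" where
  "ideal_power R I 0 = carrier R"
| "ideal_power R I (Suc n) = ideal_prod R (ideal_power R I n) I"

definition reduction_ideal :: "('a, 'b) ring_scheme \<Rightarrow> 'a set \<Rightarrow> 'a set \<Rightarrow> bool" where
  "reduction_ideal R M J \<longleftrightarrow>
     ideal J R \<and> J \<subseteq> M \<and>
     (\<exists>N. \<forall>n\<ge>N. ideal_power R M (n + 1) = ideal_prod R J (ideal_power R M n))"

definition minimal_reduction_ideal :: "('a, 'b) ring_scheme \<Rightarrow> 'a set \<Rightarrow> 'a set \<Rightarrow> bool" where
  "minimal_reduction_ideal R M J \<longleftrightarrow>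
     reduction_ideal R M J \<and> (\<forall>J'. reduction_ideal R M J' \<and> J' \<subseteq> J \<longrightarrow> J' = J)"

definition reduction_number :: "('a, 'b) ring_scheme \<Rightarrow> 'a set \<Rightarrow> 'a set \<Rightarrow> nat" where
  "reduction_number R M J =
     (LEAST r. 0 < r \<and>
        (\<forall>n\<ge>r. ideal_power R M (n + 1) = ideal_prod R J (ideal_power R M n)))"

text \<open>The length of a module is the supremum of the lengths \<open>n\<close> of chains
  \<open>C\<^sub>0 \<subset> C\<^sub>1 \<subset> \<dots> \<subset> C\<^sub>n\<close> of submodules.\<close>

definition module_length :: "('a, 'b) ring_scheme \<Rightarrow> ('a, 'c, 'd) module_scheme \<Rightarrow> enat" where
  "module_length R M =
     Sup {enat n | n. \<exists>C :: nat \<Rightarrow> 'c set.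
            (\<forall>i\<le>n. submodule (C i) R M) \<and> (\<forall>i<n. C i \<subset> C (Suc i))}"

definition quot_module :: "('a, 'b) ring_scheme \<Rightarrow> 'a set \<Rightarrow> ('a, 'a set) module" where
  "quot_module R I =
     \<lparr>carrier = carrier (R Quot I), mult = mult (R Quot I), one = one (R Quot I),
      zero = zero (R Quot I), add = add (R Quot I),
      smult = (\<lambda>r X. (I +>\<^bsub>R\<^esub> r) \<otimes>\<^bsub>R Quot I\<^esub> X)\<rparr>"

lemma module_quot_module:
  assumes "cring R" and "ideal I R"
  shows "module R (quot_module R I)"
proof -
  interpret R: cring R by fact
  interpret I: ideal I R by fact
  interpret Q: cring "R Quot I" by (rule I.quotient_is_cring[OF assms(1)])
  have hom: "(+>\<^bsub>R\<^esub>) I \<in> ring_hom R (R Quot I)"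
    by (rule I.rcos_ring_hom)
  note h = ring_hom_closed[OF hom] ring_hom_add[OF hom] ring_hom_mult[OF hom] ring_hom_one[OF hom]
  have ag: "abelian_group (quot_module R I)"
    by (rule abelian_groupI)
       (use Q.a_assoc Q.a_comm Q.l_neg Q.a_inv_closed in \<open>auto simp: quot_module_def\<close>)
  show ?thesis
    by (rule moduleI[OF assms(1) ag])
       (auto simp: quot_module_def h Q.l_distr Q.r_distr Q.m_assoc)
qed

text \<open>The multiplicity of \<open>R\<close> with respect to \<open>M\<close>, where \<open>d\<close> is the dimension of \<open>R\<close>.\<close>

definition multiplicity_of :: "nat \<Rightarrow> ('a, 'b) ring_scheme \<Rightarrow> 'a set \<Rightarrow> ereal" where
  "multiplicity_of d R M =
     lim (\<lambda>n. ereal (fact d / real n ^ d) *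
              ereal_of_enat (module_length R (quot_module R (ideal_power R M n))))"


section \<open>Dimension and the Cohen-Macaulay property\<close>

definition krull_dim :: "('a, 'b) ring_scheme \<Rightarrow> enat" where
  "krull_dim R =
     Sup {enat n | n. \<exists>C :: nat \<Rightarrow> 'a set.
            (\<forall>i\<le>n. primeideal (C i) R) \<and> (\<forall>i<n. C i \<subset> C (Suc i))}"

definition ideal_height :: "('a, 'b) ring_scheme \<Rightarrow> 'a set \<Rightarrow> enat" where
  "ideal_height R P =
     Sup {enat n | n. \<exists>C :: nat \<Rightarrow> 'a set.
            (\<forall>i\<le>n. primeideal (C i) R) \<and> (\<forall>i<n. C i \<subset> C (Suc i)) \<and> C n = P}"
  \<comment> \<open>for a prime ideal \<open>P\<close>\<close>

definition regular_sequence :: "('a, 'b) ring_scheme \<Rightarrow> 'a list \<Rightarrow> bool" where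
  "regular_sequence R xs \<longleftrightarrow>
     set xs \<subseteq> carrier R \<and>
     (\<forall>i<length xs. \<forall>y\<in>carrier R.
        (xs ! i) \<otimes>\<^bsub>R\<^esub> y \<in> Idl\<^bsub>R\<^esub> (set (take i xs)) \<longrightarrow> y \<in> Idl\<^bsub>R\<^esub> (set (take i xs))) \<and>
     Idl\<^bsub>R\<^esub> (set xs) \<noteq> carrier R"

definition ideal_depth :: "('a, 'b) ring_scheme \<Rightarrow> 'a set \<Rightarrow> enat" where
  "ideal_depth R P = Sup {enat (length xs) | xs. regular_sequence R xs \<and> set xs \<subseteq> P}"

text \<open>A Noetherian commutative ring is Cohen-Macaulay if \<open>depth(P, R) = height(P)\<close> for every
  maximal ideal \<open>P\<close>. (As depth and height of a maximal ideal are preserved by localization at it,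
  this says that the localizations of \<open>R\<close> at all maximal ideals are Cohen-Macaulay.)\<close>

definition cohen_macaulay :: "('a, 'b) ring_scheme \<Rightarrow> bool" where
  "cohen_macaulay R \<longleftrightarrow>
     cring R \<and> noetherian_ring R \<and>
     (\<forall>P. maximalideal P R \<longrightarrow> ideal_depth R P = ideal_height R P)"


section \<open>The associated graded ring\<close>

text \<open>An element of the direct sum of the \<open>M\<^sup>i / M\<^sup>i\<^sup>+\<^sup>1\<close> is a finitely supported family of cosets
  \<open>f i = M\<^sup>i\<^sup>+\<^sup>1 + x\<close> with \<open>x \<in> M\<^sup>i\<close>. The product of homogeneous components of degrees \<open>i\<close> and
  \<open>k - i\<close> is the coset of \<open>M\<^sup>k\<^sup>+\<^sup>1\<close> spanned by the products of representatives, which is what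
  \<^const>\<open>rcoset_mult\<close> modulo \<open>M\<^sup>k\<^sup>+\<^sup>1\<close> computes.\<close>

definition assoc_graded :: "('a, 'b) ring_scheme \<Rightarrow> 'a set \<Rightarrow> (nat \<Rightarrow> 'a set) ring" where
  "assoc_graded R M =
     \<lparr>carrier = {f. (\<forall>i. f i \<in> (\<lambda>x. ideal_power R M (i + 1) +>\<^bsub>R\<^esub> x) ` ideal_power R M i) \<and>
                     finite {i. f i \<noteq> ideal_power R M (i + 1)}},
      mult = (\<lambda>f g k. finsum (R Quot ideal_power R M (k + 1))
                        (\<lambda>i. rcoset_mult R (ideal_power R M (k + 1)) (f i) (g (k - i))) {..k}),
      one = (\<lambda>k. if k = 0 then ideal_power R M 1 +>\<^bsub>R\<^esub> \<one>\<^bsub>R\<^esub> else ideal_power R M (k + 1)),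
      zero = (\<lambda>k. ideal_power R M (k + 1)),
      add = (\<lambda>f g k. f k \<oplus>\<^bsub>R Quot ideal_power R M (k + 1)\<^esub> g k)\<rparr>"


section \<open>Codimension\<close>

text \<open>The embedding dimension of the semigroup ring \<open>R = K[S]\<close> is the cardinality of the minimal
  generating set \<open>A\<close> of \<open>S\<close>.\<close>

definition codim_of :: "((nat ^ 'd) \<Rightarrow>\<^sub>0 'k::field) ring \<Rightarrow> (nat ^ 'd) set \<Rightarrow> ereal" where
  "codim_of R A = ereal (real (card A)) - ereal_of_enat (krull_dim R)"

end

theory Submission
  imports Defs
begin

text \<open>
  The ring \<open>R = K[S]\<close> and all ideals in the statement are spanned by monomials, so the proof
  is mostly about the semigroup. Let \<open>ord s\<close> be the largest number of generators with sum \<open>s\<close>;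
  the power \<open>\<mm>\<^sup>n\<close> is spanned by the monomials with \<open>ord s \<ge> n\<close>, and \<open>gr\<close> has a basis \<open>t\<^sup>s\<close>, \<open>s \<in> S\<close>, in
  which \<open>t\<^sup>s t\<^sup>u\<close> is \<open>t\<^sup>s\<^sup>+\<^sup>u\<close> or \<open>0\<close> according to whether \<open>ord (s + u) = ord s + ord u\<close>. Let \<open>E\<close> be the set of
  extremal elements, \<open>d\<close> the dimension.

  The key point is that for Cohen-Macaulay \<open>gr\<close> the initial forms of the monomials of \<open>E\<close> form a
  regular sequence, which means the following: \<open>ord (s + a) = ord s + 1\<close> for \<open>a \<in> E\<close>, and if
  \<open>s + a = t + b\<close> with distinct \<open>a, b \<in> E\<close>, then \<open>s \<in> S + b\<close>
  (\<open>ord_add_extremal\<close>, \<open>extremal_exchange\<close>). Then every element of \<open>S\<close> is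
  uniquely \<open>w + \<Sum> n\<^sub>a a\<close> with \<open>w\<close> in the Apery set \<open>S - (E + S)\<close>, and its order is \<open>ord w + \<Sum> n\<^sub>a\<close>. So
  the length of \<open>R / \<mm>\<^sup>n\<close>, which is the number of elements of order below \<open>n\<close>, is a sum of binomial
  coefficients, one for each \<open>w\<close>, and the multiplicity is the cardinality of the Apery set
  (\<open>hilbert_samuel_limit\<close>). The reduction number is the largest order in the Apery set, or \<open>1\<close>. Divisors of
  Apery elements are Apery elements, so each smaller order occurs as well; together with the
  generators outside \<open>E\<close>, which all have order \<open>1\<close>, this bounds the cardinality of the Apery set from
  below by the sum of the codimension and the reduction number (\<open>card_Apery_ge\<close>).

  The regular sequence comes from depth sensitivity of the Koszul complex
  (\<open>koszul_relations_trivial\<close>). The irrelevant maximal ideal of \<open>gr\<close> has height at least \<open>d\<close>, as witnessed by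
  monomial primes belonging to faces of the cone (\<open>height_gr_prime_0\<close>); hence it contains some regular
  sequence of length at least \<open>d\<close>. Its members are nilpotent modulo the initial forms \<open>y\<^sub>1, \<dots>, y\<^sub>d\<close> of the
  extremal monomials, because those generate a reduction. Therefore \<open>H\<^sub>1(y; gr) = 0\<close>: every relation
  between the \<open>y\<^sub>i\<close> is a combination of the trivial ones. In a single multidegree this is a statement
  about alternating matrices of scalars with prescribed row sums, and as the sum of all entries of
  such a matrix vanishes, the two properties of the order follow by induction.

  To avoid computing in families of cosets, \<open>gr\<close> is treated throughout as the quotient of the Rees
  algebra, which is again spanned by monomials, with exponents in \<open>\<nat>\<^sup>d \<times> \<nat>\<close>.

  That the cone is spanned by the extremal elements, and that these are linearly independent, is
  deduced from the reduction property: up to finitely many remainders, every element of \<open>S\<close> is a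
  sum of elements of \<open>E\<close> (\<open>coordinates_exist\<close>).
\<close>

section \<open>Rings spanned by monomials\<close>

abbreviation "keys \<equiv> Poly_Mapping.keys"
abbreviation "lookup \<equiv> Poly_Mapping.lookup"
abbreviation "single \<equiv> Poly_Mapping.single"

text \<open>The exponents are kept in an arbitrary commutative monoid, because the arguments below are
  needed twice: for the semigroup ring itself, with exponents in \<open>\<nat>\<^sup>d\<close>, and for its Rees algebra,
  with exponents in \<open>\<nat>\<^sup>d \<times> \<nat>\<close>.\<close>

definition monoid_ring :: "'m::comm_monoid_add set \<Rightarrow> ('m \<Rightarrow>\<^sub>0 'k::field) ring" where
  "monoid_ring U =
     \<lparr>carrier = {f. keys f \<subseteq> U}, mult = (*), one = 1, zero = 0, add = (+)\<rparr>"

lemma semigroup_ring_eq_monoid_ring: "semigroup_ring S = monoid_ring S"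
  by (simp add: semigroup_ring_def monoid_ring_def)

lemma monoid_ring_simps [simp]:
  "carrier (monoid_ring U) = {f. keys f \<subseteq> U}"
  "mult (monoid_ring U) = (*)" "one (monoid_ring U) = 1"
  "zero (monoid_ring U) = 0" "add (monoid_ring U) = (+)"
  by (simp_all add: monoid_ring_def)

lemma keys_uminus_subset: "keys (- f) \<subseteq> U \<longleftrightarrow> keys f \<subseteq> U"
  for f :: "'m \<Rightarrow>\<^sub>0 'k::ab_group_add"
  by (simp add: subset_eq in_keys_iff)

lemma keys_add_subset:
  "keys f \<subseteq> U \<Longrightarrow> keys g \<subseteq> U \<Longrightarrow> keys (f + g) \<subseteq> U"
  using Poly_Mapping.keys_add[of f g] by blast

lemma keys_diff_subset:
  fixes f g :: "'m \<Rightarrow>\<^sub>0 'k::ab_group_add"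
  shows "keys f \<subseteq> U \<Longrightarrow> keys g \<subseteq> U \<Longrightarrow> keys (f - g) \<subseteq> U"
  by (auto simp: subset_eq in_keys_iff lookup_minus)

lemma keys_sum_subset:
  "(\<And>i. i \<in> I \<Longrightarrow> keys (f i) \<subseteq> U) \<Longrightarrow> keys (sum f I) \<subseteq> U"
proof (induction I rule: infinite_finite_induct)
  case (insert x F)
  then show ?case using keys_add_subset[of "f x" U "sum f F"] by simp
qed auto

lemma keys_mult_subset:
  fixes f g :: "'m::comm_monoid_add \<Rightarrow>\<^sub>0 'k::comm_ring_1"
  assumes "keys f \<subseteq> U" "keys g \<subseteq> V"
    and "\<And>u v. u \<in> U \<Longrightarrow> v \<in> V \<Longrightarrow> u + v \<in> W"
  shows "keys (f * g) \<subseteq> W"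
  using Poly_Mapping.keys_mult[of f g] assms by blast

lemma poly_mapping_sum_singles:
  "f = (\<Sum>a\<in>keys f. single a (lookup f a))"
proof (rule poly_mapping_eqI)
  fix k
  show "lookup f k = lookup
      (\<Sum>a\<in>keys f. single a (lookup f a)) k"
    by (simp add: Poly_Mapping.lookup_sum lookup_single when_def in_keys_iff sum.delta)
qed

lemma mult_as_double_sum:
  fixes f g :: "'m::comm_monoid_add \<Rightarrow>\<^sub>0 'k::comm_ring_1"
  shows "f * g = (\<Sum>a\<in>keys f. \<Sum>b\<in>keys g.
           single (a + b) (lookup f a * lookup g b))"
proof -
  have "f * g = (\<Sum>a\<in>keys f. single a (lookup f a)) *
                (\<Sum>b\<in>keys g. single b (lookup g b))"
    using poly_mapping_sum_singles[of f] poly_mapping_sum_singles[of g] by simp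
  then show ?thesis by (simp add: sum_product Poly_Mapping.mult_single)
qed

lemma lookup_mult_eq_sum:
  fixes f g :: "'m::comm_monoid_add \<Rightarrow>\<^sub>0 'k::comm_ring_1"
  shows "lookup (f * g) c = (\<Sum>a\<in>keys f. \<Sum>b\<in>keys g.
           if a + b = c then lookup f a * lookup g b else 0)"
  by (subst mult_as_double_sum) (simp add: Poly_Mapping.lookup_sum lookup_single when_def)

lemma lookup_single_mult:
  fixes f :: "'m::cancel_comm_monoid_add \<Rightarrow>\<^sub>0 'k::field"
  shows "lookup (single a c * f) (a + b) = c * lookup f b"
proof -
  have "lookup (single a c * f) (a + b) =
      (\<Sum>d\<in>keys f. if d = b then c * lookup f d else 0)"
    by (subst lookup_mult_eq_sum) (auto simp: if_distrib intro!: sum.cong)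
  then show ?thesis by (auto simp: in_keys_iff sum.delta)
qed

lemma lookup_single_mult_notin:
  fixes f :: "'m::cancel_comm_monoid_add \<Rightarrow>\<^sub>0 'k::field"
  assumes "\<nexists>b. q = a + b"
  shows "lookup (single a c * f) q = 0"
  by (subst lookup_mult_eq_sum) (use assms in \<open>auto intro!: sum.neutral\<close>)

locale add_submonoid =
  fixes U :: "'m::comm_monoid_add set"
  assumes zero_mem: "0 \<in> U" and add_mem: "\<And>x y. x \<in> U \<Longrightarrow> y \<in> U \<Longrightarrow> x + y \<in> U"
begin

lemma cring_monoid_ring: "cring (monoid_ring U :: ('m \<Rightarrow>\<^sub>0 'k::field) ring)"
proof (rule cringI)
  show "abelian_group (monoid_ring U :: ('m \<Rightarrow>\<^sub>0 'k) ring)"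
  proof (rule abelian_groupI)
    fix x :: "'m \<Rightarrow>\<^sub>0 'k"
    assume "x \<in> carrier (monoid_ring U)"
    then show "\<exists>y\<in>carrier (monoid_ring U). y \<oplus>\<^bsub>monoid_ring U\<^esub> x = \<zero>\<^bsub>monoid_ring U\<^esub>"
      by (intro bexI[of _ "- x"]) (auto simp: keys_uminus_subset)
  qed (auto simp: algebra_simps dest: subsetD[OF Poly_Mapping.keys_add])
  show "comm_monoid (monoid_ring U :: ('m \<Rightarrow>\<^sub>0 'k) ring)"
  proof (rule comm_monoidI)
    fix x y :: "'m \<Rightarrow>\<^sub>0 'k"
    assume "x \<in> carrier (monoid_ring U)" "y \<in> carrier (monoid_ring U)"
    then show "x \<otimes>\<^bsub>monoid_ring U\<^esub> y \<in> carrier (monoid_ring U)"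
      using Poly_Mapping.keys_mult[of x y] add_mem by fastforce
  qed (auto simp: algebra_simps zero_mem)
qed (auto simp: algebra_simps)

lemma finsum_monoid_ring:
  fixes f :: "'i \<Rightarrow> 'm \<Rightarrow>\<^sub>0 'k::field"
  assumes "finite I" "\<And>i. i \<in> I \<Longrightarrow> keys (f i) \<subseteq> U"
  shows "finsum (monoid_ring U) f I = sum f I"
proof -
  interpret cring "monoid_ring U :: ('m \<Rightarrow>\<^sub>0 'k) ring" by (rule cring_monoid_ring)
  show ?thesis
    using assms by (induction I rule: finite_induct) (auto simp: Pi_iff)
qed

lemma minus_monoid_ring:
  fixes f g :: "'m \<Rightarrow>\<^sub>0 'k::field"
  assumes "keys f \<subseteq> U" "keys g \<subseteq> U"
  shows "f \<ominus>\<^bsub>monoid_ring U\<^esub> g = f - g"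
proof -
  interpret cring "monoid_ring U :: ('m \<Rightarrow>\<^sub>0 'k) ring" by (rule cring_monoid_ring)
  have "\<ominus>\<^bsub>monoid_ring U\<^esub> g = - g"
    using assms by (intro sum_zero_eq_neg[symmetric]) (auto simp: keys_uminus_subset)
  then show ?thesis by (simp add: a_minus_def)
qed

lemma ideal_monomials:
  assumes "V \<subseteq> U" "\<And>u v. u \<in> U \<Longrightarrow> v \<in> V \<Longrightarrow> u + v \<in> V"
  shows "ideal {f :: 'm \<Rightarrow>\<^sub>0 'k::field. keys f \<subseteq> V} (monoid_ring U)"
proof -
  interpret cring "monoid_ring U :: ('m \<Rightarrow>\<^sub>0 'k) ring" by (rule cring_monoid_ring)
  show ?thesis
  proof (rule idealI)
    show "ring (monoid_ring U :: ('m \<Rightarrow>\<^sub>0 'k) ring)" by unfold_locales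
    show "subgroup {f :: 'm \<Rightarrow>\<^sub>0 'k. keys f \<subseteq> V} (add_monoid (monoid_ring U))"
    proof (rule add.subgroupI)
      fix f :: "'m \<Rightarrow>\<^sub>0 'k" assume f: "f \<in> {f. keys f \<subseteq> V}"
      have "\<ominus>\<^bsub>monoid_ring U\<^esub> f = - f"
        using assms(1) f by (intro sum_zero_eq_neg[symmetric]) (auto simp: keys_uminus_subset)
      then show "\<ominus>\<^bsub>monoid_ring U\<^esub> f \<in> {f. keys f \<subseteq> V}"
        using f by (simp add: keys_uminus_subset)
    qed (use assms(1) in \<open>auto intro: exI[of _ 0] dest: subsetD[OF Poly_Mapping.keys_add]\<close>)
  next
    fix a x :: "'m \<Rightarrow>\<^sub>0 'k"
    assume ax: "a \<in> {f. keys f \<subseteq> V}" "x \<in> carrier (monoid_ring U)"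
    then show "x \<otimes>\<^bsub>monoid_ring U\<^esub> a \<in> {f. keys f \<subseteq> V}"
      using keys_mult_subset[of x U a V V] assms(2) by auto
    then show "a \<otimes>\<^bsub>monoid_ring U\<^esub> x \<in> {f. keys f \<subseteq> V}"
      by (simp add: mult.commute)
  qed
qed

text \<open>An ideal containing the monomials with exponents in \<open>V\<close> contains their whole \<open>K\<close>-span, because
  constants are ring elements.\<close>

lemma monomials_in_ideal:
  fixes J :: "('m \<Rightarrow>\<^sub>0 'k::field) set"
  assumes J: "ideal J (monoid_ring U)" and V: "\<And>v. v \<in> V \<Longrightarrow> single v 1 \<in> J"
    and f: "keys f \<subseteq> V"
  shows "f \<in> J"
proof -
  interpret J: ideal J "monoid_ring U :: ('m \<Rightarrow>\<^sub>0 'k) ring" by (rule J)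
  have single: "single v c \<in> J" if "v \<in> V" for v c
  proof -
    have "single 0 c * single v 1 \<in> J"
      using J.I_l_closed[OF V[OF that], of "single 0 c"] zero_mem by auto
    then show ?thesis by (simp add: Poly_Mapping.mult_single)
  qed
  have "(\<Sum>a\<in>X. single a (lookup f a)) \<in> J"
    if "finite X" "X \<subseteq> V" for X
    using that
  proof (induction X rule: finite_induct)
    case empty
    show ?case using additive_subgroup.zero_closed[OF J.additive_subgroup_axioms] by simp
  next
    case (insert x F)
    then show ?case using additive_subgroup.a_closed[OF J.additive_subgroup_axioms, of "single x (lookup f x)"] single
      by simp
  qed
  from this[of "keys f"] show ?thesis
    using f by (simp flip: poly_mapping_sum_singles)
qed

lemma genideal_monomials:
  assumes "B \<subseteq> U"
  shows "genideal (monoid_ring U) ((\<lambda>a. single a (1::'k::field)) ` B) =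
         {f. keys f \<subseteq> {u + b | u b. u \<in> U \<and> b \<in> B}}" (is "?L = ?R")
proof
  interpret cring "monoid_ring U :: ('m \<Rightarrow>\<^sub>0 'k) ring" by (rule cring_monoid_ring)
  have sub: "(\<lambda>a. single a (1::'k)) ` B \<subseteq> carrier (monoid_ring U)"
    using assms by auto
  have "ideal ?R (monoid_ring U :: ('m \<Rightarrow>\<^sub>0 'k) ring)"
  proof (rule ideal_monomials)
    fix u v assume "u \<in> U" "v \<in> {u + b |u b. u \<in> U \<and> b \<in> B}"
    then show "u + v \<in> {u + b |u b. u \<in> U \<and> b \<in> B}"
      using add_mem by (auto simp: add.assoc[symmetric]) blast
  qed (use assms add_mem in auto)
  moreover have "(\<lambda>a. single a (1::'k)) ` B \<subseteq> ?R"
    using zero_mem by (auto intro: exI[of _ 0])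
  ultimately show "?L \<subseteq> ?R" by (rule genideal_minimal)
  have id: "ideal ?L (monoid_ring U)" by (rule genideal_ideal[OF sub])
  show "?R \<subseteq> ?L"
  proof
    fix f :: "'m \<Rightarrow>\<^sub>0 'k" assume f: "f \<in> ?R"
    show "f \<in> ?L"
    proof (rule monomials_in_ideal[OF id _ CollectD[OF f]])
      fix v assume "v \<in> {u + b |u b. u \<in> U \<and> b \<in> B}"
      then obtain u b where v: "v = u + b" "u \<in> U" "b \<in> B" by auto
      have "single b 1 \<in> ?L" using genideal_self[OF sub] v by auto
      then have "single u 1 * single b 1 \<in> ?L"
        using ideal.I_l_closed[OF id, of "single b 1" "single u 1"] v
        by auto
      then show "single v 1 \<in> ?L" by (simp add: v Poly_Mapping.mult_single)
    qed
  qed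
qed

lemma ideal_prod_monomials:
  assumes "V \<subseteq> U" "\<And>u v. u \<in> U \<Longrightarrow> v \<in> V \<Longrightarrow> u + v \<in> V"
    and "W \<subseteq> U" "\<And>u v. u \<in> U \<Longrightarrow> v \<in> W \<Longrightarrow> u + v \<in> W"
  shows "ideal_prod (monoid_ring U) {f :: 'm \<Rightarrow>\<^sub>0 'k::field. keys f \<subseteq> V}
            {f. keys f \<subseteq> W} =
         {f. keys f \<subseteq> {v + w | v w. v \<in> V \<and> w \<in> W}}" (is "?L = ?R")
proof
  interpret cring "monoid_ring U :: ('m \<Rightarrow>\<^sub>0 'k) ring" by (rule cring_monoid_ring)
  show "?L \<subseteq> ?R"
  proof
    fix f assume "f \<in> ?L"
    then show "f \<in> ?R"
    proof (induction rule: ideal_prod.induct)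
      case (prod i j)
      then show ?case using keys_mult_subset[of i V j W "{v + w | v w. v \<in> V \<and> w \<in> W}"] by auto
    next
      case (sum s1 s2)
      then show ?case using Poly_Mapping.keys_add[of s1 s2] by (simp, blast)
    qed
  qed
  have id: "ideal ?L (monoid_ring U)"
    by (rule ideal_prod_is_ideal) (rule ideal_monomials; use assms in blast)+
  show "?R \<subseteq> ?L"
  proof
    fix f :: "'m \<Rightarrow>\<^sub>0 'k" assume f: "f \<in> ?R"
    show "f \<in> ?L"
    proof (rule monomials_in_ideal[OF id _ CollectD[OF f]])
      fix x assume "x \<in> {v + w |v w. v \<in> V \<and> w \<in> W}"
      then obtain v w where x: "x = v + w" "v \<in> V" "w \<in> W" by auto
      have "single v 1 \<otimes>\<^bsub>monoid_ring U\<^esub> single w 1 \<in> ?L"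
        by (rule ideal_prod.prod) (use x in auto)
      then show "single x 1 \<in> ?L" by (simp add: x Poly_Mapping.mult_single)
    qed
  qed
qed

end

text \<open>A product does not lose the part lying over a face: among the exponents of each factor in the
  face take the one of largest weight; the sum of the two arises in no other way.\<close>

lemma keys_mult_meets_face:
  fixes f g :: "'m::comm_monoid_add \<Rightarrow>\<^sub>0 'k::field" and w :: "'m \<Rightarrow> nat"
  assumes fg: "keys f \<subseteq> U" "keys g \<subseteq> U"
    and add: "\<And>x y. x \<in> F \<Longrightarrow> y \<in> F \<Longrightarrow> x + y \<in> F"
    and face: "\<And>x y. x \<in> U \<Longrightarrow> y \<in> U \<Longrightarrow> x + y \<in> F \<Longrightarrow> x \<in> F \<and> y \<in> F"
    and w: "\<And>x y. w (x + y) = w x + w y" "inj_on w (keys f \<union> keys g)"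
    and ne: "keys f \<inter> F \<noteq> {}" "keys g \<inter> F \<noteq> {}"
  shows "keys (f * g) \<inter> F \<noteq> {}"
proof -
  have ex: "\<exists>a\<in>X. \<forall>a'\<in>X. w a' \<le> w a" if "finite X" "X \<noteq> {}" for X
    using Max_in[of "w ` X"] Max_ge[of "w ` X"] that by fastforce
  obtain a where a: "a \<in> keys f \<inter> F" "\<And>a'. a' \<in> keys f \<inter> F \<Longrightarrow> w a' \<le> w a"
    using ex[of "keys f \<inter> F"] ne by auto
  obtain b where b: "b \<in> keys g \<inter> F" "\<And>b'. b' \<in> keys g \<inter> F \<Longrightarrow> w b' \<le> w b"
    using ex[of "keys g \<inter> F"] ne by auto
  have abF: "a + b \<in> F" using a b add by auto
  have only: "a' = a \<and> b' = b"
    if "a' \<in> keys f" "b' \<in> keys g" "a' + b' = a + b" for a' b'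
  proof -
    have "a' \<in> F" "b' \<in> F" using face[of a' b'] that fg abF by auto
    then have "w a' \<le> w a" "w b' \<le> w b" using a b that by auto
    moreover have "w a' + w b' = w a + w b" using w(1) that(3) by metis
    ultimately have "w a' = w a" "w b' = w b" by auto
    then show ?thesis using inj_onD[OF w(2)] that a(1) b(1) by blast
  qed
  have "lookup (f * g) (a + b) = (\<Sum>a'\<in>keys f. \<Sum>b'\<in>keys g.
           if a' = a then (if b' = b then lookup f a * lookup g b else 0) else 0)"
    unfolding lookup_mult_eq_sum
    by (intro sum.cong) (auto dest: only)
  also have "\<dots> = (\<Sum>a'\<in>keys f. if a' = a then lookup f a * lookup g b else 0)"
    using b(1) by (intro sum.cong) auto
  also have "\<dots> = lookup f a * lookup g b"
    using a(1) by auto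
  finally have "a + b \<in> keys (f * g)"
    using a(1) b(1) by (simp add: in_keys_iff)
  then show ?thesis using abF by blast
qed

text \<open>Two weights are read as digits in a base that is large for the finite set at hand.\<close>

lemma combine_weights:
  fixes u v :: "'m \<Rightarrow> nat"
  assumes "finite X"
  obtains B where "\<And>x y. x \<in> X \<Longrightarrow> y \<in> X \<Longrightarrow> u x + B * v x = u y + B * v y \<Longrightarrow> u x = u y \<and> v x = v y"
proof
  define B where "B = Suc (\<Sum>x\<in>X. u x)"
  have bound: "u x < B" if "x \<in> X" for x
    using member_le_sum[of x X u] that assms by (simp add: B_def)
  fix x y assume xy: "x \<in> X" "y \<in> X" "u x + B * v x = u y + B * v y"
  have "(u x + B * v x) mod B = (u y + B * v y) mod B" using xy(3) by simp
  then have "u x = u y" using bound xy(1,2) by simp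
  moreover have "B \<noteq> 0" by (simp add: B_def)
  ultimately show "u x = u y \<and> v x = v y" using xy(3) by simp
qed

lemma separating_weight_vec:
  fixes X :: "(nat ^ 'd) set"
  assumes "finite X"
  shows "\<exists>w :: nat ^ 'd \<Rightarrow> nat. (\<forall>x y. w (x + y) = w x + w y) \<and> inj_on w X"
proof -
  have "\<exists>w :: nat ^ 'd \<Rightarrow> nat. (\<forall>x y. w (x + y) = w x + w y) \<and>
      (\<forall>x\<in>X. \<forall>y\<in>X. w x = w y \<longrightarrow> (\<forall>i\<in>I. x $ i = y $ i))" for I
    using finite[of I]
  proof (induction I rule: finite_induct)
    case empty
    show ?case by (intro exI[of _ "\<lambda>_. 0"]) simp
  next
    case (insert i I)
    then obtain w :: "nat ^ 'd \<Rightarrow> nat" where w: "\<And>x y. w (x + y) = w x + w y"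
      "\<forall>x\<in>X. \<forall>y\<in>X. w x = w y \<longrightarrow> (\<forall>i\<in>I. x $ i = y $ i)" by auto
    obtain B where B: "\<And>x y. x \<in> X \<Longrightarrow> y \<in> X \<Longrightarrow> x $ i + B * w x = y $ i + B * w y \<Longrightarrow> x $ i = y $ i \<and> w x = w y"
      using combine_weights[OF assms, of "\<lambda>x. x $ i" w] by blast
    show ?case
    proof (intro exI[of _ "\<lambda>x. x $ i + B * w x"] conjI allI ballI impI)
      show "(x + y) $ i + B * w (x + y) = (x $ i + B * w x) + (y $ i + B * w y)" for x y
        by (simp add: w(1) algebra_simps)
      fix x y j assume xy: "x \<in> X" "y \<in> X" "x $ i + B * w x = y $ i + B * w y" and "j \<in> insert i I"
      then show "x $ j = y $ j" using B[OF xy] w(2) by auto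
    qed
  qed
  from this[of UNIV] show ?thesis by (auto simp: inj_on_def vec_eq_iff)
qed

lemma separating_weight_vec_nat:
  fixes X :: "((nat ^ 'd) \<times> nat) set"
  assumes "finite X"
  shows "\<exists>w :: (nat ^ 'd) \<times> nat \<Rightarrow> nat. (\<forall>x y. w (x + y) = w x + w y) \<and> inj_on w X"
proof -
  obtain v :: "nat ^ 'd \<Rightarrow> nat" where v: "\<And>x y. v (x + y) = v x + v y" "inj_on v (fst ` X)"
    using separating_weight_vec[of "fst ` X"] assms by auto
  obtain B where B: "\<And>x y. x \<in> X \<Longrightarrow> y \<in> X \<Longrightarrow> snd x + B * v (fst x) = snd y + B * v (fst y) \<Longrightarrow>
      snd x = snd y \<and> v (fst x) = v (fst y)"
    using combine_weights[OF assms, of snd "\<lambda>x. v (fst x)"] by blast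
  have "inj_on (\<lambda>x. snd x + B * v (fst x)) X"
  proof (rule inj_onI)
    fix x y assume xy: "x \<in> X" "y \<in> X" "snd x + B * v (fst x) = snd y + B * v (fst y)"
    from B[OF this] have "snd x = snd y" "fst x = fst y" using inj_onD[OF v(2), of "fst x" "fst y"] xy by auto
    then show "x = y" by (simp add: prod_eq_iff)
  qed
  then show ?thesis
    by (intro exI[of _ "\<lambda>x. snd x + B * v (fst x)"]) (simp add: v(1) algebra_simps)
qed

section \<open>Orders of semigroup elements\<close>

lemma scalar_mult_nat_simps [simp]:
  "(0::nat) *s (x :: nat ^ 'd) = 0" "Suc n *s x = x + n *s x"
  by (simp_all add: vector_scalar_mult_def vec_eq_iff)

lemma nat_span_add_generator: "x \<in> nat_span A \<Longrightarrow> a \<in> A \<Longrightarrow> x + a \<in> nat_span A"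
  by (simp add: nat_span_add nat_span_superset)

lemma nat_span_induct [consumes 1, case_names zero add]:
  assumes "x \<in> nat_span A" "P 0" "\<And>x a. x \<in> nat_span A \<Longrightarrow> a \<in> A \<Longrightarrow> P x \<Longrightarrow> P (x + a)"
  shows "P x"
proof -
  obtain F c where F: "finite F" "F \<subseteq> A" "x = (\<Sum>a\<in>F. c a *s a)"
    using assms(1) by (auto simp: nat_span_def)
  have scale: "P (y + n *s a) \<and> y + n *s a \<in> nat_span A" if "P y" "y \<in> nat_span A" "a \<in> A" for y a n
  proof (induction n)
    case (Suc n)
    then show ?case
      using assms(3)[of "y + n *s a" a] nat_span_add_generator[of "y + n *s a" A a] that
      by (simp add: ac_simps)
  qed (use that in simp)
  have "P (\<Sum>a\<in>F. c a *s a) \<and> (\<Sum>a\<in>F. c a *s a) \<in> nat_span A"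
    using F(1,2)
  proof (induction F rule: finite_induct)
    case (insert a F)
    then show ?case using scale[of "\<Sum>a\<in>F. c a *s a" a "c a"] by (simp add: ac_simps)
  qed (simp add: assms(2) nat_span_zero)
  then show ?thesis using F(3) by simp
qed

lemma nat_span_least:
  assumes "A \<subseteq> nat_span B"
  shows "nat_span A \<subseteq> nat_span B"
proof
  fix x assume "x \<in> nat_span A"
  then show "x \<in> nat_span B"
    by (induction rule: nat_span_induct) (use assms nat_span_zero nat_span_add in blast)+
qed

text \<open>These are the exponents of the monomials in the \<open>n\<close>-th power of the maximal ideal.\<close>

primrec sums_ge :: "(nat ^ 'd) set \<Rightarrow> nat \<Rightarrow> (nat ^ 'd) set" where
  "sums_ge A 0 = nat_span A"
| "sums_ge A (Suc n) = {s + a | s a. s \<in> sums_ge A n \<and> a \<in> A}"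

lemma sums_ge_subset: "sums_ge A n \<subseteq> nat_span A"
  by (induction n) (auto intro: nat_span_add_generator)

lemma sums_ge_SucD: "s \<in> sums_ge A (Suc n) \<Longrightarrow> s \<in> sums_ge A n"
  by (induction n arbitrary: s) (auto intro: nat_span_add_generator, blast)

lemma sums_ge_antimono: "m \<le> n \<Longrightarrow> sums_ge A n \<subseteq> sums_ge A m"
  by (induction rule: dec_induct) (use sums_ge_SucD in blast)+

lemma sums_ge_add:
  assumes "s \<in> sums_ge A m" "t \<in> sums_ge A n"
  shows "s + t \<in> sums_ge A (m + n)"
proof -
  have base: "s + t \<in> sums_ge A m" if "t \<in> nat_span A" "s \<in> sums_ge A m" for s t
    using that(2)
  proof (induction m arbitrary: s)
    case 0
    then show ?case using nat_span_add that(1) by auto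
  next
    case (Suc m)
    then obtain s' a where s: "s = s' + a" "s' \<in> sums_ge A m" "a \<in> A" by auto
    then have "s' + t \<in> sums_ge A m" using Suc.IH by auto
    moreover have "s + t = (s' + t) + a" using s by (simp add: ac_simps)
    ultimately show ?case using s(3) by auto
  qed
  show ?thesis
    using assms(2)
  proof (induction n arbitrary: t)
    case 0
    then show ?case using base assms(1) by auto
  next
    case (Suc n)
    then obtain t' a where t: "t = t' + a" "t' \<in> sums_ge A n" "a \<in> A" by auto
    then have "s + t' \<in> sums_ge A (m + n)" using Suc.IH by auto
    moreover have "s + t = (s + t') + a" using t by (simp add: ac_simps)
    ultimately show ?case using t(3) by auto
  qed
qed

lemma generator_in_sums_ge_1: "(a :: nat ^ 'd) \<in> A \<Longrightarrow> a \<in> sums_ge A 1"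
  using nat_span_zero[of A] unfolding One_nat_def sums_ge.simps by force

definition vec_size :: "nat ^ 'd \<Rightarrow> nat" where
  "vec_size x = (\<Sum>i\<in>UNIV. x $ i)"

lemma vec_size_simps [simp]:
  "vec_size 0 = 0" "vec_size (x + y) = vec_size x + vec_size y"
  "vec_size x = 0 \<longleftrightarrow> x = 0"
  by (simp_all add: vec_size_def sum.distrib vec_eq_iff)

lemma vec_size_pos [simp]: "0 < vec_size x \<longleftrightarrow> x \<noteq> 0"
  using vec_size_simps(3)[of x] by linarith

lemma nat_vec_add_eq_0_iff: "x + y = 0 \<longleftrightarrow> x = 0 \<and> y = 0" for x y :: "nat ^ 'd"
  by (metis add_is_0 vec_size_simps(2,3))

locale nonzero_generators =
  fixes A :: "(nat ^ 'd) set"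
  assumes finite_A: "finite A" and zero_notin_A: "0 \<notin> A"
begin

abbreviation "S \<equiv> nat_span A"

lemma sums_ge_1: "sums_ge A (Suc 0) = S - {0}"
proof
  show "sums_ge A (Suc 0) \<subseteq> S - {0}"
    using zero_notin_A by (auto intro: nat_span_add_generator simp: nat_vec_add_eq_0_iff)
  have "s \<noteq> 0 \<longrightarrow> s \<in> sums_ge A (Suc 0)" if "s \<in> S" for s
    using that by (induction rule: nat_span_induct) auto
  then show "S - {0} \<subseteq> sums_ge A (Suc 0)" by auto
qed

lemma sums_ge_le_vec_size: "s \<in> sums_ge A n \<Longrightarrow> n \<le> vec_size s"
proof (induction n arbitrary: s)
  case (Suc n)
  then obtain s' a where "s = s' + a" "s' \<in> sums_ge A n" "a \<in> A" by auto
  moreover from this have "0 < vec_size a" using zero_notin_A by auto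
  ultimately show ?case using Suc.IH[of s'] by (simp del: vec_size_pos)
qed simp

lemma finite_not_sums_ge: "finite (S - sums_ge A n)"
proof -
  have layer: "finite (sums_ge A n - sums_ge A (Suc n))" for n
  proof (induction n)
    case 0
    have "sums_ge A 0 - sums_ge A (Suc 0) \<subseteq> {0}" unfolding sums_ge_1 by auto
    then show ?case using finite_subset by blast
  next
    case (Suc n)
    have "sums_ge A (Suc n) - sums_ge A (Suc (Suc n))
            \<subseteq> (\<lambda>(s, a). s + a) ` ((sums_ge A n - sums_ge A (Suc n)) \<times> A)"
      by (force simp: image_iff)
    then show ?case using Suc finite_A finite_subset by blast
  qed
  show ?thesis
  proof (induction n)
    case (Suc n)
    have "S - sums_ge A (Suc n) \<subseteq> (S - sums_ge A n) \<union> (sums_ge A n - sums_ge A (Suc n))" by auto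
    then show ?case using Suc layer finite_subset by blast
  qed simp
qed

definition ord :: "nat ^ 'd \<Rightarrow> nat" where
  "ord s = (GREATEST n. s \<in> sums_ge A n)"

lemma sums_ge_iff_le_ord:
  assumes "s \<in> S"
  shows "s \<in> sums_ge A n \<longleftrightarrow> n \<le> ord s"
proof
  show "s \<in> sums_ge A n \<Longrightarrow> n \<le> ord s"
    unfolding ord_def by (rule Greatest_le_nat[where b = "vec_size s"]) (auto intro: sums_ge_le_vec_size)
  have "s \<in> sums_ge A (ord s)"
    unfolding ord_def
    by (rule GreatestI_nat[where k = 0 and b = "vec_size s"]) (use assms sums_ge_le_vec_size in auto)
  then show "n \<le> ord s \<Longrightarrow> s \<in> sums_ge A n" using sums_ge_antimono by blast
qed

lemma ord_le_vec_size: "s \<in> S \<Longrightarrow> ord s \<le> vec_size s"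
  using sums_ge_iff_le_ord[of s "ord s"] sums_ge_le_vec_size by auto

lemma ord_0 [simp]: "ord 0 = 0"
  using ord_le_vec_size[OF nat_span_zero] by simp

lemma ord_add_le: "s \<in> S \<Longrightarrow> t \<in> S \<Longrightarrow> ord s + ord t \<le> ord (s + t)"
  using sums_ge_add[of s A "ord s" t "ord t"] sums_ge_iff_le_ord nat_span_add by blast

text \<open>After a generator is dropped from a longest representation, the rest has no longer one, because
  orders are superadditive.\<close>

lemma ord_predecessor:
  assumes "s \<in> S" "ord s = Suc n"
  obtains t a where "s = t + a" "t \<in> S" "a \<in> A" "ord t = n"
proof -
  have "s \<in> sums_ge A (Suc n)" using sums_ge_iff_le_ord[OF assms(1)] assms(2) by (simp del: sums_ge.simps)
  then obtain t a where ta: "s = t + a" "t \<in> sums_ge A n" "a \<in> A" by auto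
  have t: "t \<in> S" using sums_ge_subset[of A n] ta(2) by auto
  then have "n \<le> ord t" using sums_ge_iff_le_ord[OF t] ta(2) by simp
  note t = t this
  have "1 \<le> ord a"
    using generator_in_sums_ge_1[OF ta(3)] sums_ge_iff_le_ord[OF nat_span_superset[OF ta(3)]] by blast
  then have "ord t + 1 \<le> Suc n"
    using ord_add_le[of t a] t ta assms nat_span_superset[OF ta(3)] by auto
  then show ?thesis using that ta t by auto
qed

end

section \<open>Semigroups that are free over part of their elements\<close>

text \<open>For \<open>E \<subseteq> S\<close>, the last assumption says that the ideal generated by the monomials of \<open>E\<close> is a
  reduction of the maximal ideal.\<close>

locale reducing_elements = nonzero_generators A for A :: "(nat ^ 'd) set" +
  fixes E :: "(nat ^ 'd) set" and N :: nat
  assumes E_subset: "E \<subseteq> S" and zero_notin_E: "0 \<notin> E"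
    and reduction: "\<And>n s. N \<le> n \<Longrightarrow> s \<in> sums_ge A (Suc n) \<Longrightarrow> \<exists>e\<in>E. \<exists>t\<in>sums_ge A n. s = e + t"
begin

text \<open>Elements of \<open>E\<close> are split off as long as the order exceeds \<open>N\<close>. Each step costs at most one unit of
  the order, so at most \<open>N\<close> units are left to the remainder.\<close>

lemma decompose_over_E:
  assumes "s \<in> sums_ge A n"
  shows "\<exists>es t. s = sum_list es + t \<and> set es \<subseteq> E \<and> t \<in> S - sums_ge A (Suc N) \<and> n \<le> length es + N"
  using assms
proof (induction "vec_size s" arbitrary: s n rule: less_induct)
  case less
  have s: "s \<in> S" using less.prems sums_ge_subset by auto
  show ?case
  proof (cases "s \<in> sums_ge A (Suc N)")
    case False
    then have "\<not> Suc N \<le> n" using less.prems sums_ge_antimono by blast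
    then show ?thesis using False s by (intro exI[of _ "[]"] exI[of _ s]) auto
  next
    case True
    define k where "k = max N (n - 1)"
    have "s \<in> sums_ge A (Suc k)"
      using True less.prems by (cases n) (auto simp: k_def max_def simp del: sums_ge.simps)
    then obtain e t where et: "e \<in> E" "t \<in> sums_ge A k" "s = e + t"
      using reduction[of k s] by (auto simp: k_def simp del: sums_ge.simps)
    have "e \<noteq> 0" using et(1) zero_notin_E by auto
    then have "vec_size t < vec_size s" using et(3) by simp
    then obtain es t' where "t = sum_list es + t'" "set es \<subseteq> E" "t' \<in> S - sums_ge A (Suc N)"
        "k \<le> length es + N"
      using less.hyps et(2) by blast
    then show ?thesis
      using et by (intro exI[of _ "e # es"] exI[of _ t']) (auto simp: ac_simps k_def)
  qed
qed

definition Apery :: "(nat ^ 'd) set" where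
  "Apery = {w \<in> S. \<forall>e\<in>E. \<forall>s\<in>S. w \<noteq> s + e}"

lemma zero_in_Apery: "0 \<in> Apery"
proof -
  have "0 \<noteq> s + e" if "e \<in> E" for s e
    using that zero_notin_E by (metis nat_vec_add_eq_0_iff)
  then show ?thesis by (auto simp: Apery_def nat_span_zero)
qed

lemma Apery_subset: "Apery \<subseteq> S - sums_ge A (Suc N)"
proof
  fix w assume w: "w \<in> Apery"
  have "w \<notin> sums_ge A (Suc N)"
  proof
    assume "w \<in> sums_ge A (Suc N)"
    then obtain a t where "a \<in> E" "t \<in> sums_ge A N" "w = a + t" using reduction[of N w] by auto
    then show False using w sums_ge_subset[of A N] unfolding Apery_def by (auto simp: add.commute)
  qed
  then show "w \<in> S - sums_ge A (Suc N)" using w by (simp add: Apery_def)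
qed

lemma finite_Apery: "finite Apery"
  using Apery_subset finite_not_sums_ge finite_subset by blast

text \<open>Divisors of elements of the Apery set lie in the Apery set, so all orders below an occurring
  one occur.\<close>

lemma Apery_orders_downward:
  assumes "w \<in> Apery" "n \<le> ord w"
  shows "\<exists>v\<in>Apery. ord v = n"
  using assms
proof (induction "ord w" arbitrary: w)
  case 0
  then show ?case using zero_in_Apery by auto
next
  case (Suc m)
  show ?case
  proof (cases "n = ord w")
    case False
    have "w \<in> S" using Suc.prems by (simp add: Apery_def)
    then obtain t a where ta: "w = t + a" "t \<in> S" "a \<in> A" "ord t = m"
      using ord_predecessor Suc.hyps(2) by metis
    have "t \<in> Apery"
    proof -
      have "t \<noteq> s + e" if "e \<in> E" "s \<in> S" for e s
      proof
        assume "t = s + e"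
        then have "w = (s + a) + e" using ta by (simp add: ac_simps)
        moreover have "s + a \<in> S" using that ta nat_span_add_generator by auto
        ultimately show False using Suc.prems(1) that by (auto simp: Apery_def)
      qed
      then show ?thesis using ta by (auto simp: Apery_def)
    qed
    moreover have "n \<le> ord t" using False Suc.prems Suc.hyps(2) ta by auto
    ultimately show ?thesis using Suc.hyps(1)[of t] ta by auto
  next
    case True
    then show ?thesis using Suc.prems(1) by blast
  qed
qed

end

text \<open>The conditions on \<open>E\<close> say that the initial forms of its monomials form a regular sequence in the
  associated graded ring: \<open>ord_add_E\<close> that none of them is a zero divisor, \<open>exchange\<close> that this remains
  so modulo the others.\<close>

locale free_over = reducing_elements +
  fixes e :: "nat \<Rightarrow> nat ^ 'a" and d :: nat
  assumes e: "bij_betw e {..<d} E"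
    and ord_add_E: "\<And>s a. s \<in> S \<Longrightarrow> a \<in> E \<Longrightarrow> ord (s + a) = Suc (ord s)"
    and exchange: "\<And>s t a b. s \<in> S \<Longrightarrow> t \<in> S \<Longrightarrow> a \<in> E \<Longrightarrow> b \<in> E \<Longrightarrow> a \<noteq> b \<Longrightarrow> s + a = t + b \<Longrightarrow>
             \<exists>u\<in>S. s = u + b"
begin

definition comb :: "(nat \<Rightarrow> nat) \<Rightarrow> nat ^ 'a" where
  "comb c = (\<Sum>i<d. c i *s e i)"

lemma e_in_E: "i < d \<Longrightarrow> e i \<in> E" and e_eq_iff: "i < d \<Longrightarrow> j < d \<Longrightarrow> e i = e j \<longleftrightarrow> i = j"
  using e by (auto simp: bij_betw_def inj_on_def)

lemma comb_step:
  assumes "i < d" "0 < c i"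
  shows "comb c = comb (c(i := c i - 1)) + e i"
    and "(\<Sum>i<d. c i) = Suc (\<Sum>j<d. (c(i := c i - 1)) j)"
proof -
  have split: "(\<Sum>j<d. f j) = f i + (\<Sum>j\<in>{..<d}-{i}. f j)" for f :: "nat \<Rightarrow> 'x::comm_monoid_add"
    using assms(1) by (intro sum.remove) auto
  obtain m where m: "c i = Suc m" using assms(2) by (cases "c i") auto
  show "comb c = comb (c(i := c i - 1)) + e i"
    unfolding comb_def by (subst (1 2) split) (auto simp: m ac_simps intro!: sum.cong)
  show "(\<Sum>i<d. c i) = Suc (\<Sum>j<d. (c(i := c i - 1)) j)"
    by (subst (1 2) split) (auto simp: m intro!: sum.cong)
qed

lemma comb_0: "(\<Sum>i<d. c i) = 0 \<Longrightarrow> comb c = 0"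
  unfolding comb_def by (intro sum.neutral) auto

lemma add_comb:
  assumes "w \<in> S"
  shows "w + comb c \<in> S \<and> ord (w + comb c) = ord w + (\<Sum>i<d. c i)"
proof (induction "\<Sum>i<d. c i" arbitrary: c)
  case 0
  then show ?case using comb_0[of c] assms by simp
next
  case (Suc n)
  then obtain i where i: "i < d" "0 < c i"
    by (metis gr0I lessThan_iff nat.distinct(1) sum.neutral)
  note st = comb_step[of i c, OF i]
  have IH: "w + comb (c(i := c i - 1)) \<in> S \<and>
      ord (w + comb (c(i := c i - 1))) = ord w + (\<Sum>j<d. (c(i := c i - 1)) j)"
    using Suc.hyps st(2) by simp
  have "w + comb c = (w + comb (c(i := c i - 1))) + e i" using st(1) by (simp add: ac_simps)
  then show ?case
    using IH st(2) ord_add_E[of "w + comb (c(i := c i - 1))" "e i"] e_in_E[OF i(1)] E_subset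
      nat_span_add[of "w + comb (c(i := c i - 1))" A "e i"] by auto
qed

text \<open>The summands of \<open>comb c\<close> are cancelled one at a time; each of them differs from \<open>e j\<close>, so the exchange
  condition keeps \<open>e j\<close> split off.\<close>

lemma exchange_comb:
  assumes "s \<in> S" "t \<in> S" "j < d" "c j = 0" "s + comb c = t + e j"
  shows "\<exists>u\<in>S. s = u + e j"
  using assms(2,4,5)
proof (induction "\<Sum>i<d. c i" arbitrary: c t)
  case 0
  then show ?case using comb_0[of c] by auto
next
  case (Suc n)
  then obtain i where i: "i < d" "0 < c i"
    by (metis gr0I lessThan_iff nat.distinct(1) sum.neutral)
  note st = comb_step[of i c, OF i]
  have ij: "i \<noteq> j" using i Suc.prems by auto
  have "(s + comb (c(i := c i - 1))) + e i = t + e j" using st(1) Suc.prems(3) by (simp add: ac_simps)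
  then obtain u where u: "u \<in> S" "s + comb (c(i := c i - 1)) = u + e j"
    using exchange[of "s + comb (c(i := c i - 1))" t "e i" "e j"] add_comb[OF assms(1)] Suc.prems(1)
      e_in_E e_eq_iff i assms(3) ij by blast
  show ?case
    by (rule Suc.hyps(1)[OF _ u(1) _ u(2)]) (use Suc.hyps(2) st(2) ij Suc.prems(2) in auto)
qed

text \<open>A summand \<open>e i\<close> on one side either occurs on the other side and cancels, or it can be
  exchanged into \<open>w'\<close>, which is impossible in the Apery set.\<close>

lemma Apery_comb_unique:
  assumes "w \<in> Apery" "w' \<in> Apery" "w + comb c = w' + comb c'"
  shows "w = w' \<and> (\<forall>i<d. c i = c' i)"
  using assms(3)
proof (induction "\<Sum>i<d. c i" arbitrary: c c')
  have S: "w \<in> S" "w' \<in> S" using assms by (auto simp: Apery_def)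
  {
    case 0
    have "(\<Sum>i<d. c' i) = 0"
    proof (rule ccontr)
      assume "(\<Sum>i<d. c' i) \<noteq> 0"
      then obtain i where i: "i < d" "0 < c' i" by (metis gr0I lessThan_iff sum.neutral)
      then have "w = (w' + comb (c'(i := c' i - 1))) + e i"
        using 0 comb_0[of c] comb_step(1)[of i c', OF i] by (simp add: ac_simps)
      then show False using assms(1) add_comb[OF S(2)] e_in_E[OF i(1)] by (auto simp: Apery_def)
    qed
    then show ?case using 0 comb_0[of c] comb_0[of c'] by auto
  next
    case (Suc n)
    then obtain i where i: "i < d" "0 < c i"
      by (metis gr0I lessThan_iff nat.distinct(1) sum.neutral)
    note st = comb_step[of i c, OF i]
    have "c' i \<noteq> 0"
    proof
      assume "c' i = 0"
      moreover have "w' + comb c' = (w + comb (c(i := c i - 1))) + e i"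
        using Suc.prems st(1) by (simp add: ac_simps)
      ultimately have "\<exists>u\<in>S. w' = u + e i"
        using exchange_comb[of w' _ i c'] add_comb[OF S(1)] S i by blast
      then show False using assms(2) e_in_E[OF i(1)] by (auto simp: Apery_def)
    qed
    then have i': "0 < c' i" by simp
    have "w + comb (c(i := c i - 1)) + e i = w' + comb (c'(i := c' i - 1)) + e i"
      using Suc.prems st(1) comb_step(1)[of i c', OF i(1) i'] by (simp add: ac_simps)
    then have eq: "w + comb (c(i := c i - 1)) = w' + comb (c'(i := c' i - 1))"
      by (rule add_right_imp_eq)
    have "n = (\<Sum>j<d. (c(i := c i - 1)) j)" using Suc.hyps(2) st(2) by linarith
    from Suc.hyps(1)[OF this eq]
    have "w = w' \<and> (\<forall>j<d. (c(i := c i - 1)) j = (c'(i := c' i - 1)) j)" .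
    moreover from this have "c i = c' i" using i i' by auto
    ultimately show ?case by (metis fun_upd_other)
  }
qed

lemma Apery_decomposition:
  assumes "s \<in> S"
  shows "\<exists>w\<in>Apery. \<exists>c. s = w + comb c"
  using assms
proof (induction "vec_size s" arbitrary: s rule: less_induct)
  case less
  show ?case
  proof (cases "s \<in> Apery")
    case True
    then show ?thesis using comb_0[of "\<lambda>_. 0"] by (intro bexI[of _ s] exI[of _ "\<lambda>_. 0"]) auto
  next
    case False
    then obtain a t where at: "a \<in> E" "t \<in> S" "s = t + a" using less.prems by (auto simp: Apery_def)
    then obtain i where i: "i < d" "a = e i" using e by (auto simp: bij_betw_def)
    have "a \<noteq> 0" using at(1) zero_notin_E by auto
    then have "vec_size t < vec_size s" using at(3) by simp
    then obtain w c where wc: "w \<in> Apery" "t = w + comb c" using less.hyps[of t] at by blast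
    have "comb (c(i := Suc (c i))) = comb c + e i"
      using comb_step(1)[of i "c(i := Suc (c i))"] i by simp
    then show ?thesis using wc at i
      by (intro bexI[of _ w] exI[of _ "c(i := Suc (c i))"]) (auto simp: ac_simps)
  qed
qed

end

section \<open>Powers of the maximal ideal\<close>

lemma add_submonoid_nat_span: "add_submonoid (nat_span A)"
  by unfold_locales (auto intro: nat_span_zero nat_span_add)

lemma keys_subset_eq_iff:
  "{f :: 'm \<Rightarrow>\<^sub>0 'k::field. keys f \<subseteq> V} = {f. keys f \<subseteq> W} \<longleftrightarrow> V = W"
proof
  assume eq: "{f :: 'm \<Rightarrow>\<^sub>0 'k. keys f \<subseteq> V} = {f. keys f \<subseteq> W}"
  have "v \<in> V \<longleftrightarrow> v \<in> W" for v
    using eqset_imp_iff[OF eq, of "single v 1"] by simp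
  then show "V = W" by blast
qed simp

context nonzero_generators
begin

lemma genideal_monom_of:
  assumes "B \<subseteq> S"
  shows "Idl\<^bsub>semigroup_ring S\<^esub> (monom_of ` B :: (_ \<Rightarrow>\<^sub>0 'k::field) set) =
           {f. keys f \<subseteq> {s + b | s b. s \<in> S \<and> b \<in> B}}"
  using add_submonoid.genideal_monomials[OF add_submonoid_nat_span assms]
  by (simp add: monom_of_def semigroup_ring_eq_monoid_ring)

lemma maximal_ideal_eq:
  "Idl\<^bsub>semigroup_ring S\<^esub> (monom_of ` A :: (_ \<Rightarrow>\<^sub>0 'k::field) set) =
     {f. keys f \<subseteq> sums_ge A (Suc 0)}"
  by (subst genideal_monom_of) (auto intro: nat_span_superset)

lemma sums_ge_absorbs: "s \<in> S \<Longrightarrow> t \<in> sums_ge A n \<Longrightarrow> s + t \<in> sums_ge A n"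
  using sums_ge_add[of s A 0 t n] by simp

lemma ideal_power_eq:
  "ideal_power (semigroup_ring S) {f. keys f \<subseteq> sums_ge A (Suc 0)} n =
     {f :: _ \<Rightarrow>\<^sub>0 'k::field. keys f \<subseteq> sums_ge A n}"
proof (induction n)
  case 0
  show ?case by (simp add: semigroup_ring_eq_monoid_ring)
next
  case (Suc n)
  have "{v + w |v w. v \<in> sums_ge A n \<and> w \<in> sums_ge A (Suc 0)} = sums_ge A (Suc n)" (is "?L = ?R")
  proof
    show "?L \<subseteq> ?R"
      using sums_ge_add[where m = n and n = "Suc 0"] by (auto simp del: sums_ge.simps)
    have "\<exists>v\<in>sums_ge A n. \<exists>w\<in>sums_ge A (Suc 0). x = v + w" if "x \<in> ?R" for x
      using that generator_in_sums_ge_1 by fastforce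
    then show "?R \<subseteq> ?L" by blast
  qed
  then show ?case
    unfolding ideal_power.simps Suc unfolding semigroup_ring_eq_monoid_ring
    by (subst add_submonoid.ideal_prod_monomials[OF add_submonoid_nat_span])
       (auto simp del: sums_ge.simps intro: sums_ge_absorbs subsetD[OF sums_ge_subset])
qed

lemma ideal_prod_power_eq:
  assumes "E \<subseteq> S"
  shows "ideal_prod (semigroup_ring S) (Idl\<^bsub>semigroup_ring S\<^esub> (monom_of ` E :: (_ \<Rightarrow>\<^sub>0 'k::field) set))
            (ideal_power (semigroup_ring S) {f. keys f \<subseteq> sums_ge A (Suc 0)} n) =
          {f. keys f \<subseteq> {e + t | e t. e \<in> E \<and> t \<in> sums_ge A n}}"
proof -
  have "{v + w |v w. v \<in> {s + b |s b. s \<in> S \<and> b \<in> E} \<and> w \<in> sums_ge A n}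
      = {e + t | e t. e \<in> E \<and> t \<in> sums_ge A n}" (is "?L = ?R")
  proof
    show "?L \<subseteq> ?R"
    proof
      fix x assume "x \<in> ?L"
      then obtain s b w where "x = s + b + w" "s \<in> S" "b \<in> E" "w \<in> sums_ge A n" by auto
      moreover from this have "x = b + (s + w)" by (simp add: ac_simps)
      ultimately show "x \<in> ?R" using sums_ge_absorbs by blast
    qed
    show "?R \<subseteq> ?L" using nat_span_zero by force
  qed
  moreover have "u + v \<in> {s + b |s b. s \<in> S \<and> b \<in> E}"
    if uv: "u \<in> S" "v \<in> {s + b |s b. s \<in> S \<and> b \<in> E}" for u v
  proof -
    obtain s b where "v = s + b" "s \<in> S" "b \<in> E" using uv(2) by blast
    then have "u + v = (u + s) + b" "u + s \<in> S" using uv(1) nat_span_add by (auto simp: ac_simps)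
    then show ?thesis using \<open>b \<in> E\<close> by blast
  qed
  ultimately show ?thesis
    unfolding ideal_power_eq genideal_monom_of[OF assms] unfolding semigroup_ring_eq_monoid_ring
    using assms
    by (subst add_submonoid.ideal_prod_monomials[OF add_submonoid_nat_span])
       (auto intro: sums_ge_absorbs nat_span_add subsetD[OF sums_ge_subset])
qed

lemma reduction_equation_iff:
  assumes "E \<subseteq> S"
  shows "ideal_power (semigroup_ring S) {f. keys f \<subseteq> sums_ge A (Suc 0)} (n + 1) =
         ideal_prod (semigroup_ring S) (Idl\<^bsub>semigroup_ring S\<^esub> (monom_of ` E :: (_ \<Rightarrow>\<^sub>0 'k::field) set))
            (ideal_power (semigroup_ring S) {f. keys f \<subseteq> sums_ge A (Suc 0)} n)
         \<longleftrightarrow> sums_ge A (Suc n) = {e + t | e t. e \<in> E \<and> t \<in> sums_ge A n}"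
  unfolding ideal_prod_power_eq[OF assms] unfolding ideal_power_eq keys_subset_eq_iff by simp

end

lemma minimal_generators_irredundant:
  assumes "minimal_generating_set A S" "a \<in> A"
  shows "a \<notin> nat_span (A - {a})"
proof
  assume "a \<in> nat_span (A - {a})"
  then have "b \<in> nat_span (A - {a})" if "b \<in> A" for b
    using that nat_span_superset[of b "A - {a}"] by (cases "b = a") auto
  then have "A \<subseteq> nat_span (A - {a})" by blast
  then have "nat_span A \<subseteq> nat_span (A - {a})" by (rule nat_span_least)
  moreover have "nat_span (A - {a}) \<subseteq> nat_span A"
    by (rule nat_span_least) (auto intro: nat_span_superset)
  ultimately have "nat_span (A - {a}) = S" using assms(1) by (auto simp: minimal_generating_set_def)
  moreover have "A - {a} \<subset> A" using assms(2) by blast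
  ultimately show False using assms(1) by (simp add: minimal_generating_set_def)
qed

lemma minimal_generating_set_nonzero_generators:
  assumes "minimal_generating_set A S"
  shows "nonzero_generators A"
proof
  show "finite A" using assms by (simp add: minimal_generating_set_def)
  show "0 \<notin> A" using minimal_generators_irredundant[OF assms, of 0] nat_span_zero by blast
qed

text \<open>All summands of a proper decomposition of \<open>a\<close> are smaller than \<open>a\<close>, hence differ from \<open>a\<close>.\<close>

lemma minimal_generators_indecomposable:
  assumes min: "minimal_generating_set A S" and a: "a \<in> A"
  shows "a \<notin> sums_ge A 2"
proof
  interpret nonzero_generators A by (rule minimal_generating_set_nonzero_generators[OF min])
  have small: "x \<in> nat_span A \<Longrightarrow> vec_size x < vec_size a \<longrightarrow> x \<in> nat_span (A - {a})" for x
  proof (induction rule: nat_span_induct)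
    case (add x b)
    then show ?case using nat_span_add_generator[of x "A - {a}" b] by auto
  qed (simp add: nat_span_zero)
  assume "a \<in> sums_ge A 2"
  then obtain s b where sb: "a = s + b" "s \<in> sums_ge A (Suc 0)" "b \<in> A"
    unfolding numeral_2_eq_2 sums_ge.simps(2)[of A "Suc 0"] by blast
  then have s: "s \<in> nat_span A" "s \<noteq> 0" unfolding sums_ge_1 by auto
  have "b \<noteq> 0" using sb(3) zero_notin_A by auto
  then have "s \<in> nat_span (A - {a})" "b \<in> nat_span (A - {a})"
    using small[OF s(1)] small[OF nat_span_superset[OF sb(3)]] sb(1) s(2) by simp_all
  then show False using nat_span_add sb(1) minimal_generators_irredundant[OF min a] by blast
qed

section \<open>Length of quotients by monomial ideals\<close>

lemma (in add_submonoid) quot_module_facts: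
  fixes V defines "I \<equiv> {f :: 'm \<Rightarrow>\<^sub>0 'k::field. keys f \<subseteq> V}"
  defines "Q \<equiv> quot_module (monoid_ring U) I"
  assumes V: "V \<subseteq> U" "\<forall>u\<in>U. \<forall>v\<in>V. u + v \<in> V"
  shows "module (monoid_ring U) Q"
    and "carrier Q = (\<lambda>f. I +>\<^bsub>monoid_ring U\<^esub> f) ` {f. keys f \<subseteq> U}"
    and "keys f \<subseteq> U \<Longrightarrow> keys g \<subseteq> U \<Longrightarrow>
           (I +>\<^bsub>monoid_ring U\<^esub> f) \<oplus>\<^bsub>Q\<^esub> (I +>\<^bsub>monoid_ring U\<^esub> g) = I +>\<^bsub>monoid_ring U\<^esub> (f + g)"
    and "keys f \<subseteq> U \<Longrightarrow> keys g \<subseteq> U \<Longrightarrow>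
           f \<odot>\<^bsub>Q\<^esub> (I +>\<^bsub>monoid_ring U\<^esub> g) = I +>\<^bsub>monoid_ring U\<^esub> (f * g)"
    and "keys f \<subseteq> U \<Longrightarrow> keys g \<subseteq> U \<Longrightarrow>
           I +>\<^bsub>monoid_ring U\<^esub> f = I +>\<^bsub>monoid_ring U\<^esub> g \<longleftrightarrow> keys (f - g) \<subseteq> V"
    and "\<zero>\<^bsub>Q\<^esub> = I +>\<^bsub>monoid_ring U\<^esub> 0"
proof -
  let ?R = "monoid_ring U :: ('m \<Rightarrow>\<^sub>0 'k) ring"
  interpret R: cring ?R by (rule cring_monoid_ring)
  interpret I: ideal I ?R unfolding I_def by (rule ideal_monomials) (use V in auto)
  show "module ?R Q" unfolding Q_def by (rule module_quot_module) unfold_locales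
  show "carrier Q = (\<lambda>f. I +>\<^bsub>?R\<^esub> f) ` {f. keys f \<subseteq> U}"
    by (auto simp: Q_def quot_module_def FactRing_def A_RCOSETS_def RCOSETS_def a_r_coset_def)
  show "\<zero>\<^bsub>Q\<^esub> = I +>\<^bsub>?R\<^esub> 0"
    using R.a_rcos_zero[OF I.is_ideal, of 0] by (simp add: Q_def quot_module_def FactRing_def I_def)
  {
    assume fg: "keys f \<subseteq> U" "keys g \<subseteq> U"
    then show "(I +>\<^bsub>?R\<^esub> f) \<oplus>\<^bsub>Q\<^esub> (I +>\<^bsub>?R\<^esub> g) = I +>\<^bsub>?R\<^esub> (f + g)"
      using I.a_rcos_sum[of f g] by (simp add: Q_def quot_module_def FactRing_def)
    show "f \<odot>\<^bsub>Q\<^esub> (I +>\<^bsub>?R\<^esub> g) = I +>\<^bsub>?R\<^esub> (f * g)"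
      using I.rcoset_mult_add[of f g] fg by (simp add: Q_def quot_module_def FactRing_def)
    show "I +>\<^bsub>?R\<^esub> f = I +>\<^bsub>?R\<^esub> g \<longleftrightarrow> keys (f - g) \<subseteq> V"
      using R.quotient_eq_iff_same_a_r_cos[OF I.is_ideal, of f g] fg minus_monoid_ring[OF fg]
      by (simp add: I_def)
  }
qed

text \<open>Elements chosen from the successive differences of a chain of submodules are
  linearly independent modulo the ideal, and there the monomials outside the ideal span.\<close>

lemma (in add_submonoid) submodule_chain_bound:
  fixes V defines "I \<equiv> {f :: 'm \<Rightarrow>\<^sub>0 'k::field. keys f \<subseteq> V}"
  defines "Q \<equiv> quot_module (monoid_ring U) I"
  assumes V: "V \<subseteq> U" "\<forall>u\<in>U. \<forall>v\<in>V. u + v \<in> V" and fin: "finite (U - V)"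
    and C: "\<And>i. i \<le> m \<Longrightarrow> submodule (C i) (monoid_ring U) Q" "\<And>i. i < m \<Longrightarrow> C i \<subset> C (Suc i)"
  shows "m \<le> card (U - V)"
proof -
  let ?R = "monoid_ring U :: ('m \<Rightarrow>\<^sub>0 'k) ring"
  note Q = quot_module_facts[OF V, where 'k = 'k, folded I_def Q_def]
  interpret module ?R Q by (rule Q(1))
  interpret vs: vector_space "\<lambda>(c::'k) (f :: 'm \<Rightarrow>\<^sub>0 'k). single 0 c * f"
    by unfold_locales (simp_all add: algebra_simps single_add Poly_Mapping.mult_single flip: mult.assoc)
  define B :: "('m \<Rightarrow>\<^sub>0 'k) set" where "B = (\<lambda>x. single x 1) ` (U - V)"
  have keysB: "f \<in> vs.span B" if "keys f \<subseteq> U - V" for f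
  proof -
    have "single x c \<in> vs.span B" if "x \<in> U - V" for x c
    proof -
      have "single 0 c * single x 1 \<in> vs.span B"
        by (rule vs.span_scale) (use that in \<open>auto simp: B_def intro: vs.span_base\<close>)
      then show ?thesis by (simp add: Poly_Mapping.mult_single)
    qed
    then have "(\<Sum>a\<in>keys f. single a (lookup f a)) \<in> vs.span B"
      using that by (intro vs.span_sum) auto
    then show ?thesis by (simp flip: poly_mapping_sum_singles)
  qed
  define D where "D i = {f. keys f \<subseteq> U \<and> I +>\<^bsub>?R\<^esub> f \<in> C i}" for i
  have mono: "D i \<subseteq> D (Suc i)" if "i < m" for i using C(2)[OF that] by (auto simp: D_def)
  have sub: "vs.subspace (D i)" if i: "i \<le> m" for i
  proof (rule vs.subspaceI)
    note sE = submoduleE[OF C(1)[OF i]]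
    obtain c where c: "c \<in> C i" using sE(2) by auto
    then obtain f where f: "c = I +>\<^bsub>?R\<^esub> f" "keys f \<subseteq> U" using sE(1) Q(2) by auto
    then have "0 \<odot>\<^bsub>Q\<^esub> c = I +>\<^bsub>?R\<^esub> 0" using Q(4)[of 0 f] by simp
    then show "0 \<in> D i" using sE(4)[of 0 c] c by (simp add: D_def)
    show "f + g \<in> D i" if "f \<in> D i" "g \<in> D i" for f g
      using that sE(5)[of "I +>\<^bsub>?R\<^esub> f" "I +>\<^bsub>?R\<^esub> g"] Q(3)[of f g] by (auto simp: D_def keys_add_subset)
    show "single 0 c * f \<in> D i" if "f \<in> D i" for c f
    proof -
      have f: "keys f \<subseteq> U" "I +>\<^bsub>?R\<^esub> f \<in> C i" using that by (auto simp: D_def)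
      have c: "keys (single 0 c) \<subseteq> U" using zero_mem by simp
      have "I +>\<^bsub>?R\<^esub> (single 0 c * f) \<in> C i"
        using sE(4)[of "single 0 c" "I +>\<^bsub>?R\<^esub> f"] Q(4)[OF c f(1)] f c by simp
      then show ?thesis using keys_mult_subset[OF c f(1) add_mem] by (simp add: D_def)
    qed
  qed
  have "\<exists>v. v \<in> D (Suc i) \<and> v \<notin> D i \<and> keys v \<subseteq> U - V" if i: "i < m" for i
  proof -
    obtain c where c: "c \<in> C (Suc i)" "c \<notin> C i" using C(2)[OF i] by blast
    moreover have "C (Suc i) \<subseteq> carrier Q" by (rule submoduleE(1)[OF C(1)]) (use i in simp)
    ultimately obtain f where f: "c = I +>\<^bsub>?R\<^esub> f" "keys f \<subseteq> U" using Q(2) by auto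
    define g where "g = (\<Sum>a\<in>keys f - V. single a (lookup f a))"
    have look: "lookup g a = (if a \<in> V then 0 else lookup f a)" for a
      by (auto simp: g_def Poly_Mapping.lookup_sum lookup_single when_def in_keys_iff)
    have "keys g \<subseteq> U - V" using f(2) by (auto simp: in_keys_iff look subset_eq split: if_splits)
    moreover have "keys (f - g) \<subseteq> V" by (auto simp: in_keys_iff look lookup_minus split: if_splits)
    moreover from \<open>keys g \<subseteq> U - V\<close> have "keys g \<subseteq> U" by blast
    ultimately have "I +>\<^bsub>?R\<^esub> g = c" using f Q(5)[of f g] by simp
    then show ?thesis
      using c \<open>keys g \<subseteq> U - V\<close> by (intro exI[of _ g]) (auto simp: D_def)
  qed
  then obtain v where v: "\<And>i. i < m \<Longrightarrow> v i \<in> D (Suc i)" "\<And>i. i < m \<Longrightarrow> v i \<notin> D i"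
    "\<And>i. i < m \<Longrightarrow> keys (v i) \<subseteq> U - V" by metis
  have "k \<le> m \<Longrightarrow> vs.independent (v ` {..<k}) \<and> card (v ` {..<k}) = k \<and> v ` {..<k} \<subseteq> D k" for k
  proof (induction k)
    case (Suc k)
    then have k: "k < m" "k \<le> m" and IH: "vs.independent (v ` {..<k})" "card (v ` {..<k}) = k" "v ` {..<k} \<subseteq> D k"
      by auto
    have "vs.span (v ` {..<k}) \<subseteq> D k" by (rule vs.span_minimal[OF IH(3) sub[OF k(2)]])
    then have "v k \<notin> vs.span (v ` {..<k})" using v(2)[OF k(1)] by blast
    moreover from this have "v k \<notin> v ` {..<k}" using vs.span_base[of "v k" "v ` {..<k}"] by auto
    moreover have "v ` {..<Suc k} = insert (v k) (v ` {..<k})" by (simp add: lessThan_Suc)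
    moreover have "insert (v k) (v ` {..<k}) \<subseteq> D (Suc k)"
      using v(1)[OF k(1)] IH(3) mono[OF k(1)] by blast
    ultimately show ?case using vs.independent_insertI[OF _ IH(1)] IH(2) by simp
  qed (simp add: vs.independent_empty)
  from this[of m] have ind: "vs.independent (v ` {..<m})" "card (v ` {..<m}) = m" by auto
  have "v ` {..<m} \<subseteq> vs.span B" using v(3) keysB by auto
  moreover have "finite B" using fin by (simp add: B_def)
  ultimately have "m \<le> card B" using vs.independent_span_bound[of B "v ` {..<m}"] ind by auto
  also have "\<dots> \<le> card (U - V)" unfolding B_def by (rule card_image_le[OF fin])
  finally show ?thesis .
qed

text \<open>Monomials can be adjoined to the ideal one at a time; when the largest come first, every step
  gives an ideal.\<close>

lemma monoid_ideal_chain: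
  fixes U V :: "'m::comm_monoid_add set" and sz :: "'m \<Rightarrow> nat"
  assumes "finite (U - V)" "V \<subseteq> U" "\<forall>u\<in>U. \<forall>v\<in>V. u + v \<in> V"
    and add: "\<forall>u\<in>U. \<forall>v\<in>U. u + v \<in> U"
    and sz: "\<forall>u v. sz (u + v) = sz u + sz v" "\<forall>u\<in>U. sz u = 0 \<longrightarrow> u = 0"
  shows "\<exists>W. W 0 = V \<and> (\<forall>i\<le>card (U - V). W i \<subseteq> U \<and> V \<subseteq> W i \<and> (\<forall>u\<in>U. \<forall>w\<in>W i. u + w \<in> W i)) \<and>
             (\<forall>i<card (U - V). W i \<subset> W (Suc i))"
  using assms(1-3)
proof (induction "card (U - V)" arbitrary: V)
  case 0
  then show ?case by (intro exI[of _ "\<lambda>_. V"]) auto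
next
  case (Suc k)
  then have ne: "U - V \<noteq> {}" by auto
  have "Max (sz ` (U - V)) \<in> sz ` (U - V)" using Suc.prems(1) ne by (intro Max_in) auto
  then obtain x where x: "x \<in> U - V" "sz x = Max (sz ` (U - V))" by auto
  have max: "y \<in> V" if "y \<in> U" "sz x < sz y" for y
    using Max_ge[of "sz ` (U - V)" "sz y"] Suc.prems(1) that x by fastforce
  have absorb': "u + v \<in> insert x V" if "u \<in> U" "v \<in> insert x V" for u v
  proof (cases "v = x \<and> u \<noteq> 0")
    case True
    then have "sz u \<noteq> 0" using sz(2) that(1) by auto
    then have "sz x < sz (u + v)" using sz(1) True by simp
    then show ?thesis using max[of "u + v"] add that(1) x True by auto
  qed (use that Suc.prems(3) in auto)
  then have absorb: "\<forall>u\<in>U. \<forall>v\<in>insert x V. u + v \<in> insert x V" by blast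
  have diff: "U - insert x V = (U - V) - {x}" by auto
  have card: "k = card (U - insert x V)" using Suc.hyps(2) x(1) unfolding diff by simp
  have fin: "finite (U - insert x V)" using Suc.prems(1) unfolding diff by simp
  have sub: "insert x V \<subseteq> U" using Suc.prems(2) x(1) by auto
  from Suc.hyps(1)[OF card fin sub absorb, folded card]
  obtain W where W: "W 0 = insert x V"
    "\<forall>i\<le>k. W i \<subseteq> U \<and> insert x V \<subseteq> W i \<and> (\<forall>u\<in>U. \<forall>w\<in>W i. u + w \<in> W i)"
    "\<forall>i<k. W i \<subset> W (Suc i)"
    by (elim exE conjE) simp
  show ?case
    unfolding Suc.hyps(2)[symmetric]
  proof (intro exI[of _ "case_nat V W"] conjI allI impI)
    fix i
    show "i \<le> Suc k \<Longrightarrow> (case i of 0 \<Rightarrow> V | Suc j \<Rightarrow> W j) \<subseteq> U"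
      "i \<le> Suc k \<Longrightarrow> V \<subseteq> (case i of 0 \<Rightarrow> V | Suc j \<Rightarrow> W j)"
      "i \<le> Suc k \<Longrightarrow> \<forall>u\<in>U. \<forall>w\<in>case i of 0 \<Rightarrow> V | Suc j \<Rightarrow> W j. u + w \<in> (case i of 0 \<Rightarrow> V | Suc j \<Rightarrow> W j)"
      using Suc.prems W(2) by (cases i; force)+
    show "i < Suc k \<Longrightarrow> (case i of 0 \<Rightarrow> V | Suc j \<Rightarrow> W j) \<subset> (case Suc i of 0 \<Rightarrow> V | Suc j \<Rightarrow> W j)"
      using W(1,3) x(1) by (cases i) auto
  qed simp
qed

lemma (in add_submonoid) length_quotient_monomial_ideal:
  fixes V defines "I \<equiv> {f :: 'm \<Rightarrow>\<^sub>0 'k::field. keys f \<subseteq> V}"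
  assumes V: "V \<subseteq> U" "\<forall>u\<in>U. \<forall>v\<in>V. u + v \<in> V" and fin: "finite (U - V)"
    and sz: "\<And>u v. sz (u + v) = sz u + (sz v :: nat)" "\<And>u. u \<in> U \<Longrightarrow> sz u = 0 \<Longrightarrow> u = 0"
  shows "module_length (monoid_ring U) (quot_module (monoid_ring U) I) = enat (card (U - V))"
proof -
  let ?R = "monoid_ring U :: ('m \<Rightarrow>\<^sub>0 'k) ring"
  let ?Q = "quot_module ?R I"
  note Q = quot_module_facts[OF V, where 'k = 'k, folded I_def]
  interpret Q: module ?R ?Q by (rule Q(1))
  have "\<forall>u\<in>U. \<forall>v\<in>U. u + v \<in> U" "\<forall>u v. sz (u + v) = sz u + sz v" "\<forall>u\<in>U. sz u = 0 \<longrightarrow> u = 0"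
    using add_mem sz by auto
  from monoid_ideal_chain[OF fin V this]
  obtain W where "W 0 = V"
    "\<forall>i\<le>card (U - V). W i \<subseteq> U \<and> V \<subseteq> W i \<and> (\<forall>u\<in>U. \<forall>w\<in>W i. u + w \<in> W i)"
    "\<forall>i<card (U - V). W i \<subset> W (Suc i)"
    by (elim exE conjE) simp
  then have W: "W 0 = V"
    "\<And>i. i \<le> card (U - V) \<Longrightarrow> W i \<subseteq> U" "\<And>i. i \<le> card (U - V) \<Longrightarrow> V \<subseteq> W i"
    "\<And>i u w. i \<le> card (U - V) \<Longrightarrow> u \<in> U \<Longrightarrow> w \<in> W i \<Longrightarrow> u + w \<in> W i"
    "\<And>i. i < card (U - V) \<Longrightarrow> W i \<subset> W (Suc i)"
    by simp_all
  define C where "C i = (\<lambda>f. I +>\<^bsub>?R\<^esub> f) ` {f. keys f \<subseteq> W i}" for i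
  have sub: "submodule (C i) ?R ?Q" if i: "i \<le> card (U - V)" for i
  proof (rule Q.submoduleI)
    have U: "keys f \<subseteq> U" if "keys f \<subseteq> W i" for f :: "'m \<Rightarrow>\<^sub>0 'k"
      using that W(2)[OF i] by blast
    show "C i \<subseteq> carrier ?Q" using Q(2) U by (auto simp: C_def)
    show "\<zero>\<^bsub>?Q\<^esub> \<in> C i" using Q(6) by (auto simp: C_def intro!: image_eqI[of _ _ 0])
    show add: "a \<oplus>\<^bsub>?Q\<^esub> b \<in> C i" if "a \<in> C i" "b \<in> C i" for a b
    proof -
      obtain f g where fg: "a = I +>\<^bsub>?R\<^esub> f" "keys f \<subseteq> W i"
        "b = I +>\<^bsub>?R\<^esub> g" "keys g \<subseteq> W i" using \<open>a \<in> C i\<close> \<open>b \<in> C i\<close> by (auto simp: C_def)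
      then show ?thesis using Q(3)[of f g] U keys_add_subset[of f "W i" g] by (auto simp: C_def)
    qed
    show smult: "r \<odot>\<^bsub>?Q\<^esub> b \<in> C i" if "r \<in> carrier ?R" "b \<in> C i" for r b
    proof -
      obtain g where g: "b = I +>\<^bsub>?R\<^esub> g" "keys g \<subseteq> W i" using \<open>b \<in> C i\<close> by (auto simp: C_def)
      moreover have "keys (r * g) \<subseteq> W i"
        using keys_mult_subset[of r U g "W i" "W i"] W(4)[OF i] that(1) g(2) by auto
      ultimately show ?thesis using Q(4)[of r g] U that(1) by (auto simp: C_def)
    qed
    show "\<ominus>\<^bsub>?Q\<^esub> b \<in> C i" if "b \<in> C i" for b
    proof -
      have "b \<in> carrier ?Q" using \<open>C i \<subseteq> carrier ?Q\<close> \<open>b \<in> C i\<close> by blast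
      then have "\<ominus>\<^bsub>?Q\<^esub> b = (\<ominus>\<^bsub>?R\<^esub> \<one>\<^bsub>?R\<^esub>) \<odot>\<^bsub>?Q\<^esub> b"
        using Q.smult_l_minus[of "\<one>\<^bsub>?R\<^esub>" b] Q.R.one_closed Q.smult_one by simp
      then show ?thesis using smult[of "\<ominus>\<^bsub>?R\<^esub> \<one>\<^bsub>?R\<^esub>" b] \<open>b \<in> C i\<close> Q.R.one_closed Q.R.a_inv_closed by simp
    qed
  qed
  have strict: "C i \<subset> C (Suc i)" if i: "i < card (U - V)" for i
  proof -
    obtain x where x: "x \<in> W (Suc i)" "x \<notin> W i" using W(5)[OF i] by blast
    let ?f = "single x (1::'k)"
    have "I +>\<^bsub>?R\<^esub> ?f \<notin> C i"
    proof
      assume "I +>\<^bsub>?R\<^esub> ?f \<in> C i"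
      then obtain g where g: "I +>\<^bsub>?R\<^esub> ?f = I +>\<^bsub>?R\<^esub> g" "keys g \<subseteq> W i" by (auto simp: C_def)
      have "keys (?f - g) \<subseteq> V"
        using Q(5)[of ?f g] g x(1) W(2)[of i] W(2)[of "Suc i"] i by auto
      moreover have "x \<in> keys (?f - g)"
        using g(2) x(2) by (auto simp: in_keys_iff lookup_minus subset_eq)
      ultimately show False using x(2) W(3)[of i] i by auto
    qed
    moreover have "I +>\<^bsub>?R\<^esub> ?f \<in> C (Suc i)" using x(1) by (auto simp: C_def)
    moreover have "C i \<subseteq> C (Suc i)" using W(5)[OF i] by (auto simp: C_def)
    ultimately show ?thesis by blast
  qed
  show ?thesis
    unfolding module_length_def
  proof (rule antisym)
    show "Sup {enat n |n. \<exists>C. (\<forall>i\<le>n. submodule (C i) ?R ?Q) \<and> (\<forall>i<n. C i \<subset> C (Suc i))} \<le> enat (card (U - V))"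
    proof (rule Sup_least)
      fix x assume "x \<in> {enat n |n. \<exists>C. (\<forall>i\<le>n. submodule (C i) ?R ?Q) \<and> (\<forall>i<n. C i \<subset> C (Suc i))}"
      then obtain n C where nC: "x = enat n" "\<forall>i\<le>n. submodule (C i) ?R ?Q" "\<forall>i<n. C i \<subset> C (Suc i)"
        by blast
      have "n \<le> card (U - V)"
        by (rule submodule_chain_bound[OF V fin, where 'k = 'k and C = C]) (use nC in \<open>auto simp: I_def\<close>)
      then show "x \<le> enat (card (U - V))" using nC(1) by simp
    qed
    show "enat (card (U - V)) \<le> Sup {enat n |n. \<exists>C. (\<forall>i\<le>n. submodule (C i) ?R ?Q) \<and> (\<forall>i<n. C i \<subset> C (Suc i))}"
      by (rule Sup_upper) (use sub strict in blast)
  qed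
qed

section \<open>The Hilbert function of a free semigroup\<close>

text \<open>A slack entry turns the bound on the sum into an equation.\<close>

lemma card_lists_sum_list_le:
  "card {l :: nat list. length l = d \<and> sum_list l \<le> m} = (m + d) choose d"
proof -
  have "bij_betw (\<lambda>l. (m - sum_list l) # l) {l :: nat list. length l = d \<and> sum_list l \<le> m}
          {l. length l = Suc d \<and> sum_list l = m}"
    by (rule bij_betwI[where g = tl]) (auto simp: length_Suc_conv)
  then have "card {l :: nat list. length l = d \<and> sum_list l \<le> m} = card {l :: nat list. length l = Suc d \<and> sum_list l = m}"
    by (rule bij_betw_same_card)
  also have "\<dots> = (m + d) choose d"
    by (simp add: card_length_sum_list binomial_symmetric[of m "m + d"])
  finally show ?thesis .
qed

lemma finite_lists_sum_list_le: "finite {l :: nat list. length l = d \<and> sum_list l \<le> m}"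
proof (rule finite_subset)
  show "{l :: nat list. length l = d \<and> sum_list l \<le> m} \<subseteq> {l. set l \<subseteq> {..m} \<and> length l = d}"
    using member_le_sum_list by fastforce
qed (simp add: finite_lists_length_eq)

lemma binomial_shift_asymptotic:
  "(\<lambda>n. fact d / real n ^ d * real (if k < n then (n - 1 - k + d) choose d else 0)) \<longlonglongrightarrow> 1"
proof (rule Lim_transform_eventually)
  have "(\<lambda>n. \<Prod>i<d. 1 + (real d - 1 - real k - real i) / real n) \<longlonglongrightarrow> (\<Prod>i<d. 1 + 0)"
    by (intro tendsto_prod tendsto_add tendsto_const lim_const_over_n)
  then show "(\<lambda>n. \<Prod>i<d. 1 + (real d - 1 - real k - real i) / real n) \<longlonglongrightarrow> 1" by simp
  show "\<forall>\<^sub>F n in sequentially. (\<Prod>i<d. 1 + (real d - 1 - real k - real i) / real n) =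
      fact d / real n ^ d * real (if k < n then (n - 1 - k + d) choose d else 0)"
    using eventually_gt_at_top[of k]
  proof eventually_elim
    case (elim n)
    have n0: "real n \<noteq> 0" using elim by simp
    have "fact d * real ((n - 1 - k + d) choose d) = (\<Prod>i<d. real (n - 1 - k + d) - real i)"
      by (simp add: binomial_gbinomial gbinomial_prod_rev atLeast0LessThan)
    also have "\<dots> = (\<Prod>i<d. real n * (1 + (real d - 1 - real k - real i) / real n))"
    proof (rule prod.cong)
      fix i
      show "real (n - 1 - k + d) - real i = real n * (1 + (real d - 1 - real k - real i) / real n)"
        using elim n0 by (simp add: field_simps of_nat_diff)
    qed simp
    also have "\<dots> = real n ^ d * (\<Prod>i<d. 1 + (real d - 1 - real k - real i) / real n)"
      by (simp only: prod.distrib) simp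
    finally show ?case using elim n0 by (simp add: field_simps)
  qed
qed

context free_over
begin

text \<open>Each element is uniquely \<open>w + comb c\<close>, and its order is \<open>ord w + \<Sum> c\<close>; the summand of \<open>w\<close> counts the
  \<open>c\<close> with \<open>ord w + \<Sum> c < n\<close>.\<close>

lemma card_not_sums_ge:
  "card (S - sums_ge A n) = (\<Sum>w\<in>Apery. if ord w < n then (n - 1 - ord w + d) choose d else 0)"
proof -
  let ?g = "\<lambda>(w, l). w + comb (\<lambda>i. l ! i)"
  let ?L = "\<lambda>w. {l :: nat list. length l = d \<and> ord w + sum_list l < n}"
  have sum_l: "(\<Sum>i<d. l ! i) = sum_list l" if "length l = d" for l :: "nat list"
    using that by (simp add: sum_list_sum_nth atLeast0LessThan)
  have "bij_betw ?g (SIGMA w:Apery. ?L w) (S - sums_ge A n)"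
    unfolding bij_betw_def
  proof
    show "inj_on ?g (SIGMA w:Apery. ?L w)"
    proof (rule inj_onI)
      fix p q assume pq: "p \<in> (SIGMA w:Apery. ?L w)" "q \<in> (SIGMA w:Apery. ?L w)"
        "?g p = ?g q"
      obtain w l w' l' where p: "p = (w, l)" "q = (w', l')" by (cases p, cases q)
      have "w = w' \<and> (\<forall>i<d. l ! i = l' ! i)" using pq p by (intro Apery_comb_unique) auto
      then show "p = q" using pq p by (auto intro: nth_equalityI)
    qed
    show "?g ` (SIGMA w:Apery. ?L w) = S - sums_ge A n"
    proof
      show "?g ` (SIGMA w:Apery. ?L w) \<subseteq> S - sums_ge A n"
      proof (rule image_subsetI)
        fix p assume p: "p \<in> (SIGMA w:Apery. ?L w)"
        then obtain w l where wl: "p = (w, l)"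
          and *: "w \<in> Apery" "length l = d" "ord w + sum_list l < n" by auto
        have "w \<in> S" using *(1) by (simp add: Apery_def)
        then show "(case p of (w, l) \<Rightarrow> w + comb (\<lambda>i. l ! i)) \<in> S - sums_ge A n"
          unfolding wl using add_comb[of w "\<lambda>i. l ! i"] sum_l[OF *(2)] *(3) sums_ge_iff_le_ord by auto
      qed
      show "S - sums_ge A n \<subseteq> ?g ` (SIGMA w:Apery. ?L w)"
      proof
        fix s assume s: "s \<in> S - sums_ge A n"
        then obtain w c where wc: "w \<in> Apery" "s = w + comb c" using Apery_decomposition by blast
        define l where "l = map c [0..<d]"
        have l: "length l = d" "comb (\<lambda>i. l ! i) = comb c" by (auto simp: l_def comb_def)
        have "w \<in> S" using wc(1) by (simp add: Apery_def)
        then have "ord s = ord w + sum_list l"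
          using add_comb[of w "\<lambda>i. l ! i"] sum_l[OF l(1)] l(2) wc(2) by simp
        then have "ord w + sum_list l < n" using s sums_ge_iff_le_ord[of s n] by auto
        then show "s \<in> ?g ` (SIGMA w:Apery. ?L w)"
          using wc l by (intro image_eqI[of _ _ "(w, l)"]) auto
      qed
    qed
  qed
  then have "card (S - sums_ge A n) = card (SIGMA w:Apery. ?L w)" by (rule bij_betw_same_card[symmetric])
  also have "\<dots> = (\<Sum>w\<in>Apery. card (?L w))"
  proof (rule card_SigmaI[OF finite_Apery], rule ballI)
    fix w
    have "?L w \<subseteq> {l. length l = d \<and> sum_list l \<le> n}" by auto
    then show "finite (?L w)" using finite_lists_sum_list_le finite_subset by blast
  qed
  also have "\<dots> = (\<Sum>w\<in>Apery. if ord w < n then (n - 1 - ord w + d) choose d else 0)"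
  proof (rule sum.cong)
    fix w
    show "card (?L w) = (if ord w < n then (n - 1 - ord w + d) choose d else 0)"
    proof (cases "ord w < n")
      case True
      then have "?L w = {l. length l = d \<and> sum_list l \<le> n - 1 - ord w}" by auto
      then show ?thesis using True card_lists_sum_list_le by simp
    next
      case False
      then have "?L w = {}" by auto
      then show ?thesis using False by simp
    qed
  qed simp
  finally show ?thesis .
qed

lemma hilbert_samuel_limit:
  "(\<lambda>n. fact d / real n ^ d * real (card (S - sums_ge A n))) \<longlonglongrightarrow> real (card Apery)"
proof -
  have "(\<lambda>n. \<Sum>w\<in>Apery. fact d / real n ^ d * real (if ord w < n then (n - 1 - ord w + d) choose d else 0))
      \<longlonglongrightarrow> (\<Sum>w\<in>Apery. 1)"
    by (intro tendsto_sum binomial_shift_asymptotic)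
  then show ?thesis by (simp only: card_not_sums_ge of_nat_sum sum_distrib_left) simp
qed

end

section \<open>The coordinates of a reduction by extremal elements\<close>

lemma real_vec_simps [simp]:
  "real_vec 0 = 0" "real_vec (x + y) = real_vec x + real_vec y" "real_vec x = real_vec y \<longleftrightarrow> x = y"
  by (simp_all add: real_vec_def vec_eq_iff)

lemma real_vec_scale: "real_vec (n *s x) = real n *\<^sub>R real_vec x"
  by (simp add: real_vec_def vec_eq_iff)

lemma extremal_elements_subset: "extremal_elements S \<subseteq> S" "0 \<notin> extremal_elements S"
  by (auto simp: extremal_elements_def)

text \<open>Each extremal element is the least one on some extremal ray, so no ray serves two of them.\<close>

lemma card_extremal_elements_le:
  fixes S :: "(nat ^ 'd) set"
  assumes "card (extremal_rays (semigroup_cone S)) = CARD('d)"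
  shows "finite (extremal_elements S) \<and> card (extremal_elements S) \<le> CARD('d)"
proof -
  let ?R = "extremal_rays (semigroup_cone S)"
  have "\<forall>a\<in>extremal_elements S. \<exists>F\<in>?R. real_vec a \<in> F \<and> (\<forall>b\<in>S. b \<noteq> 0 \<and> real_vec b \<in> F \<longrightarrow> a \<le> b)"
    by (auto simp: extremal_elements_def)
  then obtain F where F: "\<And>a. a \<in> extremal_elements S \<Longrightarrow> F a \<in> ?R"
    "\<And>a. a \<in> extremal_elements S \<Longrightarrow> real_vec a \<in> F a"
    "\<And>a b. a \<in> extremal_elements S \<Longrightarrow> b \<in> S \<Longrightarrow> b \<noteq> 0 \<Longrightarrow> real_vec b \<in> F a \<Longrightarrow> a \<le> b"
    by metis
  have inj: "inj_on F (extremal_elements S)"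
  proof (rule inj_onI)
    fix a b assume ab: "a \<in> extremal_elements S" "b \<in> extremal_elements S" "F a = F b"
    then have "a \<in> S" "b \<in> S" "a \<noteq> 0" "b \<noteq> 0" by (auto simp: extremal_elements_def)
    then have "a \<le> b" "b \<le> a" using F ab by metis+
    then show "a = b" by simp
  qed
  have fin: "finite ?R" using assms zero_less_card_finite[where 'a = 'd] by (metis card.infinite less_nat_zero_code)
  have sub: "F ` extremal_elements S \<subseteq> ?R" using F(1) by auto
  show ?thesis
    using card_inj_on_le[OF inj sub fin] finite_imageD[OF finite_subset[OF sub fin] inj] assms by simp
qed

context nonzero_generators
begin

lemma scale_generator_in_sums_ge: "a \<in> A \<Longrightarrow> k *s a \<in> sums_ge A k"
proof (induction k)
  case (Suc k)
  then have "k *s a + a \<in> sums_ge A (Suc k)" by auto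
  then show ?case by (simp add: add.commute del: sums_ge.simps)
qed (simp add: nat_span_zero)

lemma scale_in_nat_span: "s \<in> S \<Longrightarrow> k *s s \<in> S"
  by (induction k) (auto intro: nat_span_zero nat_span_add)

end

context reducing_elements
begin

text \<open>Among the multiples of \<open>s\<close>, each of which is a sum of elements of \<open>E\<close> up to one of finitely many
  remainders, two have the same remainder.\<close>

lemma real_vec_in_span_E:
  assumes "s \<in> S"
  shows "real_vec s \<in> span (real_vec ` E)"
proof -
  have "\<forall>k. \<exists>es t. k *s s = sum_list es + t \<and> set es \<subseteq> E \<and> t \<in> S - sums_ge A (Suc N)"
    using decompose_over_E[of _ 0] scale_in_nat_span[OF assms] by fastforce
  then obtain es t where est: "\<And>k. k *s s = sum_list (es k) + t k" "\<And>k. set (es k) \<subseteq> E"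
    "\<And>k. t k \<in> S - sums_ge A (Suc N)" by metis
  have "range t \<subseteq> S - sums_ge A (Suc N)" using est(3) by auto
  then have "finite (range t)" using finite_not_sums_ge finite_subset by blast
  then have "\<not> inj t" using finite_imageD infinite_UNIV_nat by blast
  then obtain k l where kl: "k \<noteq> l" "t k = t l" by (auto simp: inj_on_def)
  have sp: "real_vec (sum_list es) \<in> span (real_vec ` E)" if "set es \<subseteq> E" for es
    using that by (induction es) (auto intro: span_zero span_add span_base)
  have "(real k - real l) *\<^sub>R real_vec s = real_vec (k *s s) - real_vec (l *s s)"
    by (simp add: real_vec_scale algebra_simps)
  also have "\<dots> = real_vec (sum_list (es k)) - real_vec (sum_list (es l))"
    unfolding est(1) by (simp add: kl(2))
  finally have "(real k - real l) *\<^sub>R real_vec s \<in> span (real_vec ` E)"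
    using span_diff sp est(2) by metis
  then have "(1 / (real k - real l)) *\<^sub>R ((real k - real l) *\<^sub>R real_vec s) \<in> span (real_vec ` E)"
    by (rule span_scale)
  then show ?thesis using kl(1) by simp
qed

end

text \<open>Coordinates with respect to \<open>E\<close>. They are nonnegative on the semigroup, and their sum dominates
  the order, with equality on \<open>E\<close>.\<close>

locale coordinates = reducing_elements +
  fixes lam :: "nat ^ 'a \<Rightarrow> nat ^ 'a \<Rightarrow> real"
  assumes finite_E: "finite E" and card_E: "card E = CARD('a)"
    and lam_add: "\<And>a x y. a \<in> E \<Longrightarrow> lam a (x + y) = lam a x + lam a y"
    and lam_E: "\<And>a b. a \<in> E \<Longrightarrow> b \<in> E \<Longrightarrow> lam a b = (if a = b then 1 else 0)"
    and lam_nonneg: "\<And>a s. a \<in> E \<Longrightarrow> s \<in> S \<Longrightarrow> 0 \<le> lam a s"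
    and lam_eq_0: "\<And>s. s \<in> S \<Longrightarrow> (\<And>a. a \<in> E \<Longrightarrow> lam a s = 0) \<Longrightarrow> s = 0"
    and le_sum_lam: "\<And>n s. s \<in> sums_ge A n \<Longrightarrow> real n \<le> (\<Sum>a\<in>E. lam a s)"

text \<open>The extremal elements span, and there are at most as many as the dimension, so they form a basis.
  In the decomposition of \<open>k s\<close> into elements of \<open>E\<close> and a remainder, the coordinates of the remainder are
  bounded independently of \<open>k\<close>; a negative coordinate of \<open>s\<close>, or a generator with coordinate sum below
  one, would violate such a bound for large \<open>k\<close>.\<close>

lemma (in reducing_elements) coordinates_exist:
  assumes E: "E = extremal_elements S" and simp: "simplicial_affine_semigroup S"
  shows "\<exists>lam. coordinates A E N lam"
proof -
  let ?B = "real_vec ` E"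
  have finE: "finite E" and cardE: "card E \<le> CARD('d)"
    using card_extremal_elements_le[of S] simp by (auto simp: E simplicial_affine_semigroup_def)
  have inj: "inj_on real_vec E" by (auto simp: inj_on_def)
  have "span (real_vec ` S) \<subseteq> span ?B" using real_vec_in_span_E by (intro span_minimal) auto
  then have sp: "span ?B = UNIV" using simp by (auto simp: simplicial_affine_semigroup_def)
  have "dim (UNIV :: (real ^ 'd) set) = CARD('d)" by simp
  then have ind: "independent ?B"
    using sp cardE finE card_image[OF inj] by (intro card_le_dim_spanning[of _ UNIV]) auto
  have "card ?B = CARD('d)" using dim_span_eq_card_independent[OF ind] sp by simp
  then have cardE: "card E = CARD('d)" using card_image[OF inj] by simp
  define lam where "lam a x = representation ?B (real_vec x) (real_vec a)" for a x
  have spx: "v \<in> span ?B" for v using sp by simp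
  have add: "lam a (x + y) = lam a x + lam a y" for a x y
    by (simp add: lam_def representation_add[OF ind spx spx])
  have lamE: "lam a b = (if a = b then 1 else 0)" if "a \<in> E" "b \<in> E" for a b
    using that by (simp add: lam_def representation_basis[OF ind])
  have zero: "lam a 0 = 0" for a using add[of a 0 0] by simp
  have scale: "lam a (k *s x) = real k * lam a x" for a k x
    by (induction k) (simp_all add: zero add algebra_simps)
  have list: "0 \<le> lam a (sum_list es)" if "a \<in> E" "set es \<subseteq> E" for a es
    using that(2) by (induction es) (auto simp: zero add lamE that(1))
  have list_sum: "(\<Sum>a\<in>E. lam a (sum_list es)) = real (length es)" if "set es \<subseteq> E" for es
    using that
  proof (induction es)
    case (Cons b es)
    have "(\<Sum>a\<in>E. lam a b) = (\<Sum>a\<in>E. if a = b then 1 else 0)" using Cons.prems by (intro sum.cong) (auto simp: lamE)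
    then show ?case using Cons finE by (simp add: add sum.distrib)
  qed (simp add: zero)
  have nonneg: "0 \<le> lam a s" if a: "a \<in> E" and s: "s \<in> S" for a s
  proof (rule ccontr)
    assume neg: "\<not> 0 \<le> lam a s"
    \<comment> \<open>a bound for the coordinate on all remainders\<close>
    define K where "K = (\<Sum>t\<in>S - sums_ge A (Suc N). \<bar>lam a t\<bar>)"
    obtain k where k: "K < real k * (- lam a s)" using neg reals_Archimedean3[of "- lam a s"] by auto
    obtain es t where est: "k *s s = sum_list es + t" "set es \<subseteq> E" "t \<in> S - sums_ge A (Suc N)"
      using decompose_over_E[of "k *s s" 0] scale_in_nat_span[OF s] by auto
    have "\<bar>lam a t\<bar> \<le> K" unfolding K_def
      by (rule member_le_sum[OF est(3) _ finite_not_sums_ge]) simp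
    moreover have "real k * lam a s = lam a (sum_list es) + lam a t"
      using est(1) by (simp flip: scale add)
    ultimately show False using list[OF a est(2)] k by simp
  qed
  have eq0: "s = 0" if "\<And>a. a \<in> E \<Longrightarrow> lam a s = 0" for s
  proof -
    have "representation ?B (real_vec s) b = 0" for b
      using that representation_ne_zero[of ?B "real_vec s" b] by (auto simp: lam_def)
    then have "real_vec s = 0" using sum_nonzero_representation_eq[OF ind spx, of "real_vec s"] by simp
    then show ?thesis using real_vec_simps(1,3) by metis
  qed
  have gen: "1 \<le> (\<Sum>a\<in>E. lam a b)" if b: "b \<in> A" for b
  proof (rule ccontr)
    assume "\<not> 1 \<le> (\<Sum>a\<in>E. lam a b)"
    then obtain k where k: "real N < real k * (1 - (\<Sum>a\<in>E. lam a b))"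
      using reals_Archimedean3[of "1 - (\<Sum>a\<in>E. lam a b)"] by auto
    obtain es t where est: "k *s b = sum_list es + t" "set es \<subseteq> E" "t \<in> S - sums_ge A (Suc N)"
        "k \<le> length es + N"
      using decompose_over_E[OF scale_generator_in_sums_ge[OF b]] by blast
    have "real k * (\<Sum>a\<in>E. lam a b) = (\<Sum>a\<in>E. lam a (k *s b))" by (simp add: scale sum_distrib_left)
    also have "\<dots> = real (length es) + (\<Sum>a\<in>E. lam a t)"
      unfolding est(1) by (simp add: add sum.distrib list_sum[OF est(2)])
    also have "\<dots> \<ge> real k - real N" using est(3,4) by (simp add: sum_nonneg nonneg add_increasing2)
    finally show False using k by (simp add: algebra_simps)
  qed
  have le_sum: "real n \<le> (\<Sum>a\<in>E. lam a s)" if "s \<in> sums_ge A n" for n s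
    using that
  proof (induction n arbitrary: s)
    case 0
    then show ?case by (simp add: sum_nonneg nonneg)
  next
    case (Suc n)
    then obtain t b where tb: "s = t + b" "t \<in> sums_ge A n" "b \<in> A" by auto
    show ?case using Suc.IH[OF tb(2)] gen[OF tb(3)] by (simp add: tb(1) add sum.distrib)
  qed
  have "coordinates A E N lam"
    by unfold_locales (use finE cardE add lamE nonneg eq0 le_sum in auto)
  then show ?thesis by blast
qed

section \<open>Depth sensitivity of the Koszul complex\<close>

text \<open>The diagonal has to be assumed to vanish separately because of characteristic two.\<close>

lemma sum_alternating_eq_0:
  fixes u :: "'i \<Rightarrow> 'i \<Rightarrow> 'a::ab_group_add"
  assumes "finite W" "\<And>i j. i \<in> W \<Longrightarrow> j \<in> W \<Longrightarrow> u i j = - u j i" "\<And>i. i \<in> W \<Longrightarrow> u i i = 0"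
  shows "(\<Sum>i\<in>W. \<Sum>j\<in>W. u i j) = 0"
  using assms
proof (induction W rule: finite_induct)
  case (insert x F)
  have "(\<Sum>i\<in>F. u i x) = (\<Sum>i\<in>F. - u x i)"
    by (rule sum.cong) (blast intro: insert.prems(1))+
  moreover have "(\<Sum>i\<in>F. \<Sum>j\<in>F. u i j) = 0"
    by (rule insert.IH) (blast intro: insert.prems)+
  moreover have "u x x = 0" by (rule insert.prems) simp
  ultimately show ?case
    using insert.hyps by (simp add: sum.distrib sum_negf)
qed simp

text \<open>The Koszul complex of \<open>y\<^sub>0, \<dots>, y\<^sub>d\<^sub>-\<^sub>1\<close> over a subring \<open>C\<close>; a chain is a function on subsets of
  the index set, and a chain of degree \<open>p\<close> is supported on subsets of size \<open>p\<close>. Homology is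
  considered with coefficients in the quotient of \<open>C\<close> by an ideal, always through representatives.\<close>

locale koszul =
  fixes C :: "'a::comm_ring_1 set" and y :: "nat \<Rightarrow> 'a" and d :: nat
  assumes zero_C: "0 \<in> C" and one_C: "1 \<in> C" and add_C: "\<And>a b. a \<in> C \<Longrightarrow> b \<in> C \<Longrightarrow> a + b \<in> C"
    and uminus_C: "\<And>a. a \<in> C \<Longrightarrow> - a \<in> C" and mult_C: "\<And>a b. a \<in> C \<Longrightarrow> b \<in> C \<Longrightarrow> a * b \<in> C"
    and y_C: "\<And>i. i < d \<Longrightarrow> y i \<in> C"
begin

definition C_ideal :: "'a set \<Rightarrow> bool" where
  "C_ideal J \<longleftrightarrow> 0 \<in> J \<and> J \<subseteq> C \<and> (\<forall>a\<in>J. \<forall>b\<in>J. a + b \<in> J) \<and> (\<forall>c\<in>C. \<forall>a\<in>J. c * a \<in> J)"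

lemma C_ideal_C: "C_ideal C"
  by (simp add: C_ideal_def zero_C add_C mult_C)

lemma
  assumes "C_ideal J"
  shows C_ideal_0: "0 \<in> J"
    and C_ideal_add: "a \<in> J \<Longrightarrow> b \<in> J \<Longrightarrow> a + b \<in> J"
    and C_ideal_mult: "c \<in> C \<Longrightarrow> a \<in> J \<Longrightarrow> c * a \<in> J"
  using assms by (auto simp: C_ideal_def)

lemma C_ideal_uminus: "C_ideal J \<Longrightarrow> a \<in> J \<Longrightarrow> - a \<in> J"
  using C_ideal_mult[of J "-1" a] uminus_C[OF one_C] by simp

lemma C_ideal_diff: "C_ideal J \<Longrightarrow> a \<in> J \<Longrightarrow> b \<in> J \<Longrightarrow> a - b \<in> J"
  using C_ideal_add[of J a "- b"] C_ideal_uminus by simp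

lemma C_ideal_sum: "C_ideal J \<Longrightarrow> (\<And>i. i \<in> I \<Longrightarrow> f i \<in> J) \<Longrightarrow> sum f I \<in> J"
  by (induction I rule: infinite_finite_induct) (auto intro: C_ideal_0 C_ideal_add)

definition pos_sign :: "nat \<Rightarrow> nat set \<Rightarrow> 'a" where
  "pos_sign i F = (-1) ^ card {k \<in> F. k < i}"

lemma pos_sign_C: "pos_sign i F \<in> C"
proof -
  have "(-1) ^ n \<in> C" for n by (induction n) (auto intro: one_C uminus_C)
  then show ?thesis by (simp add: pos_sign_def)
qed

lemma pos_sign_square: "pos_sign i F * pos_sign i F = 1"
  by (simp add: pos_sign_def flip: power_add mult_2)

lemma pos_sign_insert:
  assumes "finite F" "i \<notin> F"
  shows "pos_sign j (insert i F) = (if i < j then - pos_sign j F else pos_sign j F)"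
proof (cases "i < j")
  case True
  then have "{k \<in> insert i F. k < j} = insert i {k \<in> F. k < j}" by auto
  then show ?thesis using True assms by (simp add: pos_sign_def)
next
  case False
  then have "{k \<in> insert i F. k < j} = {k \<in> F. k < j}" by auto
  then show ?thesis using False by (simp add: pos_sign_def)
qed

lemma pos_sign_swap:
  assumes "finite F" "i \<notin> F" "j \<notin> F" "i \<noteq> j"
  shows "pos_sign i F * pos_sign j (insert i F) = - (pos_sign j F * pos_sign i (insert j F))"
  using assms by (auto simp: pos_sign_insert not_less)

definition bdry :: "(nat set \<Rightarrow> 'a) \<Rightarrow> nat set \<Rightarrow> 'a" where
  "bdry z F = (\<Sum>i\<in>{..<d} - F. pos_sign i F * y i * z (insert i F))"

definition wedge :: "nat \<Rightarrow> (nat set \<Rightarrow> 'a) \<Rightarrow> nat set \<Rightarrow> 'a" where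
  "wedge j z F = (if j \<in> F then pos_sign j (F - {j}) * z (F - {j}) else 0)"

definition chain :: "nat \<Rightarrow> (nat set \<Rightarrow> 'a) \<Rightarrow> bool" where
  "chain p z \<longleftrightarrow> (\<forall>F. z F \<in> C \<and> (z F \<noteq> 0 \<longrightarrow> F \<subseteq> {..<d} \<and> card F = p))"

lemma chain_C: "chain p z \<Longrightarrow> z F \<in> C"
  by (simp add: chain_def)

lemma chain_support:
  assumes "chain p z" "z F \<noteq> 0"
  shows "F \<subseteq> {..<d}" "card F = p" "finite F"
  using assms finite_subset[of F "{..<d}"] by (simp_all add: chain_def)

lemma bdry_in_ideal:
  assumes "C_ideal J" "\<And>F. z F \<in> J"
  shows "bdry z F \<in> J"
  unfolding bdry_def
  by (intro C_ideal_sum[OF assms(1)] C_ideal_mult[OF assms(1)] mult_C pos_sign_C y_C assms(2)) auto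

lemma chain_bdry:
  assumes "chain (Suc p) z"
  shows "chain p (bdry z)"
proof -
  have "F \<subseteq> {..<d} \<and> card F = p" if "bdry z F \<noteq> 0" for F
  proof -
    from that obtain i where "i \<in> {..<d} - F" "pos_sign i F * y i * z (insert i F) \<noteq> 0"
      unfolding bdry_def by (rule sum.not_neutral_contains_not_neutral)
    then have i: "i \<in> {..<d} - F" "z (insert i F) \<noteq> 0" by auto
    have "insert i F \<subseteq> {..<d}" "card (insert i F) = Suc p" "finite F"
      using chain_support[OF assms i(2)] by auto
    then show ?thesis using i(1) by auto
  qed
  moreover have "bdry z F \<in> C" for F
    using bdry_in_ideal[OF C_ideal_C] chain_C[OF assms] by blast
  ultimately show ?thesis by (auto simp: chain_def)
qed

lemma chain_wedge:
  assumes "chain p z" "j < d"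
  shows "chain (Suc p) (wedge j z)"
proof -
  have "F \<subseteq> {..<d} \<and> card F = Suc p" if "wedge j z F \<noteq> 0" for F
  proof -
    have F: "j \<in> F" "z (F - {j}) \<noteq> 0" using that by (auto simp: wedge_def split: if_splits)
    have "F - {j} \<subseteq> {..<d}" "card (F - {j}) = p" "finite F"
      using chain_support[OF assms(1) F(2)] by auto
    then show ?thesis using F(1) assms(2) card_Suc_Diff1[of F j] by auto
  qed
  moreover have "wedge j z F \<in> C" for F
    using chain_C[OF assms(1)] by (auto simp: wedge_def zero_C intro: mult_C pos_sign_C)
  ultimately show ?thesis by (auto simp: chain_def)
qed

lemma chain_sum:
  assumes "\<And>i. i \<in> I \<Longrightarrow> chain p (z i)"
  shows "chain p (\<lambda>F. \<Sum>i\<in>I. z i F)"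
  unfolding chain_def
proof (intro allI conjI impI)
  fix F
  show "(\<Sum>i\<in>I. z i F) \<in> C"
    by (rule C_ideal_sum[OF C_ideal_C]) (rule chain_C[OF assms])
  assume "(\<Sum>i\<in>I. z i F) \<noteq> 0"
  then obtain i where i: "i \<in> I" "z i F \<noteq> 0" by (rule sum.not_neutral_contains_not_neutral)
  show "F \<subseteq> {..<d}" "card F = p" by (rule chain_support[OF assms[OF i(1)] i(2)])+
qed

lemma chain_scale: "chain p z \<Longrightarrow> c \<in> C \<Longrightarrow> chain p (\<lambda>F. c * z F)"
  unfolding chain_def using mult_C by (metis mult_zero_right)

lemma bdry_add: "bdry (\<lambda>F. z F + w F) F = bdry z F + bdry w F"
  by (simp add: bdry_def algebra_simps sum.distrib)

lemma bdry_scale: "bdry (\<lambda>F. c * z F) F = c * bdry z F"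
  by (simp add: bdry_def sum_distrib_left algebra_simps)

lemma bdry_sum: "bdry (\<lambda>F. \<Sum>i\<in>I. z i F) F = (\<Sum>i\<in>I. bdry (z i) F)"
  unfolding bdry_def by (subst sum.swap) (simp add: sum_distrib_left)

lemma bdry_bdry:
  assumes "chain p z"
  shows "bdry (bdry z) F = 0"
proof (cases "F \<subseteq> {..<d}")
  case False
  then have "z (insert j (insert i F)) = 0" for i j
    using chain_support(1)[OF assms, of "insert j (insert i F)"] by blast
  then show ?thesis by (simp add: bdry_def)
next
  case True
  then have fin: "finite F" using finite_subset by blast
  let ?W = "{..<d} - F"
  define u where "u i j = (if i = j then 0 else
      pos_sign i F * pos_sign j (insert i F) * (y i * y j * z (insert i (insert j F))))" for i j
  have "bdry (bdry z) F = (\<Sum>i\<in>?W. \<Sum>j\<in>?W. u i j)"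
  proof -
    have "pos_sign i F * y i * (\<Sum>j\<in>{..<d} - insert i F. pos_sign j (insert i F) * y j * z (insert j (insert i F)))
        = (\<Sum>j\<in>?W. u i j)" if "i \<in> ?W" for i
    proof -
      have "(\<Sum>j\<in>?W. u i j) = (\<Sum>j\<in>{..<d} - insert i F. u i j)"
        by (rule sum.mono_neutral_right) (auto simp: u_def)
      also have "\<dots> = (\<Sum>j\<in>{..<d} - insert i F. pos_sign i F * y i * (pos_sign j (insert i F) * y j * z (insert j (insert i F))))"
        by (intro sum.cong) (auto simp: u_def insert_commute)
      finally show ?thesis by (simp add: sum_distrib_left)
    qed
    then show ?thesis unfolding bdry_def by (intro sum.cong) auto
  qed
  also have "\<dots> = 0"
  proof (rule sum_alternating_eq_0)
    show "u i j = - u j i" if "i \<in> ?W" "j \<in> ?W" for i j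
      using pos_sign_swap[OF fin, of i j] that
      by (auto simp: u_def insert_commute algebra_simps)
  qed (auto simp: u_def)
  finally show ?thesis .
qed

text \<open>Exterior multiplication by the \<open>j\<close>-th basis element is a null homotopy of \<open>y\<^sub>j\<close>.\<close>

lemma wedge_homotopy:
  assumes "j < d" "F \<subseteq> {..<d}"
  shows "bdry (wedge j z) F + wedge j (bdry z) F = y j * z F"
proof (cases "j \<in> F")
  case False
  have "bdry (wedge j z) F = (\<Sum>i\<in>{..<d} - F. if i = j then y j * z F else 0)"
    unfolding bdry_def
  proof (rule sum.cong)
    fix i assume i: "i \<in> {..<d} - F"
    have "insert j F - {j} = F" using False by auto
    moreover have "pos_sign j F * y j * (pos_sign j F * z F) = (pos_sign j F * pos_sign j F) * (y j * z F)"
      by (simp only: mult_ac)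
    ultimately show "pos_sign i F * y i * wedge j z (insert i F) = (if i = j then y j * z F else 0)"
      using False by (auto simp: wedge_def pos_sign_square)
  qed simp
  also have "\<dots> = y j * z F" using assms False by simp
  finally show ?thesis using False by (simp add: wedge_def)
next
  case True
  define H where "H = F - {j}"
  have F: "F = insert j H" "j \<notin> H" using True by (auto simp: H_def)
  have fin: "finite H" using assms(2) finite_subset by (auto simp: H_def)
  have "bdry (wedge j z) F = (\<Sum>i\<in>{..<d} - F. - (pos_sign j H * (pos_sign i H * y i * z (insert i H))))"
    unfolding bdry_def
  proof (rule sum.cong)
    fix i assume i: "i \<in> {..<d} - F"
    have "insert i F - {j} = insert i H" using i F by auto
    then have "pos_sign i F * y i * wedge j z (insert i F)
        = (pos_sign j (insert i H) * pos_sign i (insert j H)) * (y i * z (insert i H))"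
      using i F by (simp add: wedge_def mult_ac)
    also have "pos_sign j (insert i H) * pos_sign i (insert j H) = - (pos_sign j H * pos_sign i H)"
      using i F fin by (auto simp: pos_sign_insert not_less)
    finally show "pos_sign i F * y i * wedge j z (insert i F)
        = - (pos_sign j H * (pos_sign i H * y i * z (insert i H)))" by (simp add: mult_ac)
  qed simp
  moreover have "wedge j (bdry z) F =
      y j * z F + (\<Sum>i\<in>{..<d} - F. pos_sign j H * (pos_sign i H * y i * z (insert i H)))"
  proof -
    have "{..<d} - H = insert j ({..<d} - F)" using F assms(1) by auto
    then have "bdry z H = pos_sign j H * y j * z F + (\<Sum>i\<in>{..<d} - F. pos_sign i H * y i * z (insert i H))"
      unfolding bdry_def by (simp add: True F(1)[symmetric])
    moreover have "wedge j (bdry z) F = pos_sign j H * bdry z H"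
      using True by (simp add: wedge_def H_def)
    moreover have "pos_sign j H * (pos_sign j H * y j * z F) = y j * z F"
      by (simp add: pos_sign_square flip: mult.assoc)
    ultimately show ?thesis by (simp add: algebra_simps sum_distrib_left)
  qed
  ultimately show ?thesis by (simp add: sum_negf)
qed

text \<open>The homology in degree \<open>p\<close> with coefficients in \<open>C / J\<close> vanishes.\<close>

definition acyclic :: "nat \<Rightarrow> 'a set \<Rightarrow> bool" where
  "acyclic p J \<longleftrightarrow> (\<forall>z. chain p z \<and> (\<forall>F. bdry z F \<in> J) \<longrightarrow>
      (\<exists>u. chain (Suc p) u \<and> (\<forall>F. z F - bdry u F \<in> J)))"

lemma acyclic_above:
  assumes "d < p" "C_ideal J"
  shows "acyclic p J"
  unfolding acyclic_def
proof (intro allI impI)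
  fix z assume "chain p z \<and> (\<forall>F. bdry z F \<in> J)"
  moreover have "card F \<le> d" if "F \<subseteq> {..<d}" for F using card_mono[OF _ that] by simp
  ultimately have z0: "z F = 0" for F
    using assms(1) chain_support(1,2)[of p z F] by (metis leD)
  then show "\<exists>u. chain (Suc p) u \<and> (\<forall>F. z F - bdry u F \<in> J)"
    using C_ideal_0[OF assms(2)]
    by (intro exI[of _ "\<lambda>_. 0"]) (simp add: chain_def zero_C bdry_def z0)
qed

text \<open>This is the long exact homology sequence of multiplication by \<open>f\<close>: if the homology modulo
  \<open>J + (f)\<close> vanishes one degree higher, then \<open>f\<close> acts injectively on the homology modulo \<open>J\<close>. A power
  of \<open>f\<close> in the ideal of the \<open>y\<^sub>j\<close> acts as zero on homology, hence that homology vanishes.\<close>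

lemma acyclic_descend:
  assumes J: "C_ideal J" and f: "f \<in> C"
    and regular: "\<And>c. c \<in> C \<Longrightarrow> f * c \<in> J \<Longrightarrow> c \<in> J"
    and ac: "acyclic (Suc p) {a + f * c | a c. a \<in> J \<and> c \<in> C}"
    and pow: "f ^ n = (\<Sum>j<d. c j * y j) + b" "b \<in> J" "\<And>j. j < d \<Longrightarrow> c j \<in> C"
  shows "acyclic p J"
  unfolding acyclic_def
proof (intro allI impI)
  fix z assume z: "chain p z \<and> (\<forall>F. bdry z F \<in> J)"
  let ?bounds = "\<lambda>z. \<exists>u. chain (Suc p) u \<and> (\<forall>F. z F - bdry u F \<in> J)"
  have fC: "f ^ k \<in> C" for k by (induction k) (auto intro: one_C mult_C f)
  have inj: "?bounds z" if z: "chain p z" "\<And>F. bdry z F \<in> J" and fz: "?bounds (\<lambda>F. f * z F)" for z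
  proof -
    let ?J' = "{a + f * c | a c. a \<in> J \<and> c \<in> C}"
    obtain w where w: "chain (Suc p) w" "\<And>F. f * z F - bdry w F \<in> J" using fz by blast
    have "bdry w F \<in> ?J'" for F
    proof -
      have "bdry w F = - (f * z F - bdry w F) + f * z F" by simp
      then show ?thesis using C_ideal_uminus[OF J w(2)[of F]] chain_C[OF z(1)] by blast
    qed
    then obtain u where u: "chain (Suc (Suc p)) u" "\<And>F. w F - bdry u F \<in> ?J'"
      using ac w(1) unfolding acyclic_def by blast
    have "\<forall>F. \<exists>a v. a \<in> J \<and> v \<in> C \<and> (v \<noteq> 0 \<longrightarrow> F \<subseteq> {..<d} \<and> card F = Suc p) \<and>
        w F = bdry u F + a + f * v"
    proof
      fix F
      show "\<exists>a v. a \<in> J \<and> v \<in> C \<and> (v \<noteq> 0 \<longrightarrow> F \<subseteq> {..<d} \<and> card F = Suc p) \<and>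
        w F = bdry u F + a + f * v"
    proof (cases "w F = 0 \<and> bdry u F = 0")
      case True
      then show ?thesis using C_ideal_0[OF J] zero_C by (intro exI[of _ 0]) auto
    next
      case False
      then have supp: "F \<subseteq> {..<d} \<and> card F = Suc p"
        using chain_support(1,2)[OF w(1), of F] chain_support(1,2)[OF chain_bdry[OF u(1)], of F] by auto
      obtain a v where av: "a \<in> J" "v \<in> C" "w F - bdry u F = a + f * v" using u(2)[of F] by blast
      then have "w F = bdry u F + a + f * v" by (simp add: algebra_simps)
      then show ?thesis using supp av(1,2) by blast
    qed
    qed
    then obtain a v where a: "\<And>F. a F \<in> J" and v: "chain (Suc p) v"
      and w_eq: "\<And>F. w F = bdry u F + a F + f * v F"
      unfolding chain_def choice_iff by blast
    have "bdry w F = bdry a F + f * bdry v F" for F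
    proof -
      have "bdry w F = bdry (\<lambda>F. (bdry u F + a F) + f * v F) F" using w_eq by presburger
      then show ?thesis by (simp add: bdry_add bdry_scale bdry_bdry[OF u(1)])
    qed
    then have "f * (z F - bdry v F) = (f * z F - bdry w F) + bdry a F" for F by (simp add: algebra_simps)
    then have "f * (z F - bdry v F) \<in> J" for F
      using C_ideal_add[OF J w(2)] bdry_in_ideal[OF J] a by metis
    then have "z F - bdry v F \<in> J" for F
      using regular C_ideal_diff[OF C_ideal_C] chain_C[OF z(1)] chain_C[OF chain_bdry[OF v]] by blast
    then show ?thesis using v by blast
  qed
  have null: "?bounds (\<lambda>F. f ^ n * z F)"
  proof (intro exI conjI allI)
    let ?w = "\<lambda>F. \<Sum>j<d. c j * wedge j z F"
    show w: "chain (Suc p) ?w"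
      by (intro chain_sum chain_scale chain_wedge) (use z pow(3) in auto)
    fix F
    show "f ^ n * z F - bdry ?w F \<in> J"
    proof (cases "F \<subseteq> {..<d}")
      case False
      then have "z F = 0" "bdry ?w F = 0" using z chain_support(1)[of p z F] chain_support(1)[OF chain_bdry[OF w]] by blast+
      then show ?thesis using C_ideal_0[OF J] by simp
    next
      case True
      have "bdry ?w F = (\<Sum>j<d. c j * (y j * z F - wedge j (bdry z) F))"
        unfolding bdry_sum bdry_scale
      proof (rule sum.cong)
        fix j assume "j \<in> {..<d}"
        then have "bdry (wedge j z) F = y j * z F - wedge j (bdry z) F"
          using wedge_homotopy[of j F z] True by (simp add: algebra_simps)
        then show "c j * bdry (wedge j z) F = c j * (y j * z F - wedge j (bdry z) F)" by simp
      qed simp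
      then have "f ^ n * z F - bdry ?w F = z F * b + (\<Sum>j<d. c j * wedge j (bdry z) F)"
        by (simp add: pow(1) algebra_simps sum_subtractf sum_distrib_left sum_distrib_right)
      moreover have "wedge j (bdry z) F \<in> J" for j
        using z C_ideal_mult[OF J pos_sign_C] C_ideal_0[OF J] by (simp add: wedge_def)
      then have "(\<Sum>j<d. c j * wedge j (bdry z) F) \<in> J"
        by (intro C_ideal_sum[OF J] C_ideal_mult[OF J] pow(3)) auto
      moreover have "z F * b \<in> J" using z chain_C C_ideal_mult[OF J _ pow(2)] by blast
      ultimately show ?thesis using C_ideal_add[OF J] by simp
    qed
  qed
  have "?bounds (\<lambda>F. f ^ k * z F) \<Longrightarrow> ?bounds z" for k
  proof (induction k)
    case (Suc k)
    have "?bounds (\<lambda>F. f ^ k * z F)"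
    proof (rule inj)
      show "chain p (\<lambda>F. f ^ k * z F)" using z fC by (intro chain_scale) auto
      show "bdry (\<lambda>F. f ^ k * z F) F \<in> J" for F
        unfolding bdry_scale using z fC C_ideal_mult[OF J] by blast
      show "?bounds (\<lambda>F. f * (f ^ k * z F))" using Suc.prems by (simp add: mult.assoc)
    qed
    then show ?case by (rule Suc.IH)
  qed simp
  then show "?bounds z" using null by blast
qed

text \<open>There are no chains in degrees above \<open>d\<close>; each time the last member of the regular
  sequence \<open>f\<close> is removed from the ideal, acyclicity descends by one degree. As the sequence has at least
  \<open>d\<close> members, the homology modulo \<open>J 0\<close> vanishes in degree one, which is stated here in terms of
  relations and alternating matrices.\<close>

lemma koszul_relations_trivial:
  fixes f :: "nat \<Rightarrow> 'a" and J :: "nat \<Rightarrow> 'a set"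
  assumes J: "\<And>i. i \<le> L \<Longrightarrow> C_ideal (J i)" and L: "d \<le> L"
    and J_Suc: "\<And>i. i < L \<Longrightarrow> J (Suc i) = {a + f i * c | a c. a \<in> J i \<and> c \<in> C}"
    and f: "\<And>i. i < L \<Longrightarrow> f i \<in> C"
    and regular: "\<And>i c. i < L \<Longrightarrow> c \<in> C \<Longrightarrow> f i * c \<in> J i \<Longrightarrow> c \<in> J i"
    and pow: "\<And>i. i < L \<Longrightarrow> \<exists>n c b. f i ^ n = (\<Sum>j<d. c j * y j) + b \<and> b \<in> J 0 \<and> (\<forall>j<d. c j \<in> C)"
    and z: "\<And>i. i < d \<Longrightarrow> z i \<in> C" "(\<Sum>i<d. y i * z i) \<in> J 0"
  obtains u where "\<And>i j. u i j \<in> C" "\<And>i j. u i j = - u j i" "\<And>i. u i i = 0"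
    "\<And>i. i < d \<Longrightarrow> z i - (\<Sum>j<d. y j * u i j) \<in> J 0"
proof -
  have J_mono: "i \<le> L \<Longrightarrow> J 0 \<subseteq> J i" for i
  proof (induction i)
    case (Suc i)
    have "a \<in> {a + f i * c | a c. a \<in> J i \<and> c \<in> C}" if "a \<in> J i" for a
      using that zero_C by (intro CollectI exI[of _ a] exI[of _ 0]) auto
    then have "J i \<subseteq> J (Suc i)" using J_Suc[OF Suc_le_lessD[OF Suc.prems]] by blast
    moreover have "J 0 \<subseteq> J i" by (rule Suc.IH) (use Suc.prems in simp)
    ultimately show ?case by blast
  qed simp
  have "k \<le> L \<Longrightarrow> d < p + k \<Longrightarrow> acyclic p (J (L - k))" for k p
  proof (induction k arbitrary: p)
    case 0
    then show ?case using acyclic_above J by simp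
  next
    case (Suc k)
    define i where "i = L - Suc k"
    have i: "i < L" "L - k = Suc i" using Suc.prems(1) by (auto simp: i_def)
    obtain n c b where ncb: "f i ^ n = (\<Sum>j<d. c j * y j) + b" "b \<in> J 0" "\<forall>j<d. c j \<in> C"
      using pow[OF i(1)] by blast
    have "acyclic (Suc p) (J (Suc i))" using Suc.IH[of "Suc p"] Suc.prems i by simp
    then have ac: "acyclic (Suc p) {a + f i * c | a c. a \<in> J i \<and> c \<in> C}" using J_Suc[OF i(1)] by simp
    have "acyclic p (J i)"
      by (rule acyclic_descend[OF J f regular ac ncb(1)]) (use i ncb J_mono[of i] in auto)
    then show ?case by (simp add: i_def)
  qed
  from this[of L 1] have ac: "acyclic 1 (J 0)" using L by simp
  define z' where "z' F = (if \<exists>i<d. F = {i} then z (the_elem F) else 0)" for F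
  have z'1: "z' {i} = z i" if "i < d" for i using that by (simp add: z'_def)
  have z': "chain 1 z'" unfolding chain_def z'_def using z(1) zero_C by auto
  have "bdry z' F \<in> J 0" for F
  proof (cases "F = {}")
    case True
    have "bdry z' {} = (\<Sum>i<d. y i * z i)"
      unfolding bdry_def by (intro sum.cong) (auto simp: pos_sign_def z'1)
    then show ?thesis using z(2) True by simp
  next
    case False
    then have "bdry z' F = 0" using chain_support(2,3)[of 0 "bdry z'" F] chain_bdry[of 0 z'] z' by auto
    then show ?thesis using C_ideal_0[OF J] by simp
  qed
  then obtain u where u: "chain 2 u" "\<And>F. z' F - bdry u F \<in> J 0"
    using ac z' unfolding acyclic_def by (metis Suc_1)
  define U where "U i j = (if i = j then 0 else pos_sign j {i} * u {i, j})" for i j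
  show ?thesis
  proof (rule that[of U])
    show "U i j \<in> C" for i j using chain_C[OF u(1)] by (auto simp: U_def zero_C intro: mult_C pos_sign_C)
    show "U i j = - U j i" for i j
    proof -
      have "pos_sign l {k} = (if k < l then - 1 else 1)" for k l
        using pos_sign_insert[of "{}" k l] by (simp add: pos_sign_def)
      then show ?thesis by (auto simp: U_def insert_commute not_less)
    qed
    show "U i i = 0" for i by (simp add: U_def)
    show "z i - (\<Sum>j<d. y j * U i j) \<in> J 0" if "i < d" for i
    proof -
      have "(\<Sum>j<d. y j * U i j) = (\<Sum>j\<in>{..<d} - {i}. y j * U i j)"
        by (rule sum.mono_neutral_right) (auto simp: U_def)
      also have "\<dots> = bdry u {i}"
        unfolding bdry_def by (intro sum.cong) (auto simp: U_def insert_commute mult_ac)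
      finally show ?thesis using u(2)[of "{i}"] z'1[OF that] by simp
    qed
  qed
qed

end

declare sums_ge.simps(2) [simp del]

section \<open>The associated graded ring as a quotient of the Rees algebra\<close>

text \<open>The exponent \<open>(s, n)\<close> stands for the monomial \<open>x\<^sup>s t\<^sup>n\<close> of the Rees algebra; this is the coefficient of \<open>t\<^sup>n\<close>.\<close>

definition slice :: "nat \<Rightarrow> ('m::comm_monoid_add \<times> nat \<Rightarrow>\<^sub>0 'k::field) \<Rightarrow> ('m \<Rightarrow>\<^sub>0 'k)" where
  "slice n f = (\<Sum>p\<in>keys f.
     if snd p = n then single (fst p) (lookup f p) else 0)"

lemma lookup_slice: "lookup (slice n f) s = lookup f (s, n)"
proof -
  have "lookup (slice n f) s =
      (\<Sum>p\<in>keys f. if p = (s, n) then lookup f p else 0)"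
    unfolding slice_def Poly_Mapping.lookup_sum
    by (intro sum.cong) (auto simp: lookup_single when_def prod_eq_iff)
  then show ?thesis by (simp add: in_keys_iff)
qed

lemma slice_add: "slice n (f + g) = slice n f + slice n g"
  by (rule poly_mapping_eqI) (simp add: lookup_slice lookup_add)

lemma slice_0 [simp]: "slice n 0 = 0"
  by (rule poly_mapping_eqI) (simp add: lookup_slice)

lemma slice_sum: "slice n (sum f I) = (\<Sum>i\<in>I. slice n (f i))"
  by (induction I rule: infinite_finite_induct) (simp_all add: slice_add)

lemma slice_single: "slice n (single p c) = (if snd p = n then single (fst p) c else 0)"
  by (rule poly_mapping_eqI) (auto simp: lookup_slice lookup_single when_def prod_eq_iff)

lemma slice_mult: "slice k (f * g) = (\<Sum>i\<le>k. slice i f * slice (k - i) g)"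
proof -
  let ?t = "\<lambda>a b. single (fst a + fst b) (lookup f a * lookup g b)"
  have "(\<Sum>i\<le>k. slice i f * slice (k - i) g)
      = (\<Sum>i\<le>k. \<Sum>a\<in>keys f. \<Sum>b\<in>keys g.
           if snd a = i \<and> snd b = k - i then ?t a b else 0)"
    unfolding slice_def sum_product
    by (intro sum.cong) (auto simp: Poly_Mapping.mult_single)
  also have "\<dots> = (\<Sum>a\<in>keys f. \<Sum>b\<in>keys g. \<Sum>i\<le>k.
           if snd a = i \<and> snd b = k - i then ?t a b else 0)"
    by (subst sum.swap, intro sum.cong refl, subst sum.swap) simp
  also have "\<dots> = (\<Sum>a\<in>keys f. \<Sum>b\<in>keys g.
           if snd a + snd b = k then ?t a b else 0)"
  proof (intro sum.cong refl)
    fix a b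
    have "(\<Sum>i\<le>k. if snd a = i \<and> snd b = k - i then ?t a b else 0)
        = (\<Sum>i\<le>k. if i = snd a then if snd a + snd b = k then ?t a b else 0 else 0)"
      by (intro sum.cong) auto
    then show "(\<Sum>i\<le>k. if snd a = i \<and> snd b = k - i then ?t a b else 0)
        = (if snd a + snd b = k then ?t a b else 0)" by auto
  qed
  also have "\<dots> = slice k (f * g)"
    by (subst mult_as_double_sum) (auto simp: slice_sum slice_single intro!: sum.cong)
  finally show ?thesis ..
qed

type_synonym ('d, 'k) graded_family = "nat \<Rightarrow> (nat ^ 'd \<Rightarrow>\<^sub>0 'k) set"

context nonzero_generators
begin

definition rees :: "((nat ^ 'd) \<times> nat) set" where
  "rees = {(s, n). s \<in> sums_ge A n}"

text \<open>These monomials span the kernel of the map from the Rees algebra to the associated graded ring.\<close>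

definition rees_next :: "((nat ^ 'd) \<times> nat) set" where
  "rees_next = {(s, n). s \<in> sums_ge A (Suc n)}"

lemma add_submonoid_rees: "add_submonoid rees"
  by unfold_locales (auto simp: rees_def zero_prod_def nat_span_zero intro: sums_ge_add)

lemma rees_next_subset: "rees_next \<subseteq> rees"
  by (auto simp: rees_def rees_next_def intro: sums_ge_SucD)

lemma rees_next_absorbs: "u \<in> rees \<Longrightarrow> v \<in> rees_next \<Longrightarrow> u + v \<in> rees_next"
  using sums_ge_add by (fastforce simp: rees_def rees_next_def)

abbreviation filt :: "nat \<Rightarrow> (nat ^ 'd \<Rightarrow>\<^sub>0 'k::field) set" where
  "filt n \<equiv> {f. keys f \<subseteq> sums_ge A n}"

lemma ideal_filt: "ideal (filt n) (monoid_ring S)"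
  by (rule add_submonoid.ideal_monomials[OF add_submonoid_nat_span sums_ge_subset]) (rule sums_ge_absorbs)

lemma filt_mult: "f \<in> filt m \<Longrightarrow> g \<in> filt n \<Longrightarrow> f * g \<in> filt (m + n)"
  using keys_mult_subset[OF _ _ sums_ge_add] by blast

lemma filt_Suc_subset: "filt (Suc n) \<subseteq> filt n"
  using sums_ge_SucD by auto

lemma filt_subset: "f \<in> filt n \<Longrightarrow> keys f \<subseteq> S"
  using sums_ge_subset by blast

abbreviation cs :: "nat \<Rightarrow> (nat ^ 'd \<Rightarrow>\<^sub>0 'k::field) \<Rightarrow> (nat ^ 'd \<Rightarrow>\<^sub>0 'k) set" where
  "cs n f \<equiv> filt n +>\<^bsub>monoid_ring S\<^esub> f"

lemma cs_mem_iff: "g \<in> cs n f \<longleftrightarrow> g - f \<in> filt n"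
proof -
  have "g \<in> cs n f \<longleftrightarrow> (\<exists>h\<in>filt n. g = h + f)" by (simp add: a_r_coset_def')
  also have "\<dots> \<longleftrightarrow> g - f \<in> filt n" by (metis add_diff_cancel diff_add_cancel)
  finally show ?thesis .
qed

lemma cs_eq_iff:
  fixes f g :: "nat ^ 'd \<Rightarrow>\<^sub>0 'k::field"
  assumes "keys f \<subseteq> S" "keys g \<subseteq> S"
  shows "cs n f = cs n g \<longleftrightarrow> f - g \<in> filt n"
proof -
  interpret cring "monoid_ring S :: (nat ^ 'd \<Rightarrow>\<^sub>0 'k) ring"
    by (rule add_submonoid.cring_monoid_ring[OF add_submonoid_nat_span])
  show ?thesis
    using quotient_eq_iff_same_a_r_cos[OF ideal_filt, of f g n] assms
      add_submonoid.minus_monoid_ring[OF add_submonoid_nat_span assms] by simp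
qed

lemma cs_0: "cs n 0 = filt n"
proof (rule Set.set_eqI)
  fix g
  show "g \<in> cs n 0 \<longleftrightarrow> g \<in> filt n" using cs_mem_iff[of g n 0] by simp
qed

text \<open>Changing the representatives by elements of higher order changes the product by an element of
  higher order, so all products of representatives lie in a single coset.\<close>

lemma rcoset_mult_cs:
  fixes a b :: "nat ^ 'd \<Rightarrow>\<^sub>0 'k::field"
  assumes a: "a \<in> filt i" and b: "b \<in> filt j"
  shows "rcoset_mult (monoid_ring S) (filt (Suc (i + j))) (cs (Suc i) a) (cs (Suc j) b) = cs (Suc (i + j)) (a * b)"
proof -
  have eq: "cs (Suc (i + j)) (a' * b') = cs (Suc (i + j)) (a * b)"
    if a': "a' \<in> cs (Suc i) a" and b': "b' \<in> cs (Suc j) b" for a' b'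
  proof -
    have da: "a' - a \<in> filt (Suc i)" and db: "b' - b \<in> filt (Suc j)"
      using a' b' unfolding cs_mem_iff .
    have b'j: "b' \<in> filt j"
    proof -
      have "(b' - b) + b \<in> filt j"
        using keys_add_subset[of "b' - b" "sums_ge A j" b] b subsetD[OF filt_Suc_subset db] by blast
      then show ?thesis by simp
    qed
    have a'i: "a' \<in> filt i"
    proof -
      have "(a' - a) + a \<in> filt i"
        using keys_add_subset[of "a' - a" "sums_ge A i" a] a subsetD[OF filt_Suc_subset da] by blast
      then show ?thesis by simp
    qed
    have "(a' - a) * b' \<in> filt (Suc (i + j))" using filt_mult[OF da b'j] by simp
    moreover have "a * (b' - b) \<in> filt (Suc (i + j))" using filt_mult[OF a db] by simp
    ultimately have "(a' - a) * b' + a * (b' - b) \<in> filt (Suc (i + j))"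
      using keys_add_subset[of "(a' - a) * b'" "sums_ge A (Suc (i + j))"] by blast
    then have "a' * b' - a * b \<in> filt (Suc (i + j))" by (simp add: algebra_simps)
    then show ?thesis
      using cs_eq_iff[of "a' * b'" "a * b"] filt_subset[OF filt_mult[OF a'i b'j]] filt_subset[OF filt_mult[OF a b]]
      by blast
  qed
  have self: "x \<in> cs n x" for x :: "nat ^ 'd \<Rightarrow>\<^sub>0 'k" and n by (simp only: cs_mem_iff) simp
  have "rcoset_mult (monoid_ring S) (filt (Suc (i + j))) (cs (Suc i) a) (cs (Suc j) b)
      = (\<Union>a'\<in>cs (Suc i) a. \<Union>b'\<in>cs (Suc j) b. cs (Suc (i + j)) (a' * b'))"
    by (simp only: rcoset_mult_def monoid_ring_simps)
  also have "\<dots> = (\<Union>a'\<in>cs (Suc i) a. \<Union>b'\<in>cs (Suc j) b. cs (Suc (i + j)) (a * b))"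
    by (intro SUP_cong refl eq)
  also have "\<dots> = cs (Suc (i + j)) (a * b)" using self[of a "Suc i"] self[of b "Suc j"] by blast
  finally show ?thesis .
qed

text \<open>The map sends \<open>\<Sum> f\<^sub>n t\<^sup>n\<close> to the family of classes of the \<open>f\<^sub>n\<close>.\<close>

definition gr_map :: "((nat ^ 'd) \<times> nat \<Rightarrow>\<^sub>0 'k::field) \<Rightarrow> ('d, 'k) graded_family" where
  "gr_map f = (\<lambda>n. cs (Suc n) (slice n f))"

lemma slice_filt: "keys f \<subseteq> rees \<Longrightarrow> slice n f \<in> filt n"
  by (auto simp: in_keys_iff lookup_slice rees_def subset_eq)

abbreviation gr :: "('d, 'k::field) graded_family ring" where
  "gr \<equiv> assoc_graded (semigroup_ring S) (filt (Suc 0))"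

lemma assoc_graded_simps:
  "carrier gr = {f. (\<forall>i. f i \<in> cs (Suc i) ` filt i) \<and> finite {i. f i \<noteq> filt (Suc i)}}"
  "mult gr f g = (\<lambda>k. finsum (monoid_ring S Quot filt (Suc k))
       (\<lambda>i. rcoset_mult (monoid_ring S) (filt (Suc k)) (f i) (g (k - i))) {..k})"
  "one gr = (\<lambda>k. if k = 0 then cs (Suc 0) 1 else filt (Suc k))"
  "zero gr = (\<lambda>k. filt (Suc k))"
  "add gr f g = (\<lambda>k. f k \<oplus>\<^bsub>monoid_ring S Quot filt (Suc k)\<^esub> g k)"
  unfolding assoc_graded_def ideal_power_eq Suc_eq_plus1[symmetric]
  unfolding semigroup_ring_eq_monoid_ring
  by (simp_all add: fun_eq_iff)

lemma gr_map_ring_hom: "gr_map \<in> ring_hom (monoid_ring rees) (gr :: ('d, 'k::field) graded_family ring)"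
proof (rule ring_hom_memI)
  let ?R = "monoid_ring S :: (nat ^ 'd \<Rightarrow>\<^sub>0 'k) ring"
  interpret R: cring ?R by (rule add_submonoid.cring_monoid_ring[OF add_submonoid_nat_span])
  fix f g :: "(nat ^ 'd) \<times> nat \<Rightarrow>\<^sub>0 'k"
  assume "f \<in> carrier (monoid_ring rees)"
  then have f: "keys f \<subseteq> rees" by simp
  have "{i. gr_map f i \<noteq> filt (Suc i)} \<subseteq> snd ` keys f"
  proof
    fix i assume "i \<in> {i. gr_map f i \<noteq> filt (Suc i)}"
    then have "slice i f \<noteq> 0" using cs_0[of "Suc i"] by (auto simp: gr_map_def)
    then obtain s where "lookup (slice i f) s \<noteq> 0" by (metis lookup_zero poly_mapping_eqI)
    then have "(s, i) \<in> keys f" by (simp add: lookup_slice in_keys_iff)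
    then show "i \<in> snd ` keys f" by force
  qed
  then have "finite {i. gr_map f i \<noteq> filt (Suc i)}" by (rule finite_subset) simp
  moreover have "gr_map f i \<in> cs (Suc i) ` filt i" for i
    unfolding gr_map_def by (rule imageI) (rule slice_filt[OF f])
  ultimately show "gr_map f \<in> carrier gr" unfolding assoc_graded_simps by blast
  assume "g \<in> carrier (monoid_ring rees)"
  then have g: "keys g \<subseteq> rees" by simp
  have sl: "slice i f \<in> carrier ?R" "slice i g \<in> carrier ?R" for i
    using filt_subset[OF slice_filt[OF f]] filt_subset[OF slice_filt[OF g]] by simp_all
  show "gr_map (f \<oplus>\<^bsub>monoid_ring rees\<^esub> g) = gr_map f \<oplus>\<^bsub>gr\<^esub> gr_map g"
  proof
    fix k
    interpret I: ideal "filt (Suc k) :: (nat ^ 'd \<Rightarrow>\<^sub>0 'k) set" ?R by (rule ideal_filt)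
    show "gr_map (f \<oplus>\<^bsub>monoid_ring rees\<^esub> g) k = (gr_map f \<oplus>\<^bsub>gr\<^esub> gr_map g) k"
      unfolding assoc_graded_simps gr_map_def
      using ring_hom_add[OF I.rcos_ring_hom sl(1) sl(2), of k k]
      by (simp add: slice_add)
  qed
  show "gr_map (f \<otimes>\<^bsub>monoid_ring rees\<^esub> g) = gr_map f \<otimes>\<^bsub>gr\<^esub> gr_map g"
  proof
    fix k
    interpret I: ideal "filt (Suc k) :: (nat ^ 'd \<Rightarrow>\<^sub>0 'k) set" ?R by (rule ideal_filt)
    interpret h: ring_hom_cring ?R "?R Quot filt (Suc k)" "cs (Suc k)"
      by (rule I.rcos_ring_hom_cring) (rule R.is_cring)
    let ?p = "\<lambda>i. slice i f * slice (k - i) g"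
    have p: "keys (?p i) \<subseteq> S" for i
      using R.m_closed[OF sl(1) sl(2), of i "k - i"] by simp
    have "cs (Suc k) (\<Sum>i\<le>k. ?p i) = cs (Suc k) (finsum ?R ?p {..k})"
      by (subst add_submonoid.finsum_monoid_ring[OF add_submonoid_nat_span]) (auto dest: subsetD[OF p])
    also have "\<dots> = finsum (?R Quot filt (Suc k)) (cs (Suc k) \<circ> ?p) {..k}"
      by (rule h.hom_finsum) (use p in auto)
    also have "\<dots> = finsum (?R Quot filt (Suc k))
        (\<lambda>i. rcoset_mult ?R (filt (Suc k)) (gr_map f i) (gr_map g (k - i))) {..k}"
    proof -
      have eq: "rcoset_mult ?R (filt (Suc k)) (gr_map f i) (gr_map g (k - i)) = cs (Suc k) (?p i)" if "i \<le> k" for i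
        using rcoset_mult_cs[OF slice_filt[OF f, of i] slice_filt[OF g, of "k - i"]] that
        by (simp add: gr_map_def)
      have "cs (Suc k) (?p i) \<in> carrier (?R Quot filt (Suc k))" for i
        by (rule h.hom_closed) (use p in simp)
      then show ?thesis using eq by (intro h.S.finsum_cong') auto
    qed
    finally show "gr_map (f \<otimes>\<^bsub>monoid_ring rees\<^esub> g) k = (gr_map f \<otimes>\<^bsub>gr\<^esub> gr_map g) k"
      unfolding assoc_graded_simps by (simp add: gr_map_def slice_mult)
  qed
next
  have one: "slice n 1 = (if n = 0 then 1 else 0)" for n :: nat
    by (rule poly_mapping_eqI) (auto simp: lookup_slice lookup_one when_def zero_prod_def)
  show "gr_map \<one>\<^bsub>monoid_ring rees\<^esub> = \<one>\<^bsub>gr\<^esub>"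
    unfolding assoc_graded_simps gr_map_def by (simp add: fun_eq_iff one cs_0)
qed

lemma gr_map_surj: "F \<in> carrier gr \<Longrightarrow> \<exists>f. keys f \<subseteq> rees \<and> gr_map f = F"
  for F :: "('d, 'k::field) graded_family"
proof -
  assume "F \<in> carrier gr"
  then have F: "\<And>i. F i \<in> cs (Suc i) ` filt i" "finite {i. F i \<noteq> filt (Suc i)}"
    unfolding assoc_graded_simps by blast+
  let ?X = "{i. F i \<noteq> filt (Suc i)}"
  have "\<exists>x. x \<in> filt i \<and> F i = cs (Suc i) x" for i using F(1)[of i] by blast
  then obtain x where x: "\<And>i. x i \<in> filt i" "\<And>i. F i = cs (Suc i) (x i)" by metis
  define f where "f = (\<Sum>i\<in>?X. \<Sum>s\<in>keys (x i). single (s, i) (lookup (x i) s))"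
  have "keys f \<subseteq> rees"
    unfolding f_def
  proof (intro keys_sum_subset)
    fix i s assume "s \<in> keys (x i)"
    then have "(s, i) \<in> rees" using x(1)[of i] by (auto simp: rees_def)
    then show "keys (single (s, i) (lookup (x i) s)) \<subseteq> rees" by simp
  qed
  moreover have "gr_map f n = F n" for n
  proof -
    have "slice n f = (\<Sum>i\<in>?X. if i = n then x n else 0)"
      unfolding f_def slice_sum
    proof (rule sum.cong)
      fix i
      show "(\<Sum>s\<in>keys (x i). slice n (single (s, i) (lookup (x i) s))) = (if i = n then x n else 0)"
        by (auto simp: slice_single simp flip: poly_mapping_sum_singles)
    qed simp
    also have "\<dots> = (if n \<in> ?X then x n else 0)" using F(2) by (simp only: sum.delta)
    finally have "slice n f = (if n \<in> ?X then x n else 0)" .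
    then show ?thesis
      using x(2)[of n] cs_0[of "Suc n"] by (cases "n \<in> ?X") (simp_all add: gr_map_def)
  qed
  ultimately show ?thesis by blast
qed

lemma gr_map_eq_iff:
  fixes f g :: "(nat ^ 'd) \<times> nat \<Rightarrow>\<^sub>0 'k::field"
  assumes "keys f \<subseteq> rees" "keys g \<subseteq> rees"
  shows "gr_map f = gr_map g \<longleftrightarrow> keys (f - g) \<subseteq> rees_next"
proof -
  have "gr_map f = gr_map g \<longleftrightarrow> (\<forall>n. slice n f - slice n g \<in> filt (Suc n))"
    unfolding gr_map_def fun_eq_iff
    using cs_eq_iff[OF filt_subset[OF slice_filt[OF assms(1)]] filt_subset[OF slice_filt[OF assms(2)]]]
    by simp
  also have "\<dots> \<longleftrightarrow> (\<forall>n s. lookup (f - g) (s, n) \<noteq> 0 \<longrightarrow> s \<in> sums_ge A (Suc n))"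
    by (auto simp: subset_eq in_keys_iff lookup_slice lookup_minus)
  also have "\<dots> \<longleftrightarrow> keys (f - g) \<subseteq> rees_next"
    by (auto simp: subset_eq in_keys_iff rees_next_def)
  finally show ?thesis .
qed

end

section \<open>Monomial prime ideals\<close>

text \<open>Faces are taken in the sense of monoids; their complements span the monomial prime ideals.\<close>

definition face :: "'m::comm_monoid_add set \<Rightarrow> 'm set \<Rightarrow> bool" where
  "face F U \<longleftrightarrow> 0 \<in> F \<and> F \<subseteq> U \<and> (\<forall>x\<in>F. \<forall>y\<in>F. x + y \<in> F) \<and>
     (\<forall>x\<in>U. \<forall>y\<in>U. x + y \<in> F \<longrightarrow> x \<in> F \<and> y \<in> F)"

lemma (in add_submonoid) primeideal_face:
  assumes F: "face F U"
    and sep: "\<And>X :: 'm set. finite X \<Longrightarrow> \<exists>w :: 'm \<Rightarrow> nat. (\<forall>x y. w (x + y) = w x + w y) \<and> inj_on w X"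
  shows "primeideal {f :: 'm \<Rightarrow>\<^sub>0 'k::field. keys f \<subseteq> U - F} (monoid_ring U)"
proof (rule primeidealI)
  show "ideal {f :: 'm \<Rightarrow>\<^sub>0 'k. keys f \<subseteq> U - F} (monoid_ring U)"
  proof (rule ideal_monomials)
    fix u v assume "u \<in> U" "v \<in> U - F"
    then show "u + v \<in> U - F" using F add_mem[of u v] unfolding face_def by blast
  qed blast
  show "cring (monoid_ring U :: ('m \<Rightarrow>\<^sub>0 'k) ring)" by (rule cring_monoid_ring)
  have "(1 :: 'm \<Rightarrow>\<^sub>0 'k) \<in> carrier (monoid_ring U)" using zero_mem by simp
  moreover have "(1 :: 'm \<Rightarrow>\<^sub>0 'k) \<notin> {f. keys f \<subseteq> U - F}" using F by (simp add: face_def)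
  ultimately show "carrier (monoid_ring U) \<noteq> {f :: 'm \<Rightarrow>\<^sub>0 'k. keys f \<subseteq> U - F}" by blast
  fix f g :: "'m \<Rightarrow>\<^sub>0 'k"
  assume fg: "f \<in> carrier (monoid_ring U)" "g \<in> carrier (monoid_ring U)"
    "f \<otimes>\<^bsub>monoid_ring U\<^esub> g \<in> {f. keys f \<subseteq> U - F}"
  obtain w :: "'m \<Rightarrow> nat" where w: "\<And>x y. w (x + y) = w x + w y" "inj_on w (keys f \<union> keys g)"
    using sep[of "keys f \<union> keys g"] by auto
  have "keys f \<inter> F = {} \<or> keys g \<inter> F = {}"
  proof (rule ccontr)
    assume ne: "\<not> (keys f \<inter> F = {} \<or> keys g \<inter> F = {})"
    have "keys (f * g) \<inter> F \<noteq> {}"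
    proof (rule keys_mult_meets_face[of f U g F w])
      show "\<And>x y. x \<in> F \<Longrightarrow> y \<in> F \<Longrightarrow> x + y \<in> F" using F unfolding face_def by blast
      show "\<And>x y. x \<in> U \<Longrightarrow> y \<in> U \<Longrightarrow> x + y \<in> F \<Longrightarrow> x \<in> F \<and> y \<in> F" using F unfolding face_def by blast
    qed (use fg w ne in simp_all)
    then show False using fg(3) by auto
  qed
  then show "f \<in> {f. keys f \<subseteq> U - F} \<or> g \<in> {f. keys f \<subseteq> U - F}"
    using fg by auto
qed

lemma (in ring_hom_cring) ideal_surj_image:
  assumes surj: "h ` carrier R = carrier S" and Q: "ideal Q R"
  shows "ideal (h ` Q) S"
proof -
  interpret Q: ideal Q R by (rule Q)
  show ?thesis
  proof (rule idealI)
    show "ring S" by (rule S.ring_axioms)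
    show "subgroup (h ` Q) (add_monoid S)"
    proof (rule S.add.subgroupI)
      show "h ` Q \<subseteq> carrier S" using Q.a_subset by auto
      show "h ` Q \<noteq> {}" using Q.zero_closed by blast
      fix a assume "a \<in> h ` Q"
      then obtain q where q: "q \<in> Q" "a = h q" by auto
      have "\<ominus>\<^bsub>S\<^esub> a = h (\<ominus>\<^bsub>R\<^esub> q)" using Q.a_Hcarr[OF q(1)] q(2) by simp
      then show "\<ominus>\<^bsub>S\<^esub> a \<in> h ` Q" using Q.a_inv_closed[OF q(1)] by simp
      fix b assume "b \<in> h ` Q"
      then obtain p where p: "p \<in> Q" "b = h p" by auto
      have "a \<oplus>\<^bsub>S\<^esub> b = h (q \<oplus>\<^bsub>R\<^esub> p)"
        using Q.a_Hcarr[OF q(1)] Q.a_Hcarr[OF p(1)] q(2) p(2) by simp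
      then show "a \<oplus>\<^bsub>S\<^esub> b \<in> h ` Q" using Q.a_closed[OF q(1) p(1)] by simp
    qed
    fix a x assume "a \<in> h ` Q" "x \<in> carrier S"
    then obtain q y where q: "q \<in> Q" "a = h q" "y \<in> carrier R" "x = h y" using surj by blast
    have "x \<otimes>\<^bsub>S\<^esub> a = h (y \<otimes>\<^bsub>R\<^esub> q)" "a \<otimes>\<^bsub>S\<^esub> x = h (q \<otimes>\<^bsub>R\<^esub> y)"
      using Q.a_Hcarr[OF q(1)] q(2-4) by simp_all
    then show "x \<otimes>\<^bsub>S\<^esub> a \<in> h ` Q" "a \<otimes>\<^bsub>S\<^esub> x \<in> h ` Q"
      using Q.I_l_closed[OF q(1,3)] Q.I_r_closed[OF q(1,3)] by simp_all
  qed
qed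

lemma (in ring_hom_cring) primeideal_surj_image:
  assumes surj: "h ` carrier R = carrier S" and Q: "primeideal Q R"
    and sat: "\<And>a b. a \<in> carrier R \<Longrightarrow> b \<in> Q \<Longrightarrow> h a = h b \<Longrightarrow> a \<in> Q"
  shows "primeideal (h ` Q) S"
proof -
  interpret Q: primeideal Q R by (rule Q)
  have mem: "h a \<in> h ` Q \<longleftrightarrow> a \<in> Q" if "a \<in> carrier R" for a using sat that by blast
  show ?thesis
  proof (rule primeidealI)
    show "ideal (h ` Q) S" by (rule ideal_surj_image[OF surj Q.is_ideal])
    show "cring S" by (rule S.is_cring)
    show "carrier S \<noteq> h ` Q"
    proof
      assume "carrier S = h ` Q"
      then have "h \<one>\<^bsub>R\<^esub> \<in> h ` Q" using hom_closed[OF R.one_closed] by (simp only:)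
      then have "\<one>\<^bsub>R\<^esub> \<in> Q" using mem[OF R.one_closed] by simp
      then show False using Q.one_imp_carrier Q.I_notcarr by auto
    qed
    fix a b assume "a \<in> carrier S" "b \<in> carrier S" and ab: "a \<otimes>\<^bsub>S\<^esub> b \<in> h ` Q"
    then obtain x y where xy: "x \<in> carrier R" "y \<in> carrier R" "a = h x" "b = h y" using surj by blast
    then have "h (x \<otimes>\<^bsub>R\<^esub> y) \<in> h ` Q" using ab by simp
    then have "x \<otimes>\<^bsub>R\<^esub> y \<in> Q" using mem[of "x \<otimes>\<^bsub>R\<^esub> y"] xy by simp
    then show "a \<in> h ` Q \<or> b \<in> h ` Q" using Q.I_prime[OF xy(1,2)] xy(3,4) by blast
  qed
qed

section \<open>Chains of primes from the faces of the cone\<close>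

locale indexed_coordinates = coordinates +
  fixes e :: "nat \<Rightarrow> nat ^ 'a"
  assumes e: "bij_betw e {..<CARD('a)} E"
begin

lemma e_in_E: "i < CARD('a) \<Longrightarrow> e i \<in> E"
  and e_eq_iff: "i < CARD('a) \<Longrightarrow> j < CARD('a) \<Longrightarrow> e i = e j \<longleftrightarrow> i = j"
  and E_eq_e: "a \<in> E \<Longrightarrow> \<exists>i<CARD('a). a = e i"
  using e by (auto simp: bij_betw_def inj_on_def)

lemma e_in_S: "i < CARD('a) \<Longrightarrow> e i \<in> S"
  using e_in_E E_subset by auto

lemma lam_0: "a \<in> E \<Longrightarrow> lam a 0 = 0"
  using lam_add[of a 0 0] by simp

lemma E_sums_ge_1: "a \<in> E \<Longrightarrow> a \<in> sums_ge A (Suc 0)"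
  using E_subset zero_notin_E unfolding sums_ge_1 by auto

definition cone_face :: "nat \<Rightarrow> (nat ^ 'a) set" where
  "cone_face j = {s \<in> S. \<forall>i<CARD('a). j \<le> i \<longrightarrow> lam (e i) s = 0}"

lemma face_cone_face: "face (cone_face j) S"
proof -
  have "x \<in> cone_face j \<and> y \<in> cone_face j" if "x \<in> S" "y \<in> S" "x + y \<in> cone_face j" for x y
  proof -
    have "lam (e i) x = 0 \<and> lam (e i) y = 0" if i: "i < CARD('a)" "j \<le> i" for i
    proof -
      have "lam (e i) (x + y) = 0" using \<open>x + y \<in> cone_face j\<close> i by (simp add: cone_face_def)
      then have "lam (e i) x + lam (e i) y = 0" using lam_add[OF e_in_E[OF i(1)], of x y] by linarith
      then show ?thesis
        using lam_nonneg[OF e_in_E[OF i(1)] \<open>x \<in> S\<close>] lam_nonneg[OF e_in_E[OF i(1)] \<open>y \<in> S\<close>] by linarith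
    qed
    then show ?thesis using that by (simp add: cone_face_def)
  qed
  moreover have "x + y \<in> cone_face j" if "x \<in> cone_face j" "y \<in> cone_face j" for x y
    using that by (simp add: cone_face_def nat_span_add lam_add e_in_E)
  moreover have "0 \<in> cone_face j" by (simp add: cone_face_def nat_span_zero lam_0 e_in_E)
  moreover have "cone_face j \<subseteq> S" by (auto simp: cone_face_def)
  ultimately show ?thesis unfolding face_def by blast
qed

lemma cone_face_mono: "i \<le> j \<Longrightarrow> cone_face i \<subseteq> cone_face j"
  by (auto simp: cone_face_def)

lemma e_in_cone_face_iff: "j < CARD('a) \<Longrightarrow> e j \<in> cone_face i \<longleftrightarrow> j < i"
  by (auto simp: cone_face_def e_in_S lam_E e_in_E e_eq_iff not_le)

text \<open>The faces spanned by the first \<open>j\<close> extremal elements form a chain, and so do their primes.\<close>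

lemma krull_dim_ge: "enat CARD('a) \<le> krull_dim (semigroup_ring S :: (nat ^ 'a \<Rightarrow>\<^sub>0 'k::field) ring)"
proof -
  let ?d = "CARD('a)"
  define Q :: "nat \<Rightarrow> (nat ^ 'a \<Rightarrow>\<^sub>0 'k) set" where
    "Q i = {f. keys f \<subseteq> S - cone_face (?d - i)}" for i
  have "primeideal (Q i) (semigroup_ring S)" for i
    unfolding Q_def semigroup_ring_eq_monoid_ring
    by (rule add_submonoid.primeideal_face[OF add_submonoid_nat_span face_cone_face separating_weight_vec])
  moreover have "Q i \<subset> Q (Suc i)" if i: "i < ?d" for i
  proof -
    let ?f = "single (e (?d - Suc i)) (1 :: 'k)"
    have j: "?d - Suc i < ?d" using i by simp
    have "?f \<in> Q (Suc i)" "?f \<notin> Q i"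
      using i e_in_S[OF j] e_in_cone_face_iff[OF j] by (auto simp: Q_def)
    moreover have "Q i \<subseteq> Q (Suc i)"
      using cone_face_mono[OF diff_le_mono2[OF le_SucI[OF order_refl[of i]], of ?d]]
      unfolding Q_def by blast
    ultimately show ?thesis by blast
  qed
  ultimately show ?thesis
    unfolding krull_dim_def by (intro Sup_upper CollectI exI[of _ ?d] conjI exI[of _ Q]) auto
qed

text \<open>On these faces of the Rees monoid the second component is the sum of the coordinates of the
  first. As this sum bounds the order, they avoid the kernel of the map onto the graded ring.\<close>

definition rees_face :: "nat \<Rightarrow> ((nat ^ 'a) \<times> nat) set" where
  "rees_face j = {(s, n). s \<in> cone_face j \<and> real n = (\<Sum>a\<in>E. lam a s) \<and> s \<in> sums_ge A n}"

lemma face_rees_face: "face (rees_face j) rees"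
proof -
  have face: "x \<in> rees_face j \<and> y \<in> rees_face j" if x: "x \<in> rees" and y: "y \<in> rees" and xy: "x + y \<in> rees_face j" for x y
  proof -
    obtain s m t n where st: "x = (s, m)" "y = (t, n)" by (cases x, cases y)
    have s: "s \<in> sums_ge A m" "t \<in> sums_ge A n" using x y by (auto simp: st rees_def)
    have S: "s \<in> S" "t \<in> S" using s sums_ge_subset by blast+
    have "s + t \<in> cone_face j" and eq: "real (m + n) = (\<Sum>a\<in>E. lam a (s + t))"
      using xy by (auto simp: st rees_face_def)
    then have "s \<in> cone_face j \<and> t \<in> cone_face j" using face_cone_face S unfolding face_def by blast
    moreover have "real m + real n = (\<Sum>a\<in>E. lam a s) + (\<Sum>a\<in>E. lam a t)"
      using eq by (simp add: lam_add sum.distrib)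
    ultimately show ?thesis using s le_sum_lam[OF s(1)] le_sum_lam[OF s(2)] by (auto simp: st rees_face_def)
  qed
  have add: "x + y \<in> rees_face j" if "x \<in> rees_face j" "y \<in> rees_face j" for x y
  proof -
    obtain s m t n where st: "x = (s, m)" "y = (t, n)" by (cases x, cases y)
    have "s + t \<in> cone_face j" using that face_cone_face[of j] by (auto simp: st rees_face_def face_def)
    then show ?thesis
      using that by (auto simp: st rees_face_def lam_add sum.distrib intro: sums_ge_add)
  qed
  have zero: "0 \<in> rees_face j"
    using face_cone_face[of j] by (auto simp: zero_prod_def rees_face_def face_def lam_0 nat_span_zero)
  have "rees_face j \<subseteq> rees" by (auto simp: rees_face_def rees_def)
  then show ?thesis using face add zero unfolding face_def by blast
qed

lemma rees_face_disjoint: "rees_face j \<inter> rees_next = {}"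
  using le_sum_lam by (force simp: rees_face_def rees_next_def)

lemma rees_face_mono: "i \<le> j \<Longrightarrow> rees_face i \<subseteq> rees_face j"
  using cone_face_mono by (auto simp: rees_face_def)

lemma e_in_rees: "j < CARD('a) \<Longrightarrow> (e j, 1) \<in> rees"
  using E_sums_ge_1[OF e_in_E] by (simp add: rees_def)

lemma e_in_rees_face_iff:
  assumes "j < CARD('a)"
  shows "(e j, 1) \<in> rees_face i \<longleftrightarrow> j < i"
proof -
  have "(\<Sum>a\<in>E. lam a (e j)) = (\<Sum>a\<in>E. if a = e j then 1 else 0)"
    using lam_E e_in_E[OF assms] by (intro sum.cong) auto
  then have "(\<Sum>a\<in>E. lam a (e j)) = 1" using finite_E e_in_E[OF assms] by simp
  then show ?thesis
    using e_in_cone_face_iff[OF assms] E_sums_ge_1[OF e_in_E[OF assms]]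
    by (simp add: rees_face_def)
qed

lemma rees_face_0: "rees_face 0 = {0}"
proof -
  have "x = 0" if x: "x \<in> rees_face 0" for x
  proof -
    obtain s n where sn: "x = (s, n)" by (cases x)
    have "s \<in> S" "\<And>a. a \<in> E \<Longrightarrow> lam a s = 0"
      using x E_eq_e by (auto simp: sn rees_face_def cone_face_def)
    then have "s = 0" "(\<Sum>a\<in>E. lam a s) = 0" using lam_eq_0 by auto
    moreover have "real n = (\<Sum>a\<in>E. lam a s)" using x by (auto simp: sn rees_face_def)
    ultimately show ?thesis by (simp add: sn zero_prod_def)
  qed
  then show ?thesis using face_rees_face[of 0] by (auto simp: face_def)
qed

definition gr_prime :: "nat \<Rightarrow> ('a, 'k::field) graded_family set" where
  "gr_prime j = gr_map ` {f. keys f \<subseteq> rees - rees_face j}"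

context
  assumes cring_gr: "cring (gr :: ('a, 'k::field) graded_family ring)"
begin

interpretation h: ring_hom_cring "monoid_ring rees :: (_ \<Rightarrow>\<^sub>0 'k) ring"
    "gr :: ('a, 'k) graded_family ring" gr_map
proof -
  interpret R: cring "monoid_ring rees :: (_ \<Rightarrow>\<^sub>0 'k) ring"
    by (rule add_submonoid.cring_monoid_ring[OF add_submonoid_rees])
  interpret G: cring "gr :: ('a, 'k) graded_family ring" by (rule cring_gr)
  show "ring_hom_cring (monoid_ring rees :: (_ \<Rightarrow>\<^sub>0 'k) ring)
      (gr :: ('a, 'k) graded_family ring) gr_map"
    by unfold_locales (rule gr_map_ring_hom)
qed

lemma gr_map_image: "gr_map ` carrier (monoid_ring rees :: (_ \<Rightarrow>\<^sub>0 'k) ring) = carrier gr"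
proof
  show "gr_map ` carrier (monoid_ring rees :: (_ \<Rightarrow>\<^sub>0 'k) ring) \<subseteq> carrier gr"
    using h.hom_closed by blast
  show "carrier gr \<subseteq> gr_map ` carrier (monoid_ring rees :: (_ \<Rightarrow>\<^sub>0 'k) ring)"
  proof
    fix F :: "('a, 'k) graded_family" assume "F \<in> carrier gr"
    from gr_map_surj[OF this] obtain f where "keys f \<subseteq> rees" "gr_map f = F" by blast
    then show "F \<in> gr_map ` carrier (monoid_ring rees)" by auto
  qed
qed

lemma gr_prime_saturated:
  fixes f g :: "(nat ^ 'a) \<times> nat \<Rightarrow>\<^sub>0 'k"
  assumes "keys f \<subseteq> rees" "keys g \<subseteq> rees - rees_face j" "gr_map f = gr_map g"
  shows "keys f \<subseteq> rees - rees_face j"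
proof -
  have g: "keys g \<subseteq> rees" using assms(2) by blast
  have "keys (f - g) \<subseteq> rees_next" using gr_map_eq_iff[OF assms(1) g] assms(3) by simp
  then have "keys (f - g) \<subseteq> rees - rees_face j"
    using rees_next_subset rees_face_disjoint[of j] by blast
  then have "keys ((f - g) + g) \<subseteq> rees - rees_face j" by (rule keys_add_subset[OF _ assms(2)])
  then show ?thesis by simp
qed

lemma gr_map_in_gr_prime_iff:
  fixes f :: "(nat ^ 'a) \<times> nat \<Rightarrow>\<^sub>0 'k"
  assumes "keys f \<subseteq> rees"
  shows "gr_map f \<in> gr_prime j \<longleftrightarrow> keys f \<subseteq> rees - rees_face j"
  unfolding gr_prime_def using gr_prime_saturated[OF assms] by blast

lemma primeideal_gr_prime: "primeideal (gr_prime j) (gr :: ('a, 'k) graded_family ring)"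
  unfolding gr_prime_def
proof (rule h.primeideal_surj_image[OF gr_map_image])
  show "primeideal {f :: _ \<Rightarrow>\<^sub>0 'k. keys f \<subseteq> rees - rees_face j} (monoid_ring rees)"
    by (rule add_submonoid.primeideal_face[OF add_submonoid_rees face_rees_face separating_weight_vec_nat])
qed (use gr_prime_saturated in auto)

lemma height_gr_prime_0:
  "enat CARD('a) \<le> ideal_height (gr :: ('a, 'k) graded_family ring) (gr_prime 0)"
proof -
  let ?d = "CARD('a)"
  define Q :: "nat \<Rightarrow> ('a, 'k) graded_family set" where "Q i = gr_prime (?d - i)" for i
  have "Q i \<subset> Q (Suc i)" if i: "i < ?d" for i
  proof -
    let ?f = "single (e (?d - Suc i), 1) (1 :: 'k)"
    have j: "?d - Suc i < ?d" using i by simp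
    have f: "keys ?f \<subseteq> rees" using e_in_rees[OF j] by simp
    have "gr_map ?f \<in> Q (Suc i)" "gr_map ?f \<notin> Q i"
      unfolding Q_def gr_map_in_gr_prime_iff[OF f] using i e_in_rees[OF j] e_in_rees_face_iff[OF j] by auto
    moreover have "Q i \<subseteq> Q (Suc i)"
      using rees_face_mono[OF diff_le_mono2[OF le_SucI[OF order_refl[of i]], of ?d]]
      unfolding Q_def gr_prime_def by blast
    ultimately show ?thesis by blast
  qed
  moreover have "Q ?d = gr_prime 0" by (simp add: Q_def)
  moreover have "primeideal (Q i) gr" for i unfolding Q_def by (rule primeideal_gr_prime)
  ultimately show ?thesis
    unfolding ideal_height_def by (intro Sup_upper CollectI exI[of _ ?d] conjI exI[of _ Q]) auto
qed

text \<open>The ideal consists of the classes of elements without constant term, so an ideal that properly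
  contains it contains a nonzero constant.\<close>

lemma maximalideal_gr_prime_0: "maximalideal (gr_prime 0) (gr :: ('a, 'k) graded_family ring)"
proof (rule maximalidealI)
  interpret P: primeideal "gr_prime 0" "gr :: ('a, 'k) graded_family ring" by (rule primeideal_gr_prime)
  show "ideal (gr_prime 0) (gr :: ('a, 'k) graded_family ring)" by (rule P.is_ideal)
  show "carrier gr \<noteq> (gr_prime 0 :: ('a, 'k) graded_family set)" by (rule P.I_notcarr)
  fix J assume J: "ideal J (gr :: ('a, 'k) graded_family ring)" "gr_prime 0 \<subseteq> J" "J \<subseteq> carrier gr"
  interpret J: ideal J "gr :: ('a, 'k) graded_family ring" by (rule J(1))
  have zero: "0 \<in> rees" using add_submonoid.zero_mem[OF add_submonoid_rees] .
  have "J = carrier gr" if ne: "J \<noteq> gr_prime 0"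
  proof -
    obtain F where F: "F \<in> J" "F \<notin> gr_prime 0" using ne J(2) by blast
    then have "F \<in> carrier gr" using J(3) by blast
    from gr_map_surj[OF this] obtain f where f: "keys f \<subseteq> rees" "gr_map f = F" by blast
    define c where "c = lookup f 0"
    have c: "c \<noteq> 0"
      using F(2) f gr_map_in_gr_prime_iff[OF f(1), of 0] by (auto simp: rees_face_0 c_def in_keys_iff)
    define k where "k = (\<lambda>c :: 'k. single (0 :: (nat ^ 'a) \<times> nat) c)"
    have k: "keys (k x) \<subseteq> rees" for x using zero by (simp add: k_def)
    have df: "keys (k c - f) \<subseteq> rees" by (rule keys_diff_subset[OF k f(1)])
    have "lookup (k c - f) 0 = 0" by (simp add: lookup_minus k_def c_def)
    then have "keys (k c - f) \<subseteq> rees - rees_face 0"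
      using df by (auto simp: rees_face_0 in_keys_iff)
    then have "gr_map (k c - f) \<in> J" using gr_map_in_gr_prime_iff[OF df] J(2) by blast
    then have "gr_map (k c - f) \<oplus>\<^bsub>gr\<^esub> gr_map f \<in> J"
      unfolding f(2) by (rule additive_subgroup.a_closed[OF J.additive_subgroup_axioms _ F(1)])
    moreover have "gr_map (k c - f) \<oplus>\<^bsub>gr\<^esub> gr_map f = gr_map (k c)"
      using h.hom_add[of "k c - f" f] df f(1) by simp
    ultimately have "gr_map (k c) \<in> J" by simp
    moreover have "gr_map (k (inverse c)) \<in> carrier gr" using h.hom_closed k by simp
    ultimately have "gr_map (k (inverse c)) \<otimes>\<^bsub>gr\<^esub> gr_map (k c) \<in> J" by (rule J.I_l_closed)
    moreover have "gr_map (k (inverse c)) \<otimes>\<^bsub>gr\<^esub> gr_map (k c) = gr_map (k (inverse c) * k c)"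
      using h.hom_mult[of "k (inverse c)" "k c"] k by simp
    moreover have "k (inverse c) * k c = 1" using c by (simp add: k_def Poly_Mapping.mult_single)
    ultimately have "\<one>\<^bsub>gr\<^esub> \<in> J" using h.hom_one by simp
    then show ?thesis by (rule J.one_imp_carrier)
  qed
  then show "J = gr_prime 0 \<or> J = carrier gr" by blast
qed

end

section \<open>Relations among the initial forms of the extremal monomials\<close>

abbreviation y :: "nat \<Rightarrow> ((nat ^ 'a) \<times> nat \<Rightarrow>\<^sub>0 'k::field)" where
  "y i \<equiv> single (e i, 1) 1"

abbreviation rees_alg :: "((nat ^ 'a) \<times> nat \<Rightarrow>\<^sub>0 'k::field) set" where
  "rees_alg \<equiv> {f. keys f \<subseteq> rees}"

lemma koszul_rees: "koszul (rees_alg :: (_ \<Rightarrow>\<^sub>0 'k::field) set) y CARD('a)"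
proof
  show "(1 :: _ \<Rightarrow>\<^sub>0 'k) \<in> rees_alg" using add_submonoid.zero_mem[OF add_submonoid_rees] by simp
  show "\<And>i. i < CARD('a) \<Longrightarrow> (y i :: _ \<Rightarrow>\<^sub>0 'k) \<in> rees_alg" using e_in_rees by simp
  fix f g :: "(nat ^ 'a) \<times> nat \<Rightarrow>\<^sub>0 'k"
  assume f: "f \<in> rees_alg"
  then show "- f \<in> rees_alg" by (simp add: keys_uminus_subset)
  assume g: "g \<in> rees_alg"
  show "f + g \<in> rees_alg" using keys_add_subset f g by blast
  show "f * g \<in> rees_alg"
    using keys_mult_subset[of f rees g rees rees] add_submonoid.add_mem[OF add_submonoid_rees] f g by auto
qed simp

text \<open>Elements without constant term are nilpotent modulo the \<open>y\<^sub>i\<close> in the graded ring: their powers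
  live in large degrees, and there each monomial is divisible by some \<open>y\<^sub>i\<close>.\<close>

lemma keys_power_without_constant_term:
  fixes f :: "(nat ^ 'a) \<times> nat \<Rightarrow>\<^sub>0 'k::field"
  assumes f: "keys f \<subseteq> rees - {0}"
  shows "keys (f ^ n) \<subseteq> rees_next \<union> {p \<in> rees. n \<le> snd p}"
proof (induction n)
  case 0
  then show ?case using add_submonoid.zero_mem[OF add_submonoid_rees] by simp
next
  case (Suc n)
  have f1: "keys f \<subseteq> rees_next \<union> {p \<in> rees. Suc 0 \<le> snd p}"
  proof
    fix p assume "p \<in> keys f"
    then have p: "p \<in> rees" "p \<noteq> 0" using f by auto
    obtain s m where sm: "p = (s, m)" by (cases p)
    show "p \<in> rees_next \<union> {p \<in> rees. Suc 0 \<le> snd p}"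
    proof (cases m)
      case 0
      then have "s \<in> sums_ge A (Suc 0)" using p unfolding sums_ge_1 by (auto simp: sm rees_def zero_prod_def)
      then show ?thesis by (simp add: sm 0 rees_next_def)
    qed (use p in \<open>simp add: sm\<close>)
  qed
  show ?case unfolding power_Suc
  proof (rule keys_mult_subset[OF f1 Suc])
    fix u v assume u: "u \<in> rees_next \<union> {p \<in> rees. Suc 0 \<le> snd p}" and v: "v \<in> rees_next \<union> {p \<in> rees. n \<le> snd p}"
    have ur: "u \<in> rees" "v \<in> rees" using u v rees_next_subset by auto
    show "u + v \<in> rees_next \<union> {p \<in> rees. Suc n \<le> snd p}"
    proof (cases "u \<in> rees_next \<or> v \<in> rees_next")
      case True
      then show ?thesis using rees_next_absorbs[of u v] rees_next_absorbs[of v u] ur by (auto simp: add.commute)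
    next
      case False
      then show ?thesis using u v ur add_submonoid.add_mem[OF add_submonoid_rees ur] by auto
    qed
  qed
qed

lemma high_degree_in_y:
  fixes f :: "(nat ^ 'a) \<times> nat \<Rightarrow>\<^sub>0 'k::field"
  assumes f: "keys f \<subseteq> rees_next \<union> {p \<in> rees. Suc N \<le> snd p}"
  shows "\<exists>c b. f = (\<Sum>j<CARD('a). c j * y j) + b \<and> keys b \<subseteq> rees_next \<and>
           (\<forall>j<CARD('a). keys (c j) \<subseteq> rees)"
proof -
  have "\<exists>c b. (\<Sum>p\<in>X. single p (lookup f p)) = (\<Sum>j<CARD('a). c j * y j) + b \<and>
      keys b \<subseteq> rees_next \<and> (\<forall>j<CARD('a). keys (c j) \<subseteq> rees)"
    if "finite X" "X \<subseteq> keys f" for X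
    using that
  proof (induction X rule: finite_induct)
    case empty
    show ?case by (intro exI[of _ "\<lambda>_. 0"] exI[of _ 0]) simp
  next
    case (insert p X)
    then obtain c b where cb: "(\<Sum>p\<in>X. single p (lookup f p)) = (\<Sum>j<CARD('a). c j * y j) + b"
      "keys b \<subseteq> rees_next" "\<forall>j<CARD('a). keys (c j) \<subseteq> rees" by auto
    have p: "p \<in> rees_next \<union> {p \<in> rees. Suc N \<le> snd p}" using insert.prems f by auto
    show ?case
    proof (cases "p \<in> rees_next")
      case True
      then have "keys (b + single p (lookup f p)) \<subseteq> rees_next"
        using cb(2) by (intro keys_add_subset) auto
      then show ?thesis
        using cb insert.hyps
        by (intro exI[of _ c] exI[of _ "b + single p (lookup f p)"])
           (auto simp: add_ac)
    next
      case False
      obtain s m where sm: "p = (s, m)" by (cases p)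
      have m: "s \<in> sums_ge A m" "Suc N \<le> m" using p False by (auto simp: sm rees_def)
      then obtain k where k: "m = Suc k" "N \<le> k" by (cases m) auto
      obtain a t where at: "a \<in> E" "t \<in> sums_ge A k" "s = a + t" using reduction[OF k(2)] m k(1) by blast
      obtain i where i: "i < CARD('a)" "a = e i" using E_eq_e[OF at(1)] by blast
      define q where "q = single (t, k) (lookup f p)"
      have q: "keys q \<subseteq> rees" using at(2) by (simp add: q_def rees_def)
      have qy: "q * y i = single p (lookup f p)"
        by (simp add: q_def Poly_Mapping.mult_single sm at(3) i(2) k(1) add.commute)
      let ?c = "\<lambda>j. c j + (if j = i then q else 0)"
      have "(\<Sum>j<CARD('a). ?c j * y j) = (\<Sum>j<CARD('a). c j * y j) + (\<Sum>j<CARD('a). if j = i then q * y i else 0)"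
        unfolding sum.distrib[symmetric] by (intro sum.cong) (auto simp: algebra_simps)
      also have "\<dots> = (\<Sum>j<CARD('a). c j * y j) + q * y i" using i(1) by simp
      finally have "(\<Sum>j<CARD('a). ?c j * y j) = (\<Sum>j<CARD('a). c j * y j) + q * y i" .
      moreover have "\<forall>j<CARD('a). keys (?c j) \<subseteq> rees"
        using cb(3) q by (simp add: keys_add_subset)
      ultimately show ?thesis
        using cb(1,2) insert.hyps qy
        by (intro exI[of _ ?c] exI[of _ b]) (auto simp: add_ac)
    qed
  qed
  from this[of "keys f"] show ?thesis by (simp flip: poly_mapping_sum_singles)
qed

end

lemma (in cring) genideal_insert_subset:
  assumes "x \<in> carrier R" "T \<subseteq> carrier R"
  shows "Idl (insert x T) \<subseteq> {a \<oplus> r \<otimes> x | a r. a \<in> Idl T \<and> r \<in> carrier R}"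
proof -
  have id: "ideal (Idl T) R" "ideal (PIdl x) R" using genideal_ideal assms cgenideal_ideal by auto
  have sub: "insert x T \<subseteq> Idl T <+>\<^bsub>R\<^esub> PIdl x"
  proof
    fix t assume t: "t \<in> insert x T"
    have z: "\<zero> \<in> Idl T" "\<zero> \<in> PIdl x"
      using additive_subgroup.zero_closed ideal.axioms(1)[OF id(1)] ideal.axioms(1)[OF id(2)] by blast+
    show "t \<in> Idl T <+>\<^bsub>R\<^esub> PIdl x"
    proof (cases "t = x")
      case True
      then have "t = \<zero> \<oplus> x" using assms by simp
      then show ?thesis using z(1) cgenideal_self[OF assms(1)] unfolding set_add_def' by blast
    next
      case False
      then have "t \<in> T" using t by simp
      then have "t = t \<oplus> \<zero>" "t \<in> Idl T" using assms(2) genideal_self[OF assms(2)] by auto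
      then show ?thesis using z(2) unfolding set_add_def' by blast
    qed
  qed
  have "Idl (insert x T) \<subseteq> Idl T <+>\<^bsub>R\<^esub> PIdl x" by (rule genideal_minimal[OF add_ideals[OF id] sub])
  also have "\<dots> \<subseteq> {a \<oplus> r \<otimes> x | a r. a \<in> Idl T \<and> r \<in> carrier R}"
    unfolding set_add_def' cgenideal_def by blast
  finally show ?thesis .
qed

lemma (in ring) genideal_empty: "Idl {} = {\<zero>}"
proof
  show "Idl {} \<subseteq> {\<zero>}" by (rule genideal_minimal[OF zeroideal]) simp
  show "{\<zero>} \<subseteq> Idl {}"
    using additive_subgroup.zero_closed[OF ideal.axioms(1)[OF genideal_ideal[of "{}"]]] by simp
qed

context indexed_coordinates
begin

text \<open>The Cohen-Macaulay hypothesis at the irrelevant maximal ideal yields a regular sequence whose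
  length is at least the number of the \<open>y\<^sub>i\<close>. Its members are nilpotent modulo the \<open>y\<^sub>i\<close>, so depth
  sensitivity applies.\<close>

lemma gr_relations_trivial:
  fixes z :: "nat \<Rightarrow> (nat ^ 'a) \<times> nat \<Rightarrow>\<^sub>0 'k::field"
  assumes CM: "cohen_macaulay (gr :: ('a, 'k) graded_family ring)"
    and z: "\<And>i. i < CARD('a) \<Longrightarrow> keys (z i) \<subseteq> rees"
      "keys (\<Sum>i<CARD('a). y i * z i) \<subseteq> rees_next"
  obtains u where "\<And>i j. keys (u i j) \<subseteq> rees" "\<And>i j. u i j = - u j i" "\<And>i. u i i = 0"
    "\<And>i. i < CARD('a) \<Longrightarrow> keys (z i - (\<Sum>j<CARD('a). y j * u i j)) \<subseteq> rees_next"
proof -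
  let ?G = "gr :: ('a, 'k) graded_family ring"
  have cring: "cring ?G" using CM by (simp add: cohen_macaulay_def)
  interpret G: cring ?G by (rule cring)
  interpret R: cring "monoid_ring rees :: (_ \<Rightarrow>\<^sub>0 'k) ring"
    by (rule add_submonoid.cring_monoid_ring[OF add_submonoid_rees])
  interpret h: ring_hom_cring "monoid_ring rees :: (_ \<Rightarrow>\<^sub>0 'k) ring" ?G gr_map
    by unfold_locales (rule gr_map_ring_hom)
  interpret K: koszul "rees_alg :: (_ \<Rightarrow>\<^sub>0 'k) set" y "CARD('a)" by (rule koszul_rees)
  have "ideal_depth ?G (gr_prime 0) = ideal_height ?G (gr_prime 0)"
    using CM maximalideal_gr_prime_0[OF cring] unfolding cohen_macaulay_def by blast
  then have depth: "enat CARD('a) \<le> ideal_depth ?G (gr_prime 0)" using height_gr_prime_0[OF cring] by simp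
  obtain xs where xs: "regular_sequence ?G xs" "set xs \<subseteq> gr_prime 0" "CARD('a) \<le> length xs"
  proof (rule ccontr)
    assume "\<not> thesis"
    then have short: "length xs < CARD('a)" if "regular_sequence ?G xs" "set xs \<subseteq> gr_prime 0" for xs
      using that \<open>\<And>xs. \<lbrakk>regular_sequence ?G xs; set xs \<subseteq> gr_prime 0; CARD('a) \<le> length xs\<rbrakk> \<Longrightarrow> thesis\<close>
      by (meson not_le)
    have "ideal_depth ?G (gr_prime 0) \<le> enat (CARD('a) - 1)"
      unfolding ideal_depth_def
    proof (rule Sup_least)
      fix v assume "v \<in> {enat (length xs) |xs. regular_sequence ?G xs \<and> set xs \<subseteq> gr_prime 0}"
      then obtain xs where "v = enat (length xs)" "regular_sequence ?G xs" "set xs \<subseteq> gr_prime 0" by blast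
      then show "v \<le> enat (CARD('a) - 1)" using short[of xs] by simp
    qed
    then have "enat CARD('a) \<le> enat (CARD('a) - 1)" using depth order_trans by blast
    moreover have "0 < CARD('a)" by simp
    ultimately show False by (simp del: zero_less_card_finite)
  qed
  let ?L = "length xs"
  let ?Id = "\<lambda>i. genideal ?G (set (take i xs))"
  have xsG: "set xs \<subseteq> carrier ?G" using xs(1) by (simp add: regular_sequence_def)
  have takeG: "set (take i xs) \<subseteq> carrier ?G" for i using xsG set_take_subset[of i xs] by blast
  have ideal_Id: "ideal (?Id i) ?G" for i by (rule G.genideal_ideal[OF takeG])
  have "\<exists>f. keys f \<subseteq> rees - {0} \<and> gr_map f = xs ! i" if "i < ?L" for i
    using nth_mem[OF that] xs(2) unfolding gr_prime_def rees_face_0 by force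
  then obtain f where f: "\<And>i. i < ?L \<Longrightarrow> keys (f i) \<subseteq> rees - {0}" "\<And>i. i < ?L \<Longrightarrow> gr_map (f i) = xs ! i"
    by metis
  have f_rees: "keys (f i) \<subseteq> rees" if "i < ?L" for i using f(1)[OF that] by blast
  define J :: "nat \<Rightarrow> ((nat ^ 'a) \<times> nat \<Rightarrow>\<^sub>0 'k) set" where
    "J i = {g. keys g \<subseteq> rees \<and> gr_map g \<in> ?Id i}" for i
  have J0: "J 0 = {g. keys g \<subseteq> rees_next}"
  proof -
    have "gr_map g \<in> ?Id 0 \<longleftrightarrow> keys g \<subseteq> rees_next" if "keys g \<subseteq> rees" for g :: "(nat ^ 'a) \<times> nat \<Rightarrow>\<^sub>0 'k"
      using gr_map_eq_iff[OF that, of 0] h.hom_zero by (simp add: G.genideal_empty)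
    then show ?thesis using rees_next_subset by (auto simp: J_def)
  qed
  show ?thesis
  proof (rule K.koszul_relations_trivial[of ?L J f z])
    show "CARD('a) \<le> ?L" by (rule xs(3))
    show "K.C_ideal (J i)" for i
      unfolding K.C_ideal_def
    proof (intro conjI ballI)
      have "\<zero>\<^bsub>?G\<^esub> \<in> ?Id i"
        by (rule additive_subgroup.zero_closed[OF ideal.axioms(1)[OF ideal_Id]])
      then show "0 \<in> J i" using h.hom_zero by (simp add: J_def)
      show "J i \<subseteq> rees_alg" by (auto simp: J_def)
      fix a assume a: "a \<in> J i"
      show "a + b \<in> J i" if b: "b \<in> J i" for b
      proof -
        have ab: "keys a \<subseteq> rees" "keys b \<subseteq> rees" "gr_map a \<in> ?Id i" "gr_map b \<in> ?Id i"
          using a b by (auto simp: J_def)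
        have "gr_map (a + b) = gr_map a \<oplus>\<^bsub>?G\<^esub> gr_map b" using h.hom_add[of a b] ab by simp
        then show ?thesis
          using keys_add_subset[OF ab(1,2)] additive_subgroup.a_closed[OF ideal.axioms(1)[OF ideal_Id] ab(3,4)]
          by (simp add: J_def)
      qed
    next
      fix c a :: "(nat ^ 'a) \<times> nat \<Rightarrow>\<^sub>0 'k" assume c: "c \<in> rees_alg" and "a \<in> J i"
      then have a: "keys a \<subseteq> rees" "gr_map a \<in> ?Id i" by (auto simp: J_def)
      have "gr_map c \<in> carrier ?G" using h.hom_closed c by simp
      then have "gr_map c \<otimes>\<^bsub>?G\<^esub> gr_map a \<in> ?Id i" by (rule ideal.I_l_closed[OF ideal_Id a(2)])
      moreover have "gr_map (c * a) = gr_map c \<otimes>\<^bsub>?G\<^esub> gr_map a" using h.hom_mult[of c a] a c by simp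
      moreover have "c * a \<in> rees_alg" using K.mult_C[of c a] c a by simp
      ultimately show "c * a \<in> J i" by (simp add: J_def)
    qed
    show "f i \<in> rees_alg" if "i < ?L" for i using f_rees[OF that] by simp
    have hfc: "gr_map (f i * c) = (xs ! i) \<otimes>\<^bsub>?G\<^esub> gr_map c" "f i * c \<in> rees_alg"
      if "i < ?L" "c \<in> rees_alg" for i c
    proof -
      have fi: "f i \<in> rees_alg" using f_rees[OF that(1)] by simp
      show "gr_map (f i * c) = (xs ! i) \<otimes>\<^bsub>?G\<^esub> gr_map c"
        using h.hom_mult[of "f i" c] fi that f(2)[OF that(1)] by simp
      show "f i * c \<in> rees_alg" by (rule K.mult_C[OF fi that(2)])
    qed
    show "c \<in> J i" if i: "i < ?L" and c: "c \<in> rees_alg" and fc: "f i * c \<in> J i" for i c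
    proof -
      have "(xs ! i) \<otimes>\<^bsub>?G\<^esub> gr_map c \<in> ?Id i" using fc hfc(1)[OF i c] by (simp add: J_def)
      moreover have "gr_map c \<in> carrier ?G" using h.hom_closed c by simp
      ultimately have "gr_map c \<in> ?Id i" using xs(1) i unfolding regular_sequence_def by blast
      then show ?thesis using c by (simp add: J_def)
    qed
    show "J (Suc i) = {a + f i * c |a c. a \<in> J i \<and> c \<in> rees_alg}" (is "?l = ?r") if i: "i < ?L" for i
    proof
      have set: "set (take (Suc i) xs) = insert (xs ! i) (set (take i xs))"
        using i by (simp add: take_Suc_conv_app_nth)
      have xi: "xs ! i \<in> carrier ?G" using xsG i by auto
      show "?l \<subseteq> ?r"
      proof
        fix g assume "g \<in> ?l"
        then have g: "keys g \<subseteq> rees" "gr_map g \<in> ?Id (Suc i)" by (auto simp: J_def)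
        then obtain a r where ar: "gr_map g = a \<oplus>\<^bsub>?G\<^esub> r \<otimes>\<^bsub>?G\<^esub> (xs ! i)" "a \<in> ?Id i" "r \<in> carrier ?G"
          using G.genideal_insert_subset[OF xi takeG[of i]] unfolding set by blast
        from gr_map_surj[OF ar(3)] obtain c where c: "keys c \<subseteq> rees" "gr_map c = r" by blast
        have a: "a \<in> carrier ?G" by (rule ideal.Icarr[OF ideal_Id ar(2)])
        have c': "c \<in> rees_alg" using c(1) by simp
        note fc = hfc[OF i c']
        have dc: "keys (g - f i * c) \<subseteq> rees" using keys_diff_subset[OF g(1)] fc(2) by simp
        have "gr_map (g - f i * c) \<oplus>\<^bsub>?G\<^esub> gr_map (f i * c) = a \<oplus>\<^bsub>?G\<^esub> gr_map (f i * c)"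
          using h.hom_add[of "g - f i * c" "f i * c"] dc fc ar(1) c(2) G.m_comm[OF ar(3) xi] by simp
        moreover have "gr_map (f i * c) \<in> carrier ?G" "gr_map (g - f i * c) \<in> carrier ?G"
          using h.hom_closed dc fc(2) by simp_all
        ultimately have "gr_map (g - f i * c) = a" using G.add.right_cancel a by blast
        then have "g - f i * c \<in> J i" using dc ar(2) by (simp add: J_def)
        then show "g \<in> ?r" using c' by (intro CollectI exI[of _ "g - f i * c"] exI[of _ c]) simp
      qed
      show "?r \<subseteq> ?l"
      proof
        fix g assume "g \<in> ?r"
        then obtain a c where ac: "g = a + f i * c" "a \<in> J i" "c \<in> rees_alg" by blast
        note fc = hfc[OF i ac(3)]
        have a: "keys a \<subseteq> rees" "gr_map a \<in> ?Id i" using ac(2) by (auto simp: J_def)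
        have "?Id i \<subseteq> ?Id (Suc i)"
          by (rule G.subset_Idl_subset[OF takeG]) (auto simp: set)
        then have "gr_map a \<in> ?Id (Suc i)" using a(2) by blast
        moreover have "xs ! i \<in> ?Id (Suc i)" using G.genideal_self[OF takeG, of "Suc i"] set by auto
        then have "gr_map (f i * c) \<in> ?Id (Suc i)"
          unfolding fc(1) by (rule ideal.I_r_closed[OF ideal_Id])
            (rule h.hom_closed, use ac(3) in simp)
        ultimately have "gr_map a \<oplus>\<^bsub>?G\<^esub> gr_map (f i * c) \<in> ?Id (Suc i)"
          by (rule additive_subgroup.a_closed[OF ideal.axioms(1)[OF ideal_Id]])
        moreover have "gr_map g = gr_map a \<oplus>\<^bsub>?G\<^esub> gr_map (f i * c)"
          using h.hom_add[of a "f i * c"] a(1) fc(2) ac(1) by simp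
        moreover have "keys g \<subseteq> rees" using keys_add_subset[OF a(1)] fc(2) ac(1) by simp
        ultimately show "g \<in> ?l" by (simp add: J_def)
      qed
    qed
    show "\<exists>n c b. f i ^ n = (\<Sum>j<CARD('a). c j * y j) + b \<and> b \<in> J 0 \<and> (\<forall>j<CARD('a). c j \<in> rees_alg)"
      if "i < ?L" for i
      using high_degree_in_y[OF keys_power_without_constant_term[OF f(1)[OF that], of "Suc N"]]
      unfolding J0 by blast
    show "z i \<in> rees_alg" if "i < CARD('a)" for i using z(1)[OF that] by simp
    show "(\<Sum>i<CARD('a). y i * z i) \<in> J 0" using z(2) J0 by simp
    fix u assume u: "\<And>i j. u i j \<in> rees_alg" "\<And>i j. u i j = - u j i" "\<And>i. u i i = 0"
      "\<And>i. i < CARD('a) \<Longrightarrow> z i - (\<Sum>j<CARD('a). y j * u i j) \<in> J 0"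
    show thesis
    proof (rule that[of u])
      show "keys (u i j) \<subseteq> rees" for i j using u(1)[of i j] by simp
      show "u i j = - u j i" for i j by (rule u(2))
      show "u i i = 0" for i by (rule u(3))
      show "keys (z i - (\<Sum>j<CARD('a). y j * u i j)) \<subseteq> rees_next" if "i < CARD('a)" for i
        using u(4)[OF that] J0 by simp
    qed
  qed
qed

text \<open>In a single multidegree, such a relation is a system of scalars.\<close>

lemma scalar_relations_trivial:
  fixes c :: "nat \<Rightarrow> 'k::field"
  assumes CM: "cohen_macaulay (gr :: ('a, 'k) graded_family ring)"
    and c: "\<And>i. i < CARD('a) \<Longrightarrow> c i \<noteq> 0 \<Longrightarrow> \<exists>t\<in>sums_ge A n. x = t + e i"
    and rel: "x \<in> sums_ge A (Suc (Suc n)) \<or> (\<Sum>i<CARD('a). c i) = 0"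
  obtains U where "\<And>i j. U i j = - U j i" "\<And>i. U i i = 0"
    "\<And>i j. U i j \<noteq> 0 \<Longrightarrow> \<exists>m t. n = Suc m \<and> t \<in> sums_ge A m \<and> x = t + e i + e j"
    "\<And>i t. i < CARD('a) \<Longrightarrow> t \<in> S \<Longrightarrow> x = t + e i \<Longrightarrow> ord t = n \<Longrightarrow> (\<Sum>j<CARD('a). U i j) = c i"
proof -
  define z where "z i = single (x - e i, n) (c i)" for i
  have yz: "y i * z i = single (x, Suc n) (c i)" if i: "i < CARD('a)" for i
  proof (cases "c i = 0")
    case False
    obtain t where "x = t + e i" using c[OF i False] by blast
    then show ?thesis by (simp add: z_def Poly_Mapping.mult_single add.commute)
  qed (simp add: z_def)
  have single_sum: "(\<Sum>i\<in>X. single (x, Suc n) (c i)) = single (x, Suc n) (sum c X)" for X :: "nat set"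
    by (induction X rule: infinite_finite_induct) (simp_all add: single_add)
  have "(\<Sum>i<CARD('a). y i * z i) = single (x, Suc n) (\<Sum>i<CARD('a). c i)"
    using yz single_sum[of "{..<CARD('a)}"] by simp
  then have zrel: "keys (\<Sum>i<CARD('a). y i * z i) \<subseteq> rees_next"
    using rel by (auto simp: rees_next_def)
  have z: "keys (z i) \<subseteq> rees" if i: "i < CARD('a)" for i
  proof (cases "c i = 0")
    case False
    obtain t where "t \<in> sums_ge A n" "x = t + e i" using c[OF i False] by blast
    then show ?thesis by (simp add: z_def rees_def)
  qed (simp add: z_def)
  obtain u where u: "\<And>i j. keys (u i j) \<subseteq> rees" "\<And>i j. u i j = - u j i" "\<And>i. u i i = 0"
    "\<And>i. i < CARD('a) \<Longrightarrow> keys (z i - (\<Sum>j<CARD('a). y j * u i j)) \<subseteq> rees_next"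
    using gr_relations_trivial[OF CM z zrel] by blast
  define U where "U i j = (if \<exists>t. x = t + e i + e j \<and> n \<noteq> 0 then lookup (u i j) (x - e i - e j, n - 1) else 0)" for i j
  have U_eq: "U i j = lookup (u i j) (t, m)" if "x = t + e i + e j" "n = Suc m" for i j t m
  proof -
    have "x = (t + e j) + e i" using that(1) by (simp add: ac_simps)
    then have "x - e i - e j = t" by simp
    then show ?thesis using that by (auto simp: U_def)
  qed
  show ?thesis
  proof (rule that[of U])
    show "U i i = 0" for i by (simp add: U_def u(3))
    show "U i j = - U j i" for i j
    proof (cases "\<exists>t. x = t + e i + e j \<and> n \<noteq> 0")
      case True
      then obtain t m where t: "x = t + e i + e j" "n = Suc m" by (cases n) auto
      have "x = t + e j + e i" using t(1) by (simp add: ac_simps)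
      then have "U j i = lookup (u j i) (t, m)" using U_eq t(2) by blast
      moreover have "lookup (u i j) (t, m) = - lookup (u j i) (t, m)"
        using arg_cong[OF u(2)[of i j], of "\<lambda>f. lookup f (t, m)"] by simp
      ultimately show ?thesis using U_eq[OF t] by simp
    next
      case False
      then have False': "\<not> (\<exists>t. x = t + e j + e i \<and> n \<noteq> 0)" by (auto simp: ac_simps)
      have "U i j = 0" "U j i = 0"
        unfolding U_def by (rule if_not_P[OF False], rule if_not_P[OF False'])
      then show ?thesis by simp
    qed
    show "\<exists>m t. n = Suc m \<and> t \<in> sums_ge A m \<and> x = t + e i + e j" if ne: "U i j \<noteq> 0" for i j
    proof -
      obtain t where t: "x = t + e i + e j" "n \<noteq> 0" using ne unfolding U_def by presburger
      then obtain m where m: "n = Suc m" by (cases n) auto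
      have "(t, m) \<in> keys (u i j)" using ne U_eq[OF t(1) m] by (simp add: in_keys_iff)
      then have "t \<in> sums_ge A m" using u(1)[of i j] by (auto simp: rees_def)
      then show ?thesis using t(1) m by blast
    qed
    show "(\<Sum>j<CARD('a). U i j) = c i" if i: "i < CARD('a)" and t: "t \<in> S" "x = t + e i" "ord t = n" for i t
    proof -
      have "t \<notin> sums_ge A (Suc n)" using sums_ge_iff_le_ord[OF t(1), of "Suc n"] t(3) by simp
      then have "lookup (z i - (\<Sum>j<CARD('a). y j * u i j)) (t, n) = 0"
        using u(4)[OF i] by (auto simp: rees_next_def in_keys_iff subset_eq)
      then have "lookup (z i) (t, n) = (\<Sum>j<CARD('a). lookup (y j * u i j) (t, n))"
        by (simp add: lookup_minus Poly_Mapping.lookup_sum)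
      also have "\<dots> = (\<Sum>j<CARD('a). U i j)"
      proof (rule sum.cong)
        fix j
        show "lookup (y j * u i j) (t, n) = U i j"
        proof (cases "\<exists>s. x = s + e i + e j \<and> n \<noteq> 0")
          case True
          then obtain s m where s: "x = s + e i + e j" "n = Suc m" by (cases n) auto
          have "t + e i = s + e j + e i" using s(1) t(2) by (simp add: ac_simps)
          then have "t = s + e j" by (rule add_right_imp_eq)
          then have "(t, n) = (e j, 1) + (s, m)" using s(2) by (simp add: ac_simps)
          then show ?thesis using lookup_single_mult[of "(e j, 1)" 1 "u i j" "(s, m)"] U_eq[OF s] by simp
        next
          case False
          have "\<nexists>b. (t, n) = (e j, 1) + b"
          proof
            assume "\<exists>b. (t, n) = (e j, 1) + b"
            then obtain s m where "t = e j + s" "n = 1 + m" by auto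
            then have "x = s + e i + e j \<and> n \<noteq> 0" using t(2) by (simp add: ac_simps)
            then show False using False by blast
          qed
          then have "lookup (y j * u i j) (t, n) = 0" by (rule lookup_single_mult_notin)
          moreover have "U i j = 0" unfolding U_def by (rule if_not_P[OF False])
          ultimately show ?thesis by simp
        qed
      qed simp
      finally show ?thesis using t(2) by (simp add: z_def)
    qed
  qed
qed

text \<open>For a counterexample of minimal order, all row sums of an alternating matrix
  would vanish except one, which is \<open>1\<close>.\<close>

lemma ord_add_extremal:
  assumes CM: "cohen_macaulay (gr :: ('a, 'k::field) graded_family ring)"
    and "s \<in> S" "a \<in> E"
  shows "ord (s + a) = Suc (ord s)"
  using assms(2,3)
proof (induction "ord s" arbitrary: s a rule: less_induct)
  case less
  let ?n = "ord s" and ?x = "s + a"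
  have mono: "Suc (ord t) \<le> ord (t + b)" if "t \<in> S" "b \<in> E" for t b
  proof -
    have b: "b \<in> S" using that(2) E_subset by blast
    have "Suc 0 \<le> ord b" using E_sums_ge_1[OF that(2)] sums_ge_iff_le_ord[OF b] by blast
    then show ?thesis using ord_add_le[OF that(1) b] by simp
  qed
  show ?case
  proof (rule ccontr)
    assume "ord ?x \<noteq> Suc ?n"
    then have "Suc (Suc ?n) \<le> ord ?x" using mono[OF less.prems] by simp
    moreover have "?x \<in> S" using less.prems E_subset nat_span_add by blast
    ultimately have x: "?x \<in> sums_ge A (Suc (Suc ?n))" using sums_ge_iff_le_ord by blast
    obtain i0 where i0: "i0 < CARD('a)" "a = e i0" using E_eq_e[OF less.prems(2)] by blast
    define c :: "nat \<Rightarrow> 'k" where "c i = (if i = i0 then 1 else 0)" for i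
    have s_n: "s \<in> sums_ge A ?n" using sums_ge_iff_le_ord[OF less.prems(1)] by blast
    have csup: "\<exists>t\<in>sums_ge A ?n. ?x = t + e i" if "i < CARD('a)" "c i \<noteq> 0" for i
      using that s_n i0(2) by (auto simp: c_def split: if_splits)
    obtain U where U: "\<And>i j. U i j = - U j i" "\<And>i. U i i = 0"
      "\<And>i j. U i j \<noteq> 0 \<Longrightarrow> \<exists>m t. ?n = Suc m \<and> t \<in> sums_ge A m \<and> ?x = t + e i + e j"
      "\<And>i t. i < CARD('a) \<Longrightarrow> t \<in> S \<Longrightarrow> ?x = t + e i \<Longrightarrow> ord t = ?n \<Longrightarrow> (\<Sum>j<CARD('a). U i j) = c i"
      using scalar_relations_trivial[OF CM csup disjI1[OF x]] by blast
    \<comment> \<open>Entries in positions where the divisor has too large an order are dropped; this does not change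
      the rows of indices \<open>i\<close> whose divisor \<open>?x - e i\<close> has order \<open>?n\<close>, and it empties all other rows, by
      the induction hypothesis.\<close>
    define V where "V i j = (if \<exists>t\<in>S. ?x = t + e i + e j \<and> Suc (ord t) = ?n then U i j else 0)" for i j
    have V_alt: "V i j = - V j i" for i j
    proof -
      have "t + e i + e j = t + e j + e i" for t by (simp add: ac_simps)
      then have C: "(\<exists>t\<in>S. ?x = t + e i + e j \<and> Suc (ord t) = ?n) \<longleftrightarrow>
          (\<exists>t\<in>S. ?x = t + e j + e i \<and> Suc (ord t) = ?n)" by (simp only:)
      define P where "P \<longleftrightarrow> (\<exists>t\<in>S. ?x = t + e j + e i \<and> Suc (ord t) = ?n)"
      have "V i j = (if P then U i j else 0)" "V j i = (if P then U j i else 0)"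
        unfolding V_def C P_def by (rule refl)+
      then show ?thesis using U(1)[of i j] by simp
    qed
    have V_diag: "V i i = 0" for i by (simp add: V_def U(2))
    have row: "(\<Sum>j<CARD('a). V i j) = c i" if i: "i < CARD('a)" for i
    proof (cases "\<exists>t\<in>S. ?x = t + e i \<and> ord t = ?n")
      case True
      then obtain t where t: "t \<in> S" "?x = t + e i" "ord t = ?n" by blast
      have "V i j = U i j" if j: "j < CARD('a)" for j
      proof (cases "U i j = 0")
        case False
        then obtain m v where v: "?n = Suc m" "v \<in> sums_ge A m" "?x = v + e i + e j" using U(3) by blast
        have vS: "v \<in> S" using v(2) sums_ge_subset by blast
        have "t + e i = (v + e j) + e i" using t(2) v(3) by (simp add: ac_simps)
        then have "t = v + e j" by (rule add_right_imp_eq)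
        then have "Suc (ord v) \<le> ?n" using mono[OF vS e_in_E[OF j]] t(3) by simp
        moreover have "m \<le> ord v" using sums_ge_iff_le_ord[OF vS] v(2) by blast
        ultimately show ?thesis using v(1,3) vS by (auto simp: V_def)
      qed (simp add: V_def)
      then have "(\<Sum>j<CARD('a). V i j) = (\<Sum>j<CARD('a). U i j)" by simp
      then show ?thesis using U(4)[OF i t] by simp
    next
      case False
      have "V i j = 0" if j: "j < CARD('a)" for j
      proof (rule ccontr)
        assume "V i j \<noteq> 0"
        then obtain v where v: "v \<in> S" "?x = v + e i + e j" "Suc (ord v) = ?n"
          by (auto simp: V_def split: if_splits)
        have "ord (v + e j) = Suc (ord v)" by (rule less.hyps) (use v e_in_E[OF j] in auto)
        moreover have "v + e j \<in> S" using nat_span_add v(1) e_in_S[OF j] by blast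
        moreover have "?x = (v + e j) + e i" using v(2) by (simp add: ac_simps)
        ultimately have "\<exists>t\<in>S. ?x = t + e i \<and> ord t = ?n"
          using v(3) by (intro bexI[of _ "v + e j"] conjI) simp_all
        then show False using False by blast
      qed
      moreover have "i \<noteq> i0" using False less.prems(1) i0(2) by blast
      ultimately show ?thesis by (simp add: c_def)
    qed
    have "(\<Sum>i<CARD('a). \<Sum>j<CARD('a). V i j) = 0"
      by (rule sum_alternating_eq_0[OF finite_lessThan V_alt V_diag])
    then have "(\<Sum>i<CARD('a). c i) = 0" using row by simp
    then show False using i0(1) by (simp add: c_def)
  qed
qed

text \<open>Fix \<open>x = s + a = t + b\<close>. By induction on the order, the relation ``\<open>x - e\<^sub>i - e\<^sub>j\<close>
  lies in \<open>S\<close>'' between indices is transitive. If it failed between the indices of \<open>a\<close> and \<open>b\<close>, the rows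
  of an alternating matrix over the class of \<open>a\<close> alone would again have total sum \<open>1\<close>.\<close>

lemma extremal_exchange:
  assumes CM: "cohen_macaulay (gr :: ('a, 'k::field) graded_family ring)"
    and "s \<in> S" "t \<in> S" "a \<in> E" "b \<in> E" "a \<noteq> b" "s + a = t + b"
  shows "\<exists>u\<in>S. s = u + b"
  using assms(2-7)
proof (induction "ord s" arbitrary: s t a b rule: less_induct)
  case less
  let ?n = "ord s" and ?x = "s + a"
  note ord_add = ord_add_extremal[OF CM]
  obtain i0 j0 where i0: "i0 < CARD('a)" "a = e i0" and j0: "j0 < CARD('a)" "b = e j0"
    using E_eq_e less.prems(3,4) by blast
  have ij: "i0 \<noteq> j0" using less.prems(5) i0 j0 by auto
  have ord_x: "ord ?x = Suc ?n" by (rule ord_add) (use less.prems in auto)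
  have ordS: "ord v = ?n" if "v \<in> S" "i < CARD('a)" "?x = v + e i" for v i
    using ord_add[OF that(1) e_in_E[OF that(2)]] ord_x that(3) by simp
  define c :: "nat \<Rightarrow> 'k" where "c i = (if i = i0 then 1 else if i = j0 then -1 else 0)" for i
  have s_n: "s \<in> sums_ge A ?n" using sums_ge_iff_le_ord[OF less.prems(1)] by blast
  have t_n: "t \<in> sums_ge A ?n"
    using sums_ge_iff_le_ord[OF less.prems(2)] ordS[OF less.prems(2) j0(1)] less.prems(6) j0(2) by simp
  have csup: "\<exists>v\<in>sums_ge A ?n. ?x = v + e i" if "i < CARD('a)" "c i \<noteq> 0" for i
  proof -
    have "i = i0 \<or> i = j0" using that(2) by (auto simp: c_def split: if_splits)
    then show ?thesis
    proof
      assume "i = i0"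
      then show ?thesis using s_n i0(2) by blast
    next
      assume "i = j0"
      then show ?thesis using t_n j0(2) less.prems(6) by blast
    qed
  qed
  have "(\<Sum>i<CARD('a). c i) = (\<Sum>i<CARD('a). (if i = i0 then 1 else 0) + (if i = j0 then -1 else 0))"
    using ij by (intro sum.cong) (auto simp: c_def)
  also have "\<dots> = 0" using i0(1) j0(1) by (simp add: sum.distrib)
  finally have crel: "(\<Sum>i<CARD('a). c i) = 0" .
  obtain U where U: "\<And>i j. U i j = - U j i" "\<And>i. U i i = 0"
    "\<And>i j. U i j \<noteq> 0 \<Longrightarrow> \<exists>m t. ?n = Suc m \<and> t \<in> sums_ge A m \<and> ?x = t + e i + e j"
    "\<And>i t. i < CARD('a) \<Longrightarrow> t \<in> S \<Longrightarrow> ?x = t + e i \<Longrightarrow> ord t = ?n \<Longrightarrow> (\<Sum>j<CARD('a). U i j) = c i"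
    using scalar_relations_trivial[OF CM csup disjI2[OF crel]] by blast
  \<comment> \<open>the indices joined by a possibly nonzero entry of the matrix\<close>
  define adj where "adj i j \<longleftrightarrow> (\<exists>v\<in>S. ?x = v + e i + e j)" for i j
  have adjU: "adj i j \<and> i \<noteq> j" if "U i j \<noteq> 0" for i j
  proof -
    obtain m v where "v \<in> sums_ge A m" "?x = v + e i + e j" using U(3)[OF \<open>U i j \<noteq> 0\<close>] by blast
    then show ?thesis using sums_ge_subset U(2) that unfolding adj_def by blast
  qed
  have trans: "adj i0 j" if i: "i < CARD('a)" "j < CARD('a)" "adj i0 i" "adj i j" "j \<noteq> i0" for i j
  proof -
    obtain v v' where v: "v \<in> S" "?x = v + e i0 + e i" and v': "v' \<in> S" "?x = v' + e i + e j"
      using i(3,4) unfolding adj_def by blast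
    have "(v + e i0) + e i = (v' + e j) + e i" using v(2) v'(2) by (simp add: ac_simps)
    then have eq: "v + e i0 = v' + e j" by (rule add_right_imp_eq)
    have vi: "v + e i0 \<in> S" using nat_span_add v(1) e_in_S[OF i0(1)] by blast
    have "ord (v + e i0) = ?n" by (rule ordS[OF vi i(1)]) (use v(2) in simp)
    then have "ord v < ?n" using ord_add[OF v(1) e_in_E[OF i0(1)]] by simp
    then have "\<exists>w\<in>S. v = w + e j"
      using less.hyps[OF _ v(1) v'(1) e_in_E[OF i0(1)] e_in_E[OF i(2)] _ eq] e_eq_iff[OF i0(1) i(2)] i(5) by auto
    then obtain w where w: "w \<in> S" "v = w + e j" by blast
    have "?x = (w + e i) + e i0 + e j" using v(2) w(2) by (simp add: ac_simps)
    moreover have "w + e i \<in> S" using nat_span_add w(1) e_in_S[OF i(1)] by blast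
    ultimately show ?thesis unfolding adj_def by blast
  qed
  have "adj i0 j0"
  proof (rule ccontr)
    assume nadj: "\<not> adj i0 j0"
    define W where "W = {i. i < CARD('a) \<and> (i = i0 \<or> adj i0 i)}"
    have finW: "finite W" and W: "W \<subseteq> {..<CARD('a)}" "i0 \<in> W" "j0 \<notin> W"
      using i0(1) ij nadj by (auto simp: W_def)
    have row: "(\<Sum>j\<in>W. U i j) = c i" if i: "i \<in> W" for i
    proof -
      have iC: "i < CARD('a)" using i W(1) by auto
      have "\<exists>v\<in>S. ?x = v + e i"
      proof (cases "i = i0")
        case False
        then obtain v where v: "v \<in> S" "?x = v + e i0 + e i" using i unfolding W_def adj_def by blast
        then show ?thesis using nat_span_add[OF v(1) e_in_S[OF i0(1)]] by blast
      qed (use less.prems(1) i0(2) in blast)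
      then obtain v where v: "v \<in> S" "?x = v + e i" by blast
      have "U i j = 0" if j: "j < CARD('a)" "j \<notin> W" for j
      proof (rule ccontr)
        assume "U i j \<noteq> 0"
        then have adj: "adj i j" using adjU by blast
        have "j \<noteq> i0" using j W(2) by auto
        then have "adj i0 j" using trans[OF iC j(1) _ adj] i adj by (auto simp: W_def)
        then show False using j by (simp add: W_def)
      qed
      then have "(\<Sum>j\<in>W. U i j) = (\<Sum>j<CARD('a). U i j)"
        using W(1) by (intro sum.mono_neutral_left) auto
      then show ?thesis using U(4)[OF iC v(1) v(2) ordS[OF v(1) iC v(2)]] by simp
    qed
    have "(\<Sum>i\<in>W. \<Sum>j\<in>W. U i j) = 0" by (rule sum_alternating_eq_0[OF finW U(1,2)])
    then have "(\<Sum>i\<in>W. c i) = 0" using row by simp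
    moreover have "(\<Sum>i\<in>W. c i) = (\<Sum>i\<in>W. if i = i0 then 1 else 0)"
      using W(3) by (intro sum.cong) (auto simp: c_def)
    ultimately show False using W(2) finW by simp
  qed
  then obtain v where v: "v \<in> S" "?x = v + e i0 + e j0" unfolding adj_def by blast
  then have "s + a = (v + b) + a" using i0(2) j0(2) by (simp add: ac_simps)
  then have "s = v + b" by (rule add_right_imp_eq)
  then show ?case using v(1) by blast
qed

lemma free_over_extremal:
  assumes "cohen_macaulay (gr :: ('a, 'k::field) graded_family ring)"
  shows "free_over A E N e CARD('a)"
proof
  show "bij_betw e {..<CARD('a)} E" by (rule e)
  show "\<And>s a. s \<in> S \<Longrightarrow> a \<in> E \<Longrightarrow> ord (s + a) = Suc (ord s)" by (rule ord_add_extremal[OF assms])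
  show "\<And>s t a b. s \<in> S \<Longrightarrow> t \<in> S \<Longrightarrow> a \<in> E \<Longrightarrow> b \<in> E \<Longrightarrow> a \<noteq> b \<Longrightarrow> s + a = t + b \<Longrightarrow> \<exists>u\<in>S. s = u + b"
    by (rule extremal_exchange[OF assms])
qed

end

section \<open>The bound\<close>

text \<open>The Apery set contains the generators outside \<open>E\<close>, which have order one, and one element of each
  other order up to the largest.\<close>

context free_over
begin

text \<open>An element whose order exceeds all orders in the Apery set is divisible by an element of \<open>E\<close>, and the
  division lowers its order by exactly one.\<close>

lemma reduction_step:
  assumes "\<And>w. w \<in> Apery \<Longrightarrow> ord w \<le> n"
  shows "sums_ge A (Suc n) = {a + t | a t. a \<in> E \<and> t \<in> sums_ge A n}"
proof
  show "sums_ge A (Suc n) \<subseteq> {a + t | a t. a \<in> E \<and> t \<in> sums_ge A n}"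
  proof
    fix s assume s: "s \<in> sums_ge A (Suc n)"
    have sS: "s \<in> S" using s sums_ge_subset by blast
    then have ord_s: "Suc n \<le> ord s" using s sums_ge_iff_le_ord by blast
    then have "s \<notin> Apery" using assms[of s] by auto
    then obtain a t where at: "a \<in> E" "t \<in> S" "s = t + a" using sS unfolding Apery_def by blast
    then have "n \<le> ord t" using ord_add_E[OF at(2,1)] ord_s by simp
    then have "t \<in> sums_ge A n" using sums_ge_iff_le_ord[OF at(2)] by blast
    moreover have "s = a + t" using at(3) by (simp add: add.commute)
    ultimately show "s \<in> {a + t | a t. a \<in> E \<and> t \<in> sums_ge A n}" using at(1) by blast
  qed
  show "{a + t | a t. a \<in> E \<and> t \<in> sums_ge A n} \<subseteq> sums_ge A (Suc n)"
  proof clarify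
    fix a t assume at: "a \<in> E" "t \<in> sums_ge A n"
    have "a \<in> sums_ge A (Suc 0)" using at(1) E_subset zero_notin_E unfolding sums_ge_1 by blast
    from sums_ge_add[OF this at(2)] show "a + t \<in> sums_ge A (Suc n)" by simp
  qed
qed

lemma card_Apery_ge:
  assumes indec: "\<And>a. a \<in> A \<Longrightarrow> a \<notin> sums_ge A 2"
  defines "r \<equiv> max 1 (Max (ord ` Apery))"
  shows "r + card A \<le> card Apery + card E"
proof -
  let ?m = "Max (ord ` Apery)"
  have ne: "ord ` Apery \<noteq> {}" using zero_in_Apery by blast
  have "?m \<in> ord ` Apery" using finite_Apery ne by (intro Max_in) auto
  then obtain w where w: "w \<in> Apery" "ord w = ?m" by auto
  have "\<exists>v\<in>Apery. ord v = k" if "k \<le> ?m" for k using Apery_orders_downward[OF w(1), of k] that w(2) by simp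
  then obtain v where v: "\<And>k. k \<le> ?m \<Longrightarrow> v k \<in> Apery" "\<And>k. k \<le> ?m \<Longrightarrow> ord (v k) = k" by metis
  let ?K = "{..?m} - {1}"
  have inj: "inj_on v ?K" using v(2) by (intro inj_onI) (metis DiffD1 atMost_iff)
  have cardK: "card ?K = r"
  proof (cases "?m = 0")
    case True
    then have "?K = {0}" by auto
    then show ?thesis using True by (simp add: r_def)
  next
    case False
    then have "card ?K = card {..?m} - 1" by (intro card_Diff_singleton) auto
    then show ?thesis using False by (simp add: r_def)
  qed
  have ordA: "ord a = 1" if "a \<in> A" for a
  proof -
    have aS: "a \<in> S" by (rule nat_span_superset[OF that])
    have "1 \<le> ord a" using generator_in_sums_ge_1[OF that] sums_ge_iff_le_ord[OF aS] by blast
    moreover have "\<not> 2 \<le> ord a" using indec[OF that] sums_ge_iff_le_ord[OF aS] by blast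
    ultimately show ?thesis by simp
  qed
  have "A - E \<subseteq> Apery"
  proof
    fix a assume a: "a \<in> A - E"
    have "a \<noteq> s + b" if "b \<in> E" "s \<in> S" for s b
    proof
      assume ab: "a = s + b"
      have b: "b \<in> sums_ge A (Suc 0)" using that(1) E_subset zero_notin_E unfolding sums_ge_1 by blast
      show False
      proof (cases "s = 0")
        case True
        then show False using a ab that(1) by simp
      next
        case False
        then have "s \<in> sums_ge A (Suc 0)" using that(2) unfolding sums_ge_1 by blast
        from sums_ge_add[OF this b] show False using indec[of a] a ab by (simp add: numeral_2_eq_2)
      qed
    qed
    then show "a \<in> Apery" using a nat_span_superset[of a A] unfolding Apery_def by blast
  qed
  moreover have "v ` ?K \<subseteq> Apery" using v(1) by auto
  ultimately have "(A - E) \<union> v ` ?K \<subseteq> Apery" by blast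
  then have "card ((A - E) \<union> v ` ?K) \<le> card Apery" by (rule card_mono[OF finite_Apery])
  moreover have "(A - E) \<inter> v ` ?K = {}"
  proof -
    have "v k \<notin> A - E" if "k \<in> ?K" for k using that v(2)[of k] ordA[of "v k"] by auto
    then show ?thesis by blast
  qed
  then have "card ((A - E) \<union> v ` ?K) = card (A - E) + r"
    using finite_A card_image[OF inj] cardK by (subst card_Un_disjoint) auto
  moreover have "finite E" using e bij_betw_finite finite_lessThan by blast
  then have "card A - card E \<le> card (A - E)" by (rule diff_card_le_card_Diff)
  ultimately show ?thesis by linarith
qed

end

theorem proposition4p6:
  fixes S A :: "(nat ^ 'd) set"
    and R :: "((nat ^ 'd) \<Rightarrow>\<^sub>0 'k::field) ring"
    and M I :: "((nat ^ 'd) \<Rightarrow>\<^sub>0 'k) set"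
  assumes "simplicial_affine_semigroup S"
    and "minimal_generating_set A S"
    and "R = semigroup_ring S"
    and "M = Idl\<^bsub>R\<^esub> (monom_of ` A)"
    and "I = Idl\<^bsub>R\<^esub> (monom_of ` extremal_elements S)"
    and "minimal_reduction_ideal R M I"
    and "cohen_macaulay (assoc_graded R M)"
  shows "ereal (real (reduction_number R M I)) \<le> multiplicity_of CARD('d) R M - codim_of R A"
proof -
  interpret G: nonzero_generators A by (rule minimal_generating_set_nonzero_generators[OF assms(2)])
  let ?E = "extremal_elements S" and ?d = "CARD('d)"
  have S: "S = nat_span A" using assms(2) by (simp add: minimal_generating_set_def)
  have E: "?E \<subseteq> nat_span A" "0 \<notin> ?E" using extremal_elements_subset[of S] S by auto
  have R: "R = semigroup_ring (nat_span A)" using assms(3) S by simp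
  have M: "M = {f. keys f \<subseteq> sums_ge A (Suc 0)}"
    using assms(4) unfolding R G.maximal_ideal_eq .
  have step_iff: "ideal_power R M (n + 1) = ideal_prod R I (ideal_power R M n) \<longleftrightarrow>
      sums_ge A (Suc n) = {a + t | a t. a \<in> ?E \<and> t \<in> sums_ge A n}" for n
    using G.reduction_equation_iff[OF E(1), of n, where 'k = 'k] unfolding assms(5) R M S by blast
  obtain N where N: "\<And>n. N \<le> n \<Longrightarrow> ideal_power R M (n + 1) = ideal_prod R I (ideal_power R M n)"
    using assms(6) unfolding minimal_reduction_ideal_def reduction_ideal_def by blast
  interpret H: reducing_elements A ?E N
  proof
    fix n s assume "N \<le> n" "s \<in> sums_ge A (Suc n)"
    then show "\<exists>a\<in>?E. \<exists>t\<in>sums_ge A n. s = a + t" using N[of n] unfolding step_iff by blast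
  qed (rule E)+
  obtain lam where "coordinates A ?E N lam" using H.coordinates_exist assms(1) unfolding S by blast
  then interpret L: coordinates A ?E N lam .
  obtain e where e: "bij_betw e {..<?d} ?E"
    using ex_bij_betw_nat_finite[OF L.finite_E] L.card_E by (auto simp: atLeast0LessThan)
  interpret X: indexed_coordinates A ?E N lam e by unfold_locales (rule e)
  have CM: "cohen_macaulay (assoc_graded (semigroup_ring (nat_span A))
      {f :: _ \<Rightarrow>\<^sub>0 'k. keys f \<subseteq> sums_ge A (Suc 0)})"
    using assms(7) unfolding R M .
  interpret F: free_over A ?E N e ?d by (rule X.free_over_extremal[OF CM])
  define r where "r = max 1 (Max (G.ord ` H.Apery))"
  have "reduction_number R M I \<le> r"
    unfolding reduction_number_def
  proof (rule Least_le, intro conjI allI impI)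
    show "0 < r" by (simp add: r_def)
    fix n assume n: "r \<le> n"
    have "G.ord w \<le> n" if "w \<in> H.Apery" for w
    proof -
      have "G.ord w \<le> Max (G.ord ` H.Apery)" using H.finite_Apery that by (intro Max_ge) auto
      then show ?thesis using n unfolding r_def by linarith
    qed
    then show "ideal_power R M (n + 1) = ideal_prod R I (ideal_power R M n)"
      unfolding step_iff by (rule F.reduction_step)
  qed
  moreover have "r + card A \<le> card H.Apery + ?d"
    using F.card_Apery_ge minimal_generators_indecomposable[OF assms(2)] L.card_E by (simp add: r_def)
  ultimately have bound: "real (reduction_number R M I) + real (card A) \<le> real (card H.Apery) + real ?d"
    by linarith
  have length: "module_length R (quot_module R (ideal_power R M n)) = enat (card (nat_span A - sums_ge A n))" for n
    unfolding R M G.ideal_power_eq unfolding semigroup_ring_eq_monoid_ring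
    by (rule add_submonoid.length_quotient_monomial_ideal[OF add_submonoid_nat_span, where sz = vec_size])
       (use sums_ge_subset G.sums_ge_absorbs G.finite_not_sums_ge in auto)
  have "(\<lambda>n. ereal (fact ?d / real n ^ ?d) * ereal_of_enat (module_length R (quot_module R (ideal_power R M n))))
      \<longlonglongrightarrow> ereal (real (card H.Apery))"
    using F.hilbert_samuel_limit by (simp add: length)
  then have mult: "multiplicity_of ?d R M = ereal (real (card H.Apery))"
    unfolding multiplicity_of_def by (rule limI)
  \<comment> \<open>The lower bound on the dimension is the direction that bounds the codimension from above.\<close>
  have dim: "enat ?d \<le> krull_dim R" unfolding R by (rule X.krull_dim_ge)
  show ?thesis
  proof (cases "krull_dim R")
    case (enat k)
    then have "real ?d \<le> real k" using dim by simp
    then show ?thesis using bound enat by (simp add: mult codim_of_def)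
  next
    case infinity
    then show ?thesis by (simp add: mult codim_of_def)
  qed
qed

end
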